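(* Let $m\ge2$, let $G(x)=\sum_{j=0}^{m+1}G_{m+1-j}\,x^j$ be a complex polynomial with $G_0\ne0$, and let $g=G_x=\sum_{j=0}^m g_{m-j}x^j$ (polynomial force law of degree $m$). Consider the pendulum $\dot x=y$, $\dot y=g(x)$ on the energy level $H=0$ of $H=H^{xy}=\tfrac12y^2-G(x)$. Then: (i) On the zero energy level, in projective coordinates $u=1/x$, $z=y/x$ with $dt=u^{m-1}dt_1$, and $v=1/y$, $w=x/y$ with $dt=v^{m-1}dt_2$, and with $H^{uz}(u,z)=u^{m+1}H(1/u,z/u)$, $H^{vw}(v,w)=v^{m+1}H(w/v,1/v)$, the ODEs become $$\dot u(t_1)=-u\,H^{uz}_z=-u^mz,\qquad \dot z(t_1)=u\,H^{uz}_u=u^mg(1/u)-u^{m-1}z^2;$$ $$\dot v(t_2)=v\,H^{vw}_w=-v\,v^mg(w/v),\qquad \dot w(t_2)=-v\,H^{vw}_v=v^{m-1}-w\,v^mg(w/v).$$ (ii) The only equilibrium at infinity, i.e. at projective coordinates $[\xi:\eta:0]$, occurs at $v=w=0$, i.e. in the closure of the local leaf or leafs $\mathcal{L}\subset\{H^{vw}=0\}$. For degrees $m\ge3$, the linearization of the $(v,w)$-system vanishes at $v=w=0$. (iii) Local expansions of $\mathcal{L}$ in a complex parameter $\vartheta$ take the analytic form $$v=a\,\vartheta^{m+1}(1+\dots),\qquad w=:\vartheta^{m-1},\qquad a:=\pm(2G_0)^{1/(m-1)},$$ omitting higher order terms in $\vartheta$, where the negative sign only appears for odd $m$. Original time $t$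 is related to $\vartheta$ and $w$ by $$dt=-\tfrac{2}{m-1}(1+\dots)\,dw.$$ (iv) In particular, small loops of $\vartheta\in\mathbb{C}\setminus\{0\}$ around $0$ (for odd $m$, half cycles as specified in (v)) define discrepancy-free minimal blow-up loops $(t,v,w)\in(\gamma^t,\gamma^{vw})$ around blow-up time $t=T=0$ and $v=w=0$ such that $$t(\vartheta)=-\tfrac{2}{m-1}\vartheta^{m-1}(1+\dots),\quad v(\vartheta)=a\,\vartheta^{m+1}(1+\dots),\quad w(\vartheta):=\vartheta^{m-1}.$$ (v) For even $m\ge2$, (iii) defines a single leaf. The blow-up loop $(\gamma^t,\gamma^{vw})$ closes up, first, after one cycle of $\vartheta$, with winding numbers $\mathfrak{w}_t=m-1=\mathfrak{w}_w$ and $\mathfrak{w}_v=m+1$ of $\gamma^t,\gamma^w$ and $\gamma^v$, respectively. For odd $m$, where (iii) defines two leafs $\pm v$, half a cycle of $\vartheta$ is sufficient to close the blow-up loop $(\gamma^t,\gamma^{vw})$ on each leaf, with half those winding numbers. (vi) For either parity of $m$, the closure $\mathcal{R}:=\mathcal{L}\cup\{v=w=0\}$ of any local leaf $\mathcal{L}$ is a Riemann surface with branch point $v=w=0$. The ramification indices over $v$ and $w$ are given by the winding numbers $\mathfrak{w}_v$ and $\mathfrak{w}_w$ of (v), respectively. (vii) For either parity of $m$, with the winding numbers of (v), the blow-up stars in the local leafs $\mathcal{L}\subset\mathcal{R}$ are parametrized, alternatingly, by the $\mathfrak{w}_t=\mathfrak{w}_w$ real analytic blow-up branches and the $\mathfrak{w}_t$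 real analytic blow-down branches of $\vartheta$ (for odd $m$, within the half cycle of (v)) in the expansion of $t(\vartheta)$ in (iv), along which $t$ is real with $t\le T$ and $t\ge T$, respectively.
   Context: Homogeneous coordinates on $\mathbb{CP}^2$ are $[\xi:\eta:\zeta]=[x:y:1]=[1:z:u]=[w:1:v]$; infinity is $\zeta=0$, i.e. $u=0$ or $v=0$. A local leaf $\mathcal{L}$ here is a nonstationary orbit in complex time, near $v=w=0$, within the energy surface $\{H^{vw}=0\}$. Subscripts of $H^{uz},H^{vw}$ denote partial derivatives. Blow-up: $(v,w)\to(0,0)$ as $t\to T=0$ in finite original time. Blow-up loop: let $\gamma^t:[0,2\pi]\to\mathbb{C}\setminus\{T\}$, $s\mapsto t(s)$, be a closed curve near $T$ with nonzero (without loss of generality positive) winding number around $T$; let $\gamma^{vw}(s)=(v(t(s)),w(t(s)))\in\mathcal{L}$ be the solution continued along it. $(\gamma^t,\gamma^{vw})$ is a (discrepancy-free) blow-up loop if $\gamma^{vw}(2\pi)=\gamma^{vw}(0)$; it is minimal if the winding number of $\gamma^t$ is minimal among all blow-up loops in the local leaf. $\gamma^v,\gamma^w$ are the components of $\gamma^{vw}$. $\mathfrak{w}_t,\mathfrak{w}_v,\mathfrak{w}_w$ are the winding numbers of $\gamma^t,\gamma^v,\gamma^w$ around $T=0$, $v=0$, $w=0$. Real-time blow-up star of a minimal blow-up loop of winding number $\mathfrak{w}_t$ in $\mathcal{L}$: the collection of all $\mathfrak{w}_t$ blow-up branches (real $t\nearrow T$) and all $\mathfrak{w}_t$ blow-down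 branches (real $t\searrow T$) of solutions, alternating in $\mathcal{L}$.
   Formalization: For m ≡ 1 mod 4 the coefficients a and -a give the same leaf (e.g. m=5, G=x^6), so "two leafs ±v" is corrected: all roots a^(m-1)=2G_0 are allowed, and for odd m the two leafs are distinguished by a^((m-1)/2)=±√(2G_0); the literal ±a is kept for m ≡ 3 mod 4. *)

theory Defs
  imports
    "HOL-Complex_Analysis.Complex_Analysis"
    "HOL-Computational_Algebra.Polynomial"
    "HOL-Library.Disjoint_Sets"
begin

text \<open>
  The potential is a complex polynomial \<open>G\<close> of degree exactly \<open>m + 1\<close>. In the notation
  \<open>G(x) = \<Sum>j\<le>m+1. G\<^sub>m\<^sub>+\<^sub>1\<^sub>-\<^sub>j x^j\<close> the number \<open>G\<^sub>0\<close> is \<open>lead_coeff G\<close>, and the force law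
  is \<open>g = pderiv G\<close>.
\<close>

section \<open>The pendulum in the three coordinate charts\<close>

definition Hxy :: "complex poly \<Rightarrow> complex \<Rightarrow> complex \<Rightarrow> complex" where
  "Hxy G x y = y^2 / 2 - poly G x"

definition pendulum_solution ::
    "complex poly \<Rightarrow> complex set \<Rightarrow> (complex \<Rightarrow> complex) \<Rightarrow> (complex \<Rightarrow> complex) \<Rightarrow> bool" where
  "pendulum_solution G S x y \<longleftrightarrow>
     (\<forall>t\<in>S. (x has_field_derivative y t) (at t) \<and>
            (y has_field_derivative poly (pderiv G) (x t)) (at t))"

text \<open>
  \<open>homogenize n p v w\<close> is the polynomial \<open>v^n p(w/v)\<close>, including its values at \<open>v = 0\<close>
  (where the quotient itself would be meaningless).
\<close>
definition homogenize :: "nat \<Rightarrow> complex poly \<Rightarrow> complex \<Rightarrow> complex \<Rightarrow> complex" where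
  "homogenize n p v w = (\<Sum>j\<le>n. coeff p j * w^j * v^(n - j))"

text \<open>
  Polynomial extensions to \<open>u = 0\<close> and \<open>v = 0\<close> of \<open>u^(m+1) H(1/u, z/u)\<close> and
  \<open>v^(m+1) H(w/v, 1/v)\<close>.
\<close>
definition Huz :: "nat \<Rightarrow> complex poly \<Rightarrow> complex \<Rightarrow> complex \<Rightarrow> complex" where
  "Huz m G u z = u^(m-1) * z^2 / 2 - homogenize (m+1) G u 1"

definition Hvw :: "nat \<Rightarrow> complex poly \<Rightarrow> complex \<Rightarrow> complex \<Rightarrow> complex" where
  "Hvw m G v w = v^(m-1) / 2 - homogenize (m+1) G v w"

definition uz_field :: "nat \<Rightarrow> complex poly \<Rightarrow> complex \<times> complex \<Rightarrow> complex \<times> complex" where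
  "uz_field m G = (\<lambda>(u, z). (- (u^m * z), homogenize m (pderiv G) u 1 - u^(m-1) * z^2))"

definition vw_field :: "nat \<Rightarrow> complex poly \<Rightarrow> complex \<times> complex \<Rightarrow> complex \<times> complex" where
  "vw_field m G = (\<lambda>(v, w). (- v * homogenize m (pderiv G) v w,
                              v^(m-1) - w * homogenize m (pderiv G) v w))"


section \<open>Local leafs\<close>

text \<open>
  Two points of \<open>U\<close> are joined if they lie on one holomorphic solution (over a connected open
  set of complex times \<open>t\<^sub>2\<close>) of the \<open>(v,w)\<close>-system on the zero energy level inside \<open>U\<close>.
  Continuation of solutions along paths in complex time may be multivalued in time, so the
  orbit in \<open>U\<close> is the set of points reachable by finite chains of such solutions.
\<close>
definition joined_by_solution ::
    "nat \<Rightarrow> complex poly \<Rightarrow> (complex \<times> complex) set \<Rightarrow> complex \<times> complex \<Rightarrow> complex \<times> complex \<Rightarrow> bool"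
  where
  "joined_by_solution m G U p q \<longleftrightarrow>
     (\<exists>S v w. open S \<and> connected S \<and>
        (\<forall>\<tau>\<in>S. (v \<tau>, w \<tau>) \<in> U \<and> Hvw m G (v \<tau>) (w \<tau>) = 0 \<and>
           (v has_field_derivative fst (vw_field m G (v \<tau>, w \<tau>))) (at \<tau>) \<and>
           (w has_field_derivative snd (vw_field m G (v \<tau>, w \<tau>))) (at \<tau>)) \<and>
        p \<in> (\<lambda>\<tau>. (v \<tau>, w \<tau>)) ` S \<and> q \<in> (\<lambda>\<tau>. (v \<tau>, w \<tau>)) ` S)"

definition local_leaf ::
    "nat \<Rightarrow> complex poly \<Rightarrow> (complex \<times> complex) set \<Rightarrow> (complex \<times> complex) set \<Rightarrow> bool" where
  "local_leaf m G U L \<longleftrightarrow>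
     (\<exists>p\<in>U. Hvw m G (fst p) (snd p) = 0 \<and> vw_field m G p \<noteq> 0 \<and>
            L = {q. (joined_by_solution m G U)\<^sup>*\<^sup>* p q})"

text \<open>
  \<open>t\<close> is original time along the parametrized curve \<open>(v, w)\<close>: in the original coordinates
  \<open>x = w/v\<close>, \<open>y = 1/v\<close> one has \<open>dx = y dt\<close> and \<open>dy = g(x) dt\<close>.
\<close>
definition original_time_along ::
    "complex poly \<Rightarrow> complex set \<Rightarrow> (complex \<Rightarrow> complex) \<Rightarrow> (complex \<Rightarrow> complex \<times> complex) \<Rightarrow> bool" where
  "original_time_along G D t P \<longleftrightarrow>
     (\<forall>\<theta>\<in>D. fst (P \<theta>) \<noteq> 0 \<and>
        ((\<lambda>\<theta>. snd (P \<theta>) / fst (P \<theta>)) has_field_derivative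
            (1 / fst (P \<theta>)) * deriv t \<theta>) (at \<theta>) \<and>
        ((\<lambda>\<theta>. 1 / fst (P \<theta>)) has_field_derivative
            poly (pderiv G) (snd (P \<theta>) / fst (P \<theta>)) * deriv t \<theta>) (at \<theta>))"


section \<open>Blow-up loops\<close>

text \<open>
  \<open>\<gamma>\<close> is the continuation of a solution of the pendulum, written in \<open>(v,w)\<close>-coordinates and
  in original complex time, along the curve \<open>\<gamma>t\<close> of times: near each parameter \<open>s\<close> it is
  \<open>(v, w) \<circ> \<gamma>t\<close> for a solution \<open>(v, w)\<close> holomorphic near \<open>\<gamma>t s\<close>.
\<close>
definition continued_along ::
    "complex poly \<Rightarrow> real set \<Rightarrow> (real \<Rightarrow> complex) \<Rightarrow> (real \<Rightarrow> complex \<times> complex) \<Rightarrow> bool" where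
  "continued_along G I \<gamma>t \<gamma> \<longleftrightarrow>
     continuous_on I \<gamma>t \<and>
     (\<forall>s\<in>I. \<exists>r>0. \<exists>d>0. \<exists>v w.
        (\<forall>t\<in>ball (\<gamma>t s) r. v t \<noteq> 0) \<and>
        pendulum_solution G (ball (\<gamma>t s) r) (\<lambda>t. w t / v t) (\<lambda>t. 1 / v t) \<and>
        (\<forall>s'\<in>I. \<bar>s' - s\<bar> < d \<longrightarrow>
           \<gamma>t s' \<in> ball (\<gamma>t s) r \<and> \<gamma> s' = (v (\<gamma>t s'), w (\<gamma>t s'))))"

text \<open>
  The solution in \<open>L\<close> with value \<open>p\<close> at time \<open>t\<^sub>0\<close> blows up at time \<open>T = 0\<close>: it can be continued
  inside \<open>L\<close> along some curve of times which tends to \<open>0\<close>, such that \<open>(v, w) \<rightarrow> (0, 0)\<close>. (The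
  pendulum is autonomous; this condition is what ties the normalization \<open>T = 0\<close> to the
  blow-up.)
\<close>
definition blows_up_at_0 ::
    "complex poly \<Rightarrow> (complex \<times> complex) set \<Rightarrow> complex \<Rightarrow> complex \<times> complex \<Rightarrow> bool" where
  "blows_up_at_0 G L t0 p \<longleftrightarrow>
     (\<exists>\<sigma>t \<sigma>. continued_along G {0..<1} \<sigma>t \<sigma> \<and> \<sigma> ` {0..<1} \<subseteq> L \<and> \<sigma>t 0 = t0 \<and> \<sigma> 0 = p \<and>
        (\<sigma>t \<longlongrightarrow> 0) (at_left 1) \<and> (\<sigma> \<longlongrightarrow> (0, 0)) (at_left 1))"

text \<open>
  Discrepancy-free blow-up loops around \<open>T = 0\<close>. As usual for paths in the library, closed
  curves are parametrized over \<open>[0, 1]\<close> instead of \<open>[0, 2\<pi>]\<close>.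
\<close>
definition blowup_loop ::
    "complex poly \<Rightarrow> (complex \<times> complex) set \<Rightarrow> (real \<Rightarrow> complex) \<Rightarrow> (real \<Rightarrow> complex \<times> complex) \<Rightarrow> bool"
  where
  "blowup_loop G L \<gamma>t \<gamma> \<longleftrightarrow>
     path \<gamma>t \<and> pathfinish \<gamma>t = pathstart \<gamma>t \<and> 0 \<notin> path_image \<gamma>t \<and>
     Re (winding_number \<gamma>t 0) > 0 \<and>
     continued_along G {0..1} \<gamma>t \<gamma> \<and> \<gamma> ` {0..1} \<subseteq> L \<and>
     blows_up_at_0 G L (\<gamma>t 0) (\<gamma> 0) \<and>
     \<gamma> 1 = \<gamma> 0"

definition minimal_blowup_loop ::
    "complex poly \<Rightarrow> (complex \<times> complex) set \<Rightarrow> (real \<Rightarrow> complex) \<Rightarrow> (real \<Rightarrow> complex \<times> complex) \<Rightarrow> bool"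
  where
  "minimal_blowup_loop G L \<gamma>t \<gamma> \<longleftrightarrow>
     blowup_loop G L \<gamma>t \<gamma> \<and>
     (\<forall>\<gamma>t' \<gamma>'. blowup_loop G L \<gamma>t' \<gamma>' \<longrightarrow>
        Re (winding_number \<gamma>t 0) \<le> Re (winding_number \<gamma>t' 0))"

text \<open>The asserted values of the winding numbers of \<open>\<gamma>t\<close> (and \<open>\<gamma>w\<close>) and of \<open>\<gamma>v\<close>.\<close>
definition wind_t :: "nat \<Rightarrow> nat" where
  "wind_t m = (if even m then m - 1 else (m - 1) div 2)"

definition wind_v :: "nat \<Rightarrow> nat" where
  "wind_v m = (if even m then m + 1 else (m + 1) div 2)"


section \<open>Riemann surfaces and ramification\<close>

text \<open>A connected Hausdorff space with a holomorphic atlas; a chart is a pair of its domain and its map.\<close>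
definition riemann_surface ::
    "'a::t2_space set \<Rightarrow> ('a set \<times> ('a \<Rightarrow> complex)) set \<Rightarrow> bool" where
  "riemann_surface X A \<longleftrightarrow>
     X \<noteq> {} \<and> connected X \<and> (\<Union>(V, \<psi>)\<in>A. V) = X \<and>
     (\<forall>(V, \<psi>)\<in>A. openin (top_of_set X) V \<and> open (\<psi> ` V) \<and>
        homeomorphism V (\<psi> ` V) \<psi> (inv_into V \<psi>)) \<and>
     (\<forall>(V, \<psi>)\<in>A. \<forall>(V', \<psi>')\<in>A. (\<psi>' \<circ> inv_into V \<psi>) holomorphic_on \<psi> ` (V \<inter> V'))"

definition holomorphic_in_charts ::
    "('a set \<times> ('a \<Rightarrow> complex)) set \<Rightarrow> ('a \<Rightarrow> complex) \<Rightarrow> bool" where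
  "holomorphic_in_charts A f \<longleftrightarrow> (\<forall>(V, \<psi>)\<in>A. (f \<circ> inv_into V \<psi>) holomorphic_on \<psi> ` V)"

text \<open>The multiplicity with which \<open>f\<close> takes the value \<open>f p\<close> at \<open>p\<close>.\<close>
definition has_ramification_index ::
    "('a set \<times> ('a \<Rightarrow> complex)) set \<Rightarrow> ('a \<Rightarrow> complex) \<Rightarrow> 'a \<Rightarrow> nat \<Rightarrow> bool" where
  "has_ramification_index A f p n \<longleftrightarrow>
     (\<exists>(V, \<psi>)\<in>A. p \<in> V) \<and>
     (\<forall>(V, \<psi>)\<in>A. p \<in> V \<longrightarrow> zorder (\<lambda>\<zeta>. f (inv_into V \<psi> \<zeta>) - f p) (\<psi> p) = int n)"

definition branch_point ::
    "('a set \<times> ('a \<Rightarrow> complex)) set \<Rightarrow> ('a \<Rightarrow> complex) \<Rightarrow> 'a \<Rightarrow> bool" where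
  "branch_point A f p \<longleftrightarrow> (\<exists>n>1. has_ramification_index A f p n)"


section \<open>Real-time blow-up stars\<close>

definition real_time_solution ::
    "complex poly \<Rightarrow> (complex \<times> complex) set \<Rightarrow> real set \<Rightarrow> (real \<Rightarrow> complex \<times> complex) \<Rightarrow> bool" where
  "real_time_solution G L I \<phi> \<longleftrightarrow>
     (\<forall>s\<in>I. \<phi> s \<in> L \<and> fst (\<phi> s) \<noteq> 0 \<and>
        ((\<lambda>s. snd (\<phi> s) / fst (\<phi> s)) has_vector_derivative (1 / fst (\<phi> s))) (at s) \<and>
        ((\<lambda>s. 1 / fst (\<phi> s)) has_vector_derivative
            poly (pderiv G) (snd (\<phi> s) / fst (\<phi> s))) (at s))"

text \<open>
  The branches, as subsets of \<open>L\<close>, of the real-time blow-up star at \<open>T = 0\<close>, cut off at times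
  \<open>\<bar>t\<bar> < \<epsilon>\<close>.
\<close>
definition blowup_branches ::
    "complex poly \<Rightarrow> (complex \<times> complex) set \<Rightarrow> real \<Rightarrow> (complex \<times> complex) set set" where
  "blowup_branches G L \<epsilon> =
     {\<phi> ` {-\<epsilon><..<0} | \<phi>. real_time_solution G L {-\<epsilon><..<0} \<phi> \<and> (\<phi> \<longlongrightarrow> (0, 0)) (at_left 0)}"

definition blowdown_branches ::
    "complex poly \<Rightarrow> (complex \<times> complex) set \<Rightarrow> real \<Rightarrow> (complex \<times> complex) set set" where
  "blowdown_branches G L \<epsilon> =
     {\<phi> ` {0<..<\<epsilon>} | \<phi>. real_time_solution G L {0<..<\<epsilon>} \<phi> \<and> (\<phi> \<longlongrightarrow> (0, 0)) (at_right 0)}"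

end

theory Submission
  imports Defs
begin

text \<open>
  On the zero energy level \<open>y\<^sup>2 = 2 G(x)\<close>, so near infinity everything is a function of
  \<open>s = v/w = 1/x\<close>. With the reflected polynomial \<open>\<Gamma>(s) = s\<^sup>m\<^sup>+\<^sup>1 G(1/s)\<close> the level curve reads
  \<open>s\<^sup>m\<^sup>-\<^sup>1 = 2 w\<^sup>2 \<Gamma>(s)\<close>. Since \<open>\<Gamma>(0) = G\<^sub>0\<close> is not \<open>0\<close>, near \<open>s = 0\<close> one has \<open>\<Gamma> = G\<^sub>0 F\<^sup>m\<^sup>-\<^sup>1\<close> with
  \<open>F(0) = 1\<close>. For \<open>w = \<theta>\<^sup>m\<^sup>-\<^sup>1\<close> and a coefficient \<open>a\<close> with \<open>a\<^sup>m\<^sup>-\<^sup>1 = 2 G\<^sub>0\<close> the curve becomes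
  \<open>s = a \<theta>\<^sup>2 F(s)\<close>, which is solved by an injective germ \<open>s = S(a \<theta>\<^sup>2)\<close>. This gives the expansion
  \<open>v = w s = a \<theta>\<^sup>m\<^sup>+\<^sup>1 F(S(a \<theta>\<^sup>2))\<close>, and every point of the curve near the origin is of this form
  (\<open>level_param\<close>). The choice of \<open>\<theta>\<close> is free up to a root of unity \<open>c\<close> with \<open>c\<^sup>m\<^sup>-\<^sup>1 = 1\<close>, which changes
  \<open>a\<close> by a factor \<open>c\<^sup>2\<close> (\<open>leaf_eq_iff\<close>). For even \<open>m\<close> every such root is a square, and there is one
  curve; for odd \<open>m\<close> half of them are, and there are two, each a function of \<open>\<theta>\<^sup>2\<close>.

  The second ingredient is time. From \<open>dt = dx/y\<close> the ratio \<open>t/w\<close> satisfies a linear differential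
  equation in \<open>s\<close> with a regular singular point at \<open>s = 0\<close>. Its regular solution yields a
  single-valued function \<open>blowup_time\<close> on the level curve which grows at unit speed along every
  solution, complex or real (\<open>blowup_time_along\<close>), and which is \<open>- 2/(m-1) w\<close> to leading order. The
  remaining claims are consequences.

  Orbits: time is a local parameter of the punctured curve, so points of one curve are joined by
  solutions; a solution cannot leave its curve, because the curves are disjoint and relatively
  closed, and \<open>v = 0\<close> is invariant. Hence the curves are the local leafs (\<open>local_leaf_iff\<close>).

  Loops: the condition that the blow-up happens at \<open>T = 0\<close> identifies time with \<open>blowup_time\<close> along
  any blow-up loop. Time thus winds like \<open>w\<close>, and \<open>w\<^sup>2\<close> winds like \<open>s\<^sup>m\<^sup>-\<^sup>1\<close> with an integer winding
  number of \<open>s\<close>. This bounds the winding numbers of all blow-up loops from below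
  (\<open>blowup_loop_winding\<close>), and a full or half cycle of \<open>\<theta>\<close> attains the bound (\<open>param_loop\<close>).

  Riemann surface: \<open>\<theta>\<close> for even \<open>m\<close>, and \<open>\<theta>\<^sup>2\<close> for odd \<open>m\<close>, is a global coordinate on the closure of a
  leaf (\<open>closure_leaf_riemann_surface\<close>).

  Star: in a suitable coordinate \<open>\<sigma>\<close> near \<open>\<theta> = 0\<close> one has \<open>t = - 2/(m-1) \<sigma>\<^sup>m\<^sup>-\<^sup>1\<close>, so time is real on
  \<open>2 (m - 1)\<close> rays with alternating sign. A real solution that blows up at \<open>0\<close> has
  \<open>blowup_time\<close> equal to its own time, so it moves on these rays, and by connectedness on one of
  them (\<open>solution_is_branch\<close>).
\<close>

section \<open>The two charts at infinity\<close>

lemma homogenize_eq: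
  assumes "v \<noteq> 0" "degree p \<le> n"
  shows "homogenize n p v w = v^n * poly p (w / v)"
proof -
  have "poly p (w / v) = (\<Sum>j\<le>n. coeff p j * (w / v)^j)"
    unfolding poly_altdef by (rule sum.mono_neutral_left) (use assms in \<open>auto simp: coeff_eq_0\<close>)
  hence "v^n * poly p (w / v) = (\<Sum>j\<le>n. v^n * (coeff p j * (w / v)^j))"
    by (simp add: sum_distrib_left)
  also have "\<dots> = homogenize n p v w"
    unfolding homogenize_def using assms(1)
    by (intro sum.cong refl) (simp add: power_diff power_divide field_simps)
  finally show ?thesis ..
qed

lemma homogenize_0: "homogenize n p 0 w = coeff p n * w^n"
proof -
  have "homogenize n p 0 w = (\<Sum>j\<le>n. if j = n then coeff p n * w^n else 0)"
    unfolding homogenize_def by (intro sum.cong refl) (auto simp: power_0_left)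
  thus ?thesis by simp
qed

text \<open>
  The partial derivative of \<open>v\<^sup>m\<^sup>+\<^sup>1 G(w/v)\<close> by \<open>w\<close> is homogeneous of degree \<open>m\<close> and belongs to \<open>G'\<close>;
  this is how the force enters both vector fields.
\<close>
lemma homogenize_pderiv:
  "homogenize m (pderiv G) v w = (\<Sum>j\<le>m+1. coeff G j * (of_nat j * w^(j-1)) * v^(m+1-j))"
proof -
  have "(\<Sum>j\<le>m+1. coeff G j * (of_nat j * w^(j-1)) * v^(m+1-j))
      = (\<Sum>j\<le>Suc m. coeff G j * (of_nat j * w^(j-1)) * v^(Suc m-j))" by simp
  also have "\<dots> = (\<Sum>j\<le>m. coeff G (Suc j) * (of_nat (Suc j) * w^j) * v^(m-j))"
    unfolding sum.atMost_Suc_shift by simp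
  also have "\<dots> = homogenize m (pderiv G) v w"
    unfolding homogenize_def by (intro sum.cong refl) (simp add: coeff_pderiv algebra_simps)
  finally show ?thesis by simp
qed

lemma homogenize_has_derivative_w:
  "((\<lambda>w. homogenize (m+1) G v w) has_field_derivative homogenize m (pderiv G) v w) (at w)"
  unfolding homogenize_pderiv unfolding homogenize_def
  by (rule DERIV_sum) (auto intro!: derivative_eq_intros)

lemma homogenize_has_derivative_v:
  "((\<lambda>v. homogenize n p v w) has_field_derivative
     (\<Sum>j\<le>n. coeff p j * w^j * (of_nat (n - j) * v^(n - j - 1)))) (at v)"
  unfolding homogenize_def
  by (rule DERIV_sum) (auto intro!: derivative_eq_intros)

text \<open>Euler's relation for the homogeneous polynomial \<open>v\<^sup>m\<^sup>+\<^sup>1 G(w/v)\<close> of degree \<open>m + 1\<close>.\<close>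
lemma homogenize_euler:
  "v * (\<Sum>j\<le>m+1. coeff G j * w^j * (of_nat (m+1 - j) * v^(m+1 - j - 1)))
     + w * homogenize m (pderiv G) v w = of_nat (m+1) * homogenize (m+1) G v w"
proof -
  have *: "x * (of_nat k * x^(k-1)) = of_nat k * x^k" for x :: complex and k
    by (cases k) auto
  have "v * (\<Sum>j\<le>m+1. coeff G j * w^j * (of_nat (m+1 - j) * v^(m+1 - j - 1)))
     + w * homogenize m (pderiv G) v w =
     (\<Sum>j\<le>m+1. coeff G j * w^j * (v * (of_nat (m+1 - j) * v^(m+1 - j - 1))) +
                coeff G j * (w * (of_nat j * w^(j-1))) * v^(m+1-j))"
    unfolding homogenize_pderiv sum_distrib_left sum.distrib[symmetric]
    by (intro sum.cong refl) (simp add: algebra_simps)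
  also have "\<dots> = (\<Sum>j\<le>m+1. of_nat (m+1) * (coeff G j * w^j * v^(m+1-j)))"
  proof (intro sum.cong refl)
    fix j assume "j \<in> {..m+1}"
    hence "(of_nat (m+1) :: complex) = of_nat (m+1-j) + of_nat j"
      by (simp flip: of_nat_add)
    thus "coeff G j * w^j * (v * (of_nat (m+1 - j) * v^(m+1 - j - 1))) +
                coeff G j * (w * (of_nat j * w^(j-1))) * v^(m+1-j) =
          of_nat (m+1) * (coeff G j * w^j * v^(m+1-j))"
      unfolding * by (simp only: algebra_simps)
  qed
  also have "\<dots> = of_nat (m+1) * homogenize (m+1) G v w"
    by (simp only: homogenize_def sum_distrib_left)
  finally show ?thesis .
qed

lemma Huz_eq:
  assumes "m \<ge> 2" "degree G = m + 1" "u \<noteq> 0"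
  shows "Huz m G u z = u^(m+1) * Hxy G (1/u) (z/u)"
proof -
  have "u^(m+1) = u^(m-1) * u^2" using assms(1) by (simp flip: power_add)
  thus ?thesis using assms
    by (simp add: Huz_def Hxy_def homogenize_eq power_divide right_diff_distrib)
qed

lemma Hvw_eq:
  assumes "m \<ge> 2" "degree G = m + 1" "v \<noteq> 0"
  shows "Hvw m G v w = v^(m+1) * Hxy G (w/v) (1/v)"
proof -
  have "v^(m+1) = v^(m-1) * v^2" using assms(1) by (simp flip: power_add)
  thus ?thesis using assms
    by (simp add: Hvw_def Hxy_def homogenize_eq power_divide right_diff_distrib)
qed

text \<open>
  Away from the zero level \<open>u \<partial>H/\<partial>u\<close> differs from the second component by a multiple of \<open>H\<close>: Euler's
  relation produces \<open>(m + 1) H\<close>, which vanishes here. The same holds in the other chart.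
\<close>
lemma uz_field_hamiltonian:
  assumes m: "m \<ge> 2" and H: "Huz m G u z = 0"
  shows "uz_field m G (u, z) = (- u * deriv (\<lambda>z. Huz m G u z) z, u * deriv (\<lambda>u. Huz m G u z) u)"
proof -
  obtain n where n: "m = Suc (Suc n)" using m by (metis add_2_eq_Suc less_eqE)
  let ?D = "\<Sum>j\<le>m+1. coeff G j * 1^j * (of_nat (m+1 - j) * u^(m+1 - j - 1))"
  have 1: "deriv (\<lambda>z. Huz m G u z) z = u^(m-1) * z"
    unfolding Huz_def by (rule DERIV_imp_deriv) (auto intro!: derivative_eq_intros)
  have 2: "deriv (\<lambda>u. Huz m G u z) u = of_nat (m-1) * u^(m-2) * z^2 / 2 - ?D"
    unfolding Huz_def
    by (rule DERIV_imp_deriv)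
       (rule derivative_eq_intros homogenize_has_derivative_v refl | simp add: numeral_2_eq_2[symmetric])+
  have E: "u * ?D = of_nat (m+1) * homogenize (m+1) G u 1 - homogenize m (pderiv G) u 1"
    using homogenize_euler[where v=u and m=m and G=G and w=1] by (simp only: mult_1 eq_diff_eq)
  have "homogenize (m+1) G u 1 = u^(m-1) * z^2 / 2" using H by (simp add: Huz_def)
  hence "u * deriv (\<lambda>u. Huz m G u z) u = homogenize m (pderiv G) u 1 - u^(m-1) * z^2"
    unfolding 2 right_diff_distrib E by (simp add: n field_simps)
  thus ?thesis unfolding 1 by (simp add: uz_field_def n)
qed

lemma vw_field_hamiltonian:
  assumes m: "m \<ge> 2" and H: "Hvw m G v w = 0"
  shows "vw_field m G (v, w) = (v * deriv (\<lambda>w. Hvw m G v w) w, - v * deriv (\<lambda>v. Hvw m G v w) v)"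
proof -
  obtain n where n: "m = Suc (Suc n)" using m by (metis add_2_eq_Suc less_eqE)
  let ?D = "\<Sum>j\<le>m+1. coeff G j * w^j * (of_nat (m+1 - j) * v^(m+1 - j - 1))"
  have 1: "deriv (\<lambda>w. Hvw m G v w) w = - homogenize m (pderiv G) v w"
    unfolding Hvw_def
    by (rule DERIV_imp_deriv) (auto intro!: derivative_eq_intros homogenize_has_derivative_w[simplified])
  have 2: "deriv (\<lambda>v. Hvw m G v w) v = of_nat (m-1) * v^(m-2) / 2 - ?D"
    unfolding Hvw_def
    by (rule DERIV_imp_deriv)
       (rule derivative_eq_intros homogenize_has_derivative_v refl | simp add: numeral_2_eq_2[symmetric])+
  have E: "v * ?D = of_nat (m+1) * homogenize (m+1) G v w - w * homogenize m (pderiv G) v w"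
    using homogenize_euler[where v=v and m=m and G=G and w=w] by (simp only: eq_diff_eq)
  have "homogenize (m+1) G v w = v^(m-1) / 2" using H by (simp add: Hvw_def)
  hence "v * deriv (\<lambda>v. Hvw m G v w) v = w * homogenize m (pderiv G) v w - v^(m-1)"
    unfolding 2 right_diff_distrib E by (simp add: n field_simps)
  thus ?thesis unfolding 1 by (simp add: vw_field_def n)
qed

text \<open>
  A change of the time variable is locally invertible, so derivatives may be transported in
  both directions.
\<close>
lemma has_field_derivative_time_change_iff:
  fixes f t :: "complex \<Rightarrow> complex"
  assumes S: "open S" "inj_on t S" "s \<in> S"
    and t: "\<And>s. s \<in> S \<Longrightarrow> (t has_field_derivative t' s) (at s)"
  shows "(f has_field_derivative D) (at (t s)) \<longleftrightarrow>
         ((\<lambda>s. f (t s)) has_field_derivative D * t' s) (at s)"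
proof
  assume "(f has_field_derivative D) (at (t s))"
  thus "((\<lambda>s. f (t s)) has_field_derivative D * t' s) (at s)"
    by (rule DERIV_chain2) (use t S in auto)
next
  assume R: "((\<lambda>s. f (t s)) has_field_derivative D * t' s) (at s)"
  have hol: "t holomorphic_on S"
    using t S(1) by (auto simp: holomorphic_on_open)
  obtain g where g: "g holomorphic_on (t ` S)"
     "\<And>z. z \<in> S \<Longrightarrow> deriv t z * deriv g (t z) = 1" "\<And>z. z \<in> S \<Longrightarrow> g (t z) = z"
    using holomorphic_has_inverse[OF hol S(1,2)] by blast
  have op: "open (t ` S)" by (rule open_mapping_thm3[OF hol S(1,2)])
  have ts: "t s \<in> t ` S" using S by auto
  have dg: "(g has_field_derivative deriv g (t s)) (at (t s))"
    using holomorphic_derivI[OF g(1) op ts] .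
  have "((\<lambda>s. f (t s)) has_field_derivative D * t' s) (at (g (t s)))"
    using R g(3)[OF S(3)] by simp
  from DERIV_chain2[OF this dg]
  have "((\<lambda>\<tau>. f (t (g \<tau>))) has_field_derivative D * t' s * deriv g (t s)) (at (t s))" .
  moreover have "t' s * deriv g (t s) = 1"
    using g(2)[OF S(3)] DERIV_imp_deriv[OF t[OF S(3)]] by simp
  ultimately have "((\<lambda>\<tau>. f (t (g \<tau>))) has_field_derivative D) (at (t s))"
    by (simp add: mult.assoc)
  moreover have "\<forall>\<^sub>F \<tau> in nhds (t s). f (t (g \<tau>)) = f \<tau>"
    using eventually_nhds_in_open[OF op ts] by eventually_elim (use g(3) in auto)
  ultimately show "(f has_field_derivative D) (at (t s))"
    by (metis DERIV_cong_ev)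
qed

lemma isCont_eventually_nonzero:
  fixes f :: "'a::t2_space \<Rightarrow> 'b::{t2_space, zero}"
  assumes "isCont f a" "f a \<noteq> 0"
  shows "\<forall>\<^sub>F z in nhds a. f z \<noteq> 0"
  using tendsto_imp_eventually_ne[of f "f a" "at a" 0] assms
  by (simp add: eventually_nhds_conv_at isCont_def)

text \<open>
  Both charts at infinity have the form \<open>(1/p, q/p)\<close>. Since \<open>p\<close> and \<open>q\<close> are recovered from these
  quotients, an equation for \<open>(p, q)\<close> is equivalent to the transformed one.
\<close>
lemma chart_derivative_iff:
  fixes p q :: "complex \<Rightarrow> complex"
  assumes nz: "p c \<noteq> 0"
  shows "(p has_field_derivative P) (at c) \<and> (q has_field_derivative Q) (at c) \<longleftrightarrow>
    ((\<lambda>\<tau>. 1 / p \<tau>) has_field_derivative - (P / (p c)^2)) (at c) \<and>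
    ((\<lambda>\<tau>. q \<tau> / p \<tau>) has_field_derivative (Q * p c - q c * P) / (p c * p c)) (at c)"
proof (intro iffI conjI; (elim conjE)?)
  assume a: "(p has_field_derivative P) (at c)" "(q has_field_derivative Q) (at c)"
  show "((\<lambda>\<tau>. 1 / p \<tau>) has_field_derivative - (P / (p c)^2)) (at c)"
    using nz by (auto intro!: derivative_eq_intros a simp: power2_eq_square)
  show "((\<lambda>\<tau>. q \<tau> / p \<tau>) has_field_derivative (Q * p c - q c * P) / (p c * p c)) (at c)"
    using nz by (auto intro!: derivative_eq_intros a)
next
  assume a: "((\<lambda>\<tau>. 1 / p \<tau>) has_field_derivative - (P / (p c)^2)) (at c)"
  have "((\<lambda>\<tau>. inverse (1 / p \<tau>)) has_field_derivative P) (at c)"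
    using DERIV_inverse_fun[OF a] nz by (simp add: field_simps power2_eq_square)
  thus p': "(p has_field_derivative P) (at c)" by simp
  assume b: "((\<lambda>\<tau>. q \<tau> / p \<tau>) has_field_derivative (Q * p c - q c * P) / (p c * p c)) (at c)"
  have "((\<lambda>\<tau>. q \<tau> / p \<tau> * p \<tau>) has_field_derivative Q) (at c)"
    by (rule DERIV_cong[OF DERIV_mult[OF b p']]) (use nz in \<open>simp add: field_simps\<close>)
  moreover have "\<forall>\<^sub>F \<tau> in nhds c. q \<tau> / p \<tau> * p \<tau> = q \<tau>"
    using isCont_eventually_nonzero[OF DERIV_isCont[OF p'] nz] by eventually_elim simp
  ultimately show "(q has_field_derivative Q) (at c)"
    by (metis DERIV_cong_ev)
qed

lemma chart_ode_iff:
  fixes p q t :: "complex \<Rightarrow> complex"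
  assumes S: "open S" "inj_on t S"
    and pt: "\<forall>s\<in>S. p (t s) \<noteq> 0 \<and> (t has_field_derivative (1 / p (t s))^n) (at s)"
  shows "(\<forall>c\<in>t ` S. (p has_field_derivative P c) (at c) \<and> (q has_field_derivative Q c) (at c)) \<longleftrightarrow>
    (\<forall>s\<in>S. ((\<lambda>s. 1 / p (t s)) has_field_derivative - (P (t s) / (p (t s))^2) * (1 / p (t s))^n) (at s) \<and>
       ((\<lambda>s. q (t s) / p (t s)) has_field_derivative
          (Q (t s) * p (t s) - q (t s) * P (t s)) / (p (t s) * p (t s)) * (1 / p (t s))^n) (at s))"
proof -
  have time: "(f has_field_derivative d) (at (t s)) \<longleftrightarrow>
      ((\<lambda>s. f (t s)) has_field_derivative d * (1 / p (t s))^n) (at s)" if "s \<in> S" for s f d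
    by (rule has_field_derivative_time_change_iff[OF S that]) (use pt in blast)
  show ?thesis
    unfolding ball_simps
  proof (rule ball_cong[OF refl], goal_cases)
    case (1 s)
    show ?case
      unfolding chart_derivative_iff[where p = p and c = "t s", OF conjunct1[OF bspec[OF pt 1]]]
      unfolding time[OF 1] ..
  qed
qed

lemma pendulum_uz_iff:
  assumes m: "m \<ge> 2" and deg: "degree G = m + 1"
    and S: "open S" "inj_on t S"
    and xt: "\<forall>s\<in>S. x (t s) \<noteq> 0 \<and> (t has_field_derivative (1 / x (t s))^(m-1)) (at s)"
  shows "pendulum_solution G (t ` S) x y \<longleftrightarrow>
         (\<forall>s\<in>S.
           ((\<lambda>s. 1 / x (t s)) has_field_derivative
              fst (uz_field m G (1 / x (t s), y (t s) / x (t s)))) (at s) \<and>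
           ((\<lambda>s. y (t s) / x (t s)) has_field_derivative
              snd (uz_field m G (1 / x (t s), y (t s) / x (t s)))) (at s))"
proof -
  obtain n where n: "m = Suc (Suc n)" using m by (metis add_2_eq_Suc less_eqE)
  have field: "uz_field m G (1 / X, Y / X) = (- (Y / X^2) * (1 / X)^(m-1),
      (poly (pderiv G) X * X - Y * Y) / (X * X) * (1 / X)^(m-1))" if X: "X \<noteq> 0" for X Y
  proof -
    have hom: "homogenize m (pderiv G) (1 / X) 1 = (1 / X)^m * poly (pderiv G) X"
      using X deg by (subst homogenize_eq) (auto simp: degree_pderiv)
    show ?thesis unfolding uz_field_def prod.case hom
      using X by (simp add: n divide_simps power2_eq_square)
  qed
  show ?thesis
    unfolding pendulum_solution_def chart_ode_iff[OF S xt, of y y "\<lambda>c. poly (pderiv G) (x c)"]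
    by (intro ball_cong refl) (simp only: field[OF conjunct1[OF bspec[OF xt]]] fst_conv snd_conv)
qed

lemma pendulum_vw_iff:
  assumes m: "m \<ge> 2" and deg: "degree G = m + 1"
    and S: "open S" "inj_on t S"
    and yt: "\<forall>s\<in>S. y (t s) \<noteq> 0 \<and> (t has_field_derivative (1 / y (t s))^(m-1)) (at s)"
  shows "pendulum_solution G (t ` S) x y \<longleftrightarrow>
         (\<forall>s\<in>S.
           ((\<lambda>s. 1 / y (t s)) has_field_derivative
              fst (vw_field m G (1 / y (t s), x (t s) / y (t s)))) (at s) \<and>
           ((\<lambda>s. x (t s) / y (t s)) has_field_derivative
              snd (vw_field m G (1 / y (t s), x (t s) / y (t s)))) (at s))"
proof -
  obtain n where n: "m = Suc (Suc n)" using m by (metis add_2_eq_Suc less_eqE)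
  have field: "vw_field m G (1 / Y, X / Y) = (- (poly (pderiv G) X / Y^2) * (1 / Y)^(m-1),
      (Y * Y - X * poly (pderiv G) X) / (Y * Y) * (1 / Y)^(m-1))" if Y: "Y \<noteq> 0" for X Y
  proof -
    have hom: "homogenize m (pderiv G) (1 / Y) (X / Y) = (1 / Y)^m * poly (pderiv G) X"
      using Y deg by (subst homogenize_eq) (auto simp: degree_pderiv)
    show ?thesis unfolding vw_field_def prod.case hom
      using Y by (simp add: n divide_simps power2_eq_square)
  qed
  have swap: "pendulum_solution G (t ` S) x y \<longleftrightarrow>
      (\<forall>c\<in>t ` S. (y has_field_derivative poly (pderiv G) (x c)) (at c) \<and> (x has_field_derivative y c) (at c))"
    unfolding pendulum_solution_def by blast
  show ?thesis
    unfolding swap chart_ode_iff[OF S yt, of "\<lambda>c. poly (pderiv G) (x c)" x y]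
    by (intro ball_cong refl) (simp only: field[OF conjunct1[OF bspec[OF yt]]] fst_conv snd_conv)
qed

lemma uz_field_infinity_nonzero:
  assumes "m \<ge> 2" "degree G = m + 1"
  shows "uz_field m G (0, z) \<noteq> 0"
proof -
  have "coeff G (m+1) \<noteq> 0" using assms(2) by (metis Suc_eq_plus1 degree_0 leading_coeff_0_iff nat.simps(3))
  thus ?thesis
    using assms(1) by (simp add: uz_field_def homogenize_0 coeff_pderiv zero_prod_def power_0_left
        del: of_nat_Suc)
qed

lemma vw_field_infinity_eq_0_iff:
  assumes "m \<ge> 2" "degree G = m + 1"
  shows "vw_field m G (0, w) = 0 \<longleftrightarrow> w = 0"
proof -
  have "coeff G (m+1) \<noteq> 0" using assms(2) by (metis Suc_eq_plus1 degree_0 leading_coeff_0_iff nat.simps(3))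
  thus ?thesis
    using assms(1) by (auto simp add: vw_field_def homogenize_0 coeff_pderiv zero_prod_def power_0_left
        simp del: of_nat_Suc)
qed

lemma vw_field_linearization:
  assumes m: "m \<ge> 3"
  shows "(vw_field m G has_derivative (\<lambda>_. 0)) (at (0, 0))"
proof -
  obtain n where n: "m = Suc (Suc (Suc n))" using m by (metis less_eqE numeral_3_eq_3 add_Suc add_0)
  define h where "h = (\<lambda>p::complex\<times>complex. homogenize m (pderiv G) (fst p) (snd p))"
  have h0: "h (0, 0) = 0" by (simp add: h_def homogenize_0 n)
  have "h differentiable at (0, 0)"
    unfolding h_def homogenize_def differentiable_def
    by (rule exI) (rule derivative_eq_intros refl | simp)+
  then obtain h' where h': "(h has_derivative h') (at (0, 0))" by (auto simp: differentiable_def)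
  have "((\<lambda>p. (- (fst p * h p), fst p ^ (m-1) - snd p * h p)) has_derivative (\<lambda>_. (0, 0))) (at (0, 0))"
    by (rule derivative_eq_intros h' refl | simp add: h0 n)+
  moreover have "vw_field m G = (\<lambda>p. (- (fst p * h p), fst p ^ (m-1) - snd p * h p))"
    by (auto simp: vw_field_def h_def fun_eq_iff)
  ultimately show ?thesis by (simp add: zero_prod_def)
qed

lemma pendulum_energy_const:
  assumes sol: "pendulum_solution G T x y" and T: "convex T"
    and t: "t \<in> T" "t' \<in> T"
  shows "Hxy G (x t) (y t) = Hxy G (x t') (y t')"
proof -
  have "\<exists>c. \<forall>t\<in>T. Hxy G (x t) (y t) = c"
  proof (rule has_field_derivative_zero_constant[OF T])
    fix t assume t: "t \<in> T"
    have dx: "(x has_field_derivative y t) (at t within T)"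
      and dy: "(y has_field_derivative poly (pderiv G) (x t)) (at t within T)"
      using sol t has_field_derivative_at_within unfolding pendulum_solution_def by blast+
    show "((\<lambda>t. Hxy G (x t) (y t)) has_field_derivative 0) (at t within T)"
      unfolding Hxy_def
      by (rule DERIV_cong[OF DERIV_diff[OF DERIV_cdivide[OF DERIV_power[OF dy, where n = 2], where c = 2]
            DERIV_chain2[OF poly_DERIV dx]]]) simp
  qed
  thus ?thesis using t by metis
qed

lemma joined_sym: "joined_by_solution m G V p q \<Longrightarrow> joined_by_solution m G V q p"
  unfolding joined_by_solution_def by blast

section \<open>Complex analysis\<close>

lemma holomorphic_local_inverse:
  assumes "f holomorphic_on S" "open S" "x \<in> S" "deriv f x \<noteq> 0"
  obtains r W g where "r > 0" "open W" "x \<in> W" "W \<subseteq> S" "f ` W = ball (f x) r"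
    "g holomorphic_on ball (f x) r" "g ` ball (f x) r = W"
    "\<And>y. y \<in> ball (f x) r \<Longrightarrow> f (g y) = y" "\<And>z. z \<in> W \<Longrightarrow> g (f z) = z"
    "\<And>y. y \<in> ball (f x) r \<Longrightarrow> deriv f (g y) \<noteq> 0"
    "\<And>y. y \<in> ball (f x) r \<Longrightarrow> (g has_field_derivative 1 / deriv f (g y)) (at y)"
proof -
  obtain r' where r': "r' > 0" "ball x r' \<subseteq> S" "inj_on f (ball x r')"
    using has_complex_derivative_locally_injective[OF assms(1,3,2,4)] .
  let ?B = "ball x r'"
  have hol: "f holomorphic_on ?B" using assms(1) r'(2) holomorphic_on_subset by blast
  obtain g where g: "g holomorphic_on (f ` ?B)"
     "\<And>z. z \<in> ?B \<Longrightarrow> deriv f z * deriv g (f z) = 1" "\<And>z. z \<in> ?B \<Longrightarrow> g (f z) = z"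
    using holomorphic_has_inverse[OF hol _ r'(3)] by blast
  have op: "open (f ` ?B)" by (rule open_mapping_thm3[OF hol _ r'(3)]) auto
  moreover have "f x \<in> f ` ?B" using r'(1) by auto
  ultimately obtain r where r: "r > 0" "ball (f x) r \<subseteq> f ` ?B"
    by (meson open_contains_ball)
  define W where "W = ?B \<inter> f -` ball (f x) r"
  have oW: "open W" unfolding W_def
    by (intro continuous_open_preimage holomorphic_on_imp_continuous_on hol) auto
  have fW: "f ` W = ball (f x) r" using r(2) by (auto simp: W_def)
  have gW: "g ` ball (f x) r = W"
  proof -
    have "g ` f ` W = W" using g(3) by (force simp: W_def image_iff)
    thus ?thesis by (simp add: fW)
  qed
  have fg: "f (g y) = y" if "y \<in> ball (f x) r" for y
    using that fW g(3) by (force simp: W_def)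
  have gB: "g y \<in> ?B" if "y \<in> ball (f x) r" for y
    using that gW by (auto simp: W_def)
  have holg: "g holomorphic_on ball (f x) r" using g(1) r(2) holomorphic_on_subset by blast
  have dg: "(g has_field_derivative 1 / deriv f (g y)) (at y)" "deriv f (g y) \<noteq> 0"
    if y: "y \<in> ball (f x) r" for y
  proof -
    have *: "deriv f (g y) * deriv g y = 1" using g(2)[OF gB[OF y]] fg[OF y] by simp
    thus "deriv f (g y) \<noteq> 0" by auto
    with * have "deriv g y = 1 / deriv f (g y)" by (simp add: field_simps)
    thus "(g has_field_derivative 1 / deriv f (g y)) (at y)"
      using holomorphic_derivI[OF holg _ y] by simp
  qed
  show ?thesis
  proof (rule that[of r W g])
    show "x \<in> W" using r'(1) r(1) by (simp add: W_def)
    show "W \<subseteq> S" using r'(2) by (auto simp: W_def)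
    show "\<And>z. z \<in> W \<Longrightarrow> g (f z) = z" using g(3) by (auto simp: W_def)
  qed (use r(1) oW fW holg gW fg dg in auto)
qed

text \<open>
  Comparison of coefficients: \<open>s^n\<close> has coefficient \<open>1 + c n\<close> in \<open>s^n + c s (s^n)'\<close>, so the
  power series of the solution is dominated by the one of the right-hand side.
\<close>
lemma euler_ode_solvable:
  fixes B :: "complex \<Rightarrow> complex" and c :: real
  assumes B: "B holomorphic_on ball 0 r" and c: "c \<ge> 0"
  obtains Q where "Q holomorphic_on ball 0 r" "Q 0 = B 0"
    "\<And>s. s \<in> ball 0 r \<Longrightarrow> Q s + of_real c * s * deriv Q s = B s"
proof -
  define b where "b n = (deriv ^^ n) B 0 / fact n" for n
  define q where "q n = b n / of_real (1 + c * real n)" for n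
  define Q where "Q s = (\<Sum>n. q n * s^n)" for s
  have nz: "1 + c * real n > 0" for n using c by (simp add: add_pos_nonneg)
  have nz': "of_real (1 + c * real n) \<noteq> (0 :: complex)" for n
    using nz[of n] by (metis less_irrefl of_real_eq_0_iff)
  have b_sums: "(\<lambda>n. b n * s^n) sums B s" if "s \<in> ball 0 r" for s
    using holomorphic_power_series[OF B that] by (simp add: b_def)
  have q_le: "cmod (q n) \<le> cmod (b n)" for n
  proof -
    have "1 \<le> 1 + c * real n" using c by simp
    hence "cmod (of_real (1 + c * real n)) \<ge> 1" by (metis abs_ge_self norm_of_real order_trans)
    thus ?thesis unfolding q_def norm_divide
      by (metis div_by_1 divide_left_mono mult_1 norm_ge_zero zero_less_one order_less_le_trans mult_pos_pos)
  qed
  have q_summable: "summable (\<lambda>n. q n * s^n)" if s: "norm s < r" for s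
  proof -
    obtain s' where s': "norm s < s'" "s' < r" using s dense by blast
    have pos: "s' > 0" using s'(1) norm_ge_zero[of s] by linarith
    have "summable (\<lambda>n. b n * (of_real s')^n)"
      using b_sums[of "of_real s'"] s' pos by (auto simp: sums_iff)
    hence "summable (\<lambda>n. norm (b n * s^n))"
      by (rule powser_insidea) (use s' pos in auto)
    thus ?thesis
      by (rule summable_comparison_test'[of _ 0]) (simp add: norm_mult q_le mult_right_mono)
  qed
  have Q_sums: "(\<lambda>n. q n * s^n) sums Q s" if "norm s < r" for s
    unfolding Q_def using q_summable[OF that] by (rule summable_sums)
  have Q_hol: "Q holomorphic_on ball 0 r"
    by (rule power_series_holomorphic[of 0 r q]) (use Q_sums in auto)
  have dQ: "(\<lambda>n. diffs q n * s^n) sums deriv Q s" if s: "norm s < r" for s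
  proof -
    have "(Q has_field_derivative (\<Sum>n. diffs q n * s^n)) (at s)"
      unfolding Q_def using termdiffs_strong'[OF q_summable s] by blast
    moreover have "summable (\<lambda>n. diffs q n * s^n)"
      by (rule termdiff_converges[OF s q_summable])
    ultimately show ?thesis by (simp add: DERIV_imp_deriv summable_sums)
  qed
  show ?thesis
  proof (rule that[OF Q_hol])
    fix s :: complex assume s: "s \<in> ball 0 r"
    hence ns: "norm s < r" by simp
    have "(\<lambda>n. (diffs q n * s^n) * s) sums (deriv Q s * s)"
      by (rule sums_mult2[OF dQ[OF ns]])
    hence "(\<lambda>n. of_nat (Suc n) * q (Suc n) * s^Suc n) sums (deriv Q s * s)"
      by (simp add: diffs_def mult_ac)
    hence "(\<lambda>n. of_nat n * q n * s^n) sums (deriv Q s * s)"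
      by (subst (asm) sums_Suc_iff) simp
    hence "(\<lambda>n. q n * s^n + of_real c * (of_nat n * q n * s^n)) sums (Q s + of_real c * (deriv Q s * s))"
      by (intro sums_add sums_mult Q_sums ns)
    moreover have "q n * s^n + of_real c * (of_nat n * q n * s^n) = b n * s^n" for n
    proof -
      have "q n * of_real (1 + c * real n) = b n" unfolding q_def using nz'[of n] by simp
      hence "b n * s^n = q n * (1 + of_real c * of_nat n) * s^n" by simp
      thus ?thesis by (simp add: algebra_simps)
    qed
    ultimately have "(\<lambda>n. b n * s^n) sums (Q s + of_real c * (deriv Q s * s))" by simp
    thus "Q s + of_real c * s * deriv Q s = B s"
      using b_sums[OF s] sums_unique2 by (metis mult.assoc mult.commute)
  next
    show "Q 0 = B 0" unfolding Q_def powser_zero by (simp add: q_def b_def)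
  qed
qed

lemma connected_finite_closed_cover:
  assumes T: "connected T" and K: "finite K" "\<And>k. k \<in> K \<Longrightarrow> closedin (top_of_set T) (C k)"
    and cover: "T \<subseteq> (\<Union>k\<in>K. C k)"
    and disj: "\<And>k k'. \<lbrakk>k \<in> K; k' \<in> K; k \<noteq> k'\<rbrakk> \<Longrightarrow> C k \<inter> C k' = {}"
    and k: "k \<in> K" "t \<in> T" "t \<in> C k"
  shows "T \<subseteq> C k"
proof -
  define Y where "Y = (\<Union>k'\<in>K - {k}. C k')"
  have "closedin (top_of_set T) Y"
    unfolding Y_def by (rule closedin_Union) (use K in auto)
  moreover have "T \<subseteq> C k \<union> Y" using cover unfolding Y_def by blast
  moreover have "C k \<inter> Y = {}" using disj k(1) unfolding Y_def by blast
  moreover have "C k \<noteq> {}" using k by blast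
  ultimately have "Y = {}"
    using T K(2)[OF k(1)] unfolding connected_closedin by metis
  with \<open>T \<subseteq> C k \<union> Y\<close> show ?thesis by simp
qed

text \<open>
  If \<open>q^i\<close> and \<open>p^j\<close> differ by a factor with a continuous logarithm, then their arguments
  grow by amounts that differ by the growth of this logarithm.
\<close>
lemma winding_number_power_relation:
  assumes p: "path p" "0 \<notin> path_image p" and q: "path q" "0 \<notin> path_image q"
    and l: "path l" and eq: "\<And>s. s \<in> {0..1} \<Longrightarrow> q s ^ i = p s ^ j * exp (l s)"
  shows "of_nat i * winding_number q 0 =
    of_nat j * winding_number p 0 + (l 1 - l 0) / (2 * of_real pi * \<i>)"
proof -
  obtain p' where p': "path p'" "pathfinish p' - pathstart p' = 2 * of_real pi * \<i> * winding_number p 0"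
    "\<And>t. t \<in> {0..1} \<Longrightarrow> p t = 0 + exp (p' t)"
    using winding_number_as_continuous_log[OF p] by blast
  obtain q' where q': "path q'" "pathfinish q' - pathstart q' = 2 * of_real pi * \<i> * winding_number q 0"
    "\<And>t. t \<in> {0..1} \<Longrightarrow> q t = 0 + exp (q' t)"
    using winding_number_as_continuous_log[OF q] by blast
  define f where "f s = of_nat i * q' s - of_nat j * p' s - l s" for s
  have ef: "exp (f s) = 1" if "s \<in> {0..1}" for s
    using eq[OF that] p'(3)[OF that] q'(3)[OF that]
    by (simp add: f_def exp_diff exp_of_nat_mult)
  have cont: "continuous_on {0..1} f" unfolding f_def
    using p'(1) q'(1) l by (intro continuous_intros) (auto simp: path_def)
  have "f constant_on {0..1}"
  proof (rule continuous_discrete_range_constant[OF _ cont])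
    fix x :: real assume x: "x \<in> {0..1}"
    have "2 * pi \<le> cmod (f y - f x)" if "y \<in> {0..1}" "f y \<noteq> f x" for y
    proof -
      have "exp (f y) = exp (f x)" using ef that x by simp
      then obtain n :: int where n: "f y = f x + of_int (2 * n) * of_real pi * \<i>"
        by (auto simp: exp_eq)
      with that have "n \<noteq> 0" by auto
      hence "1 \<le> \<bar>real_of_int n\<bar>" by linarith
      hence "2 * pi \<le> 2 * pi * \<bar>real_of_int n\<bar>" by simp
      thus ?thesis by (simp add: n norm_mult abs_mult)
    qed
    thus "\<exists>e>0. \<forall>y. y \<in> {0..1} \<and> f y \<noteq> f x \<longrightarrow> e \<le> cmod (f y - f x)"
      by (intro exI[of _ "2 * pi"]) auto
  qed auto
  hence "f 1 = f 0" by (auto simp: constant_on_def)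
  hence "of_nat i * (q' 1 - q' 0) = of_nat j * (p' 1 - p' 0) + (l 1 - l 0)"
    by (simp add: f_def algebra_simps)
  thus ?thesis using p'(2) q'(2) by (simp add: pathfinish_def pathstart_def field_simps)
qed

text \<open>
  On a disc \<open>f\<close> has a primitive \<open>g\<close>, and \<open>v exp g\<close> is constant there; so the zero set of \<open>v\<close> is open
  as well as closed.
\<close>
lemma linear_ode_nonvanishing:
  fixes v f :: "complex \<Rightarrow> complex"
  assumes T: "open T" "connected T" and f: "f holomorphic_on T"
    and v: "\<And>\<tau>. \<tau> \<in> T \<Longrightarrow> (v has_field_derivative - v \<tau> * f \<tau>) (at \<tau>)"
    and p: "p \<in> T" "v p \<noteq> 0" and q: "q \<in> T"
  shows "v q \<noteq> 0"
proof -
  have "(v p = 0) = (v q = 0)"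
  proof (rule connected_local_const[OF T(2) p(1) q, of "\<lambda>\<tau>. v \<tau> = 0"], intro ballI)
    fix a assume a: "a \<in> T"
    obtain r where r: "r > 0" "ball a r \<subseteq> T" using T(1) a by (meson open_contains_ball)
    have "f holomorphic_on ball a r" using f r(2) by (rule holomorphic_on_subset)
    then obtain g where g: "\<And>x. x \<in> ball a r \<Longrightarrow> (g has_field_derivative f x) (at x within ball a r)"
      using holomorphic_convex_primitive'[OF convex_ball open_ball] by metis
    have "\<exists>c. \<forall>x\<in>ball a r. v x * exp (g x) = c"
    proof (rule has_field_derivative_zero_constant)
      fix x assume x: "x \<in> ball a r"
      have "(v has_field_derivative - v x * f x) (at x within ball a r)"
        using v r(2) x has_field_derivative_at_within by blast
      from DERIV_mult[OF this DERIV_chain2[where f = exp, OF DERIV_exp g[OF x]]]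
      show "((\<lambda>x. v x * exp (g x)) has_field_derivative 0) (at x within ball a r)"
        by (simp add: algebra_simps)
    qed auto
    then obtain c where c: "\<And>x. x \<in> ball a r \<Longrightarrow> v x * exp (g x) = c" by blast
    have "(v a = 0) = (v b = 0)" if "b \<in> ball a r" for b
      using c[OF that] c[of a] r(1) by (metis centre_in_ball exp_not_eq_zero mult_eq_0_iff)
    thus "\<forall>\<^sub>F b in at a within T. (v a = 0) = (v b = 0)"
      using eventually_at_ball[OF r(1), of a T] by (auto elim!: eventually_mono)
  qed
  thus ?thesis using p by simp
qed

section \<open>The level curve near infinity and the original time on it\<close>

lemma poly_conv_reflect_poly:
  fixes x :: "'a::field"
  assumes "degree G = n" "x \<noteq> 0"
  shows "poly G x = x^n * poly (reflect_poly G) (1 / x)"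
  using poly_reflect_poly_nz[of "1 / x" G] assms by (simp add: field_simps)

lemma homogenize_conv_reflect_poly:
  assumes "degree G = n" "w \<noteq> 0"
  shows "homogenize n G v w = w^n * poly (reflect_poly G) (v / w)"
proof (cases "v = 0")
  case True
  thus ?thesis using assms by (simp add: homogenize_0)
next
  case False
  thus ?thesis using assms poly_conv_reflect_poly[of G n "w / v"]
    by (simp add: homogenize_eq field_simps)
qed

text \<open>
  Write \<open>\<Gamma>(s) = s\<^sup>m\<^sup>+\<^sup>1 G(1/s)\<close> for the reflected polynomial, so that \<open>\<Gamma>(0)\<close> is the leading coefficient.
  In the variable \<open>s = v/w = 1/x\<close> the level curve is \<open>s\<^sup>m\<^sup>-\<^sup>1 = 2 w\<^sup>2 \<Gamma>(s)\<close>. The locale collects the three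
  germs that describe it: \<open>F\<close> is the \<open>(m-1)\<close>-st root of \<open>\<Gamma>(s)/\<Gamma>(0)\<close>, which turns the curve into
  \<open>s = z F(s)\<close> with \<open>z\<close> proportional to the square of an \<open>(m-1)\<close>-st root of \<open>w\<close>; \<open>S\<close> is the solution
  \<open>s = S(z)\<close> of that equation; and \<open>- 2/(m-1) w N(s)\<close> is the original time.

  The differential equation of \<open>N\<close> comes from \<open>dt = dx/y\<close>. It is singular at \<open>s = 0\<close>, and \<open>N\<close> is
  its only regular solution there. The bound on \<open>N - 1\<close> keeps \<open>N\<close> away from \<open>0\<close> uniformly, so
  that small times belong to small parameters.
\<close>
locale puiseux_data =
  fixes m :: nat and G :: "complex poly" and r0 r1 :: real and F S N :: "complex \<Rightarrow> complex"
  assumes m: "m \<ge> 2" and deg: "degree G = m + 1"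
    and r: "0 < r0" "r0 \<le> r1" "r1 \<le> 1"
    and G_nz: "s \<in> ball 0 r1 \<Longrightarrow> poly (reflect_poly G) s \<noteq> 0"
    and F_hol: "F holomorphic_on ball 0 r1" and F_0: "F 0 = 1"
    and F_pow: "s \<in> ball 0 r1 \<Longrightarrow> lead_coeff G * F s^(m-1) = poly (reflect_poly G) s"
    and S_hol: "S holomorphic_on ball 0 r0"
    and S_in: "z \<in> ball 0 r0 \<Longrightarrow> S z \<in> ball 0 r1"
    and S_eq: "z \<in> ball 0 r0 \<Longrightarrow> S z = z * F (S z)"
    and S_unique: "\<lbrakk>s \<in> ball 0 r1; z \<in> ball 0 r0; s = z * F s\<rbrakk> \<Longrightarrow> s = S z"
    and N_hol: "N holomorphic_on ball 0 r1" and N_0: "N 0 = 1"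
    and N_near: "s \<in> ball 0 r1 \<Longrightarrow> cmod (N s - 1) < 1 / 2"
    and N_ode: "s \<in> ball 0 r1 \<Longrightarrow>
       (of_nat (m-1) * poly (reflect_poly G) s - s * poly (pderiv (reflect_poly G)) s) * N s
         + 2 * s * poly (reflect_poly G) s * deriv N s = of_nat (m-1) * poly (reflect_poly G) s"

text \<open>
  All germs are built from one logarithm of \<open>\<Gamma>/\<Gamma>(0)\<close>. With \<open>B = (\<Gamma>/\<Gamma>(0))\<^sup>-\<^sup>1\<^sup>/\<^sup>2\<close> the equation of \<open>N\<close> is
  equivalent to \<open>Q + 2/(m-1) s Q' = B\<close> for \<open>Q = B N\<close>, which has constant coefficients on
  powers of \<open>s\<close>.
\<close>
lemma puiseux_data_exists:
  assumes m: "m \<ge> 2" and deg: "degree G = m + 1"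
  shows "\<exists>r0 r1 F S N. puiseux_data m G r0 r1 F S N"
proof -
  define g where "g s = poly (reflect_poly G) s" for s
  define g' where "g' s = poly (pderiv (reflect_poly G)) s" for s
  define c where "c = lead_coeff G"
  define M where "M = real (m - 1)"
  have M: "M \<noteq> 0" "M > 0" "of_real M = (of_nat (m-1) :: complex)" using m by (auto simp: M_def)
  have c: "c \<noteq> 0" using deg unfolding c_def by (metis degree_0 leading_coeff_0_iff Suc_eq_plus1 nat.simps(3))
  have g0: "g 0 = c" by (simp add: g_def c_def)
  have dg: "(g has_field_derivative g' s) (at s)" for s
    unfolding g_def g'_def by (rule poly_DERIV)
  have contg: "isCont g s" for s using dg DERIV_isCont by blast
  obtain ra where ra: "ra > 0" "\<And>s. cmod s < ra \<Longrightarrow> cmod (g s - c) < cmod c"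
  proof -
    have "cmod c > 0" using c by simp
    then obtain d where "d > 0" "\<forall>s. dist s 0 < d \<longrightarrow> dist (g s) (g 0) < cmod c"
      using contg[of 0] unfolding continuous_at_eps_delta by blast
    thus ?thesis using that[of d] by (auto simp: dist_norm g0)
  qed
  have gc: "cmod (g s / c - 1) < 1" if "cmod s < ra" for s
  proof -
    have "g s / c - 1 = (g s - c) / c" using c by (simp add: field_simps)
    thus ?thesis using ra(2)[OF that] c by (simp add: norm_divide)
  qed
  have gnz: "g s \<noteq> 0" if "cmod s < ra" for s using ra(2)[OF that] by auto
  have gRe: "g s / c \<notin> \<real>\<^sub>\<le>\<^sub>0" if "cmod s < ra" for s
  proof
    assume a: "g s / c \<in> \<real>\<^sub>\<le>\<^sub>0"
    then obtain x where x: "g s / c = of_real x" "x \<le> 0" by (auto elim!: nonpos_Reals_cases)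
    hence "cmod (g s / c - 1) = \<bar>x - 1\<bar>" by (metis norm_of_real of_real_1 of_real_diff)
    thus False using gc[OF that] x(2) by auto
  qed
  define Lg where "Lg s = Ln (g s / c)" for s
  have dLg: "(Lg has_field_derivative g' s / g s) (at s)" if "cmod s < ra" for s
    unfolding Lg_def using gRe[OF that] gnz[OF that] c
    by (auto intro!: derivative_eq_intros dg simp: field_simps)
  have eLg: "exp (Lg s) = g s / c" if "cmod s < ra" for s
    unfolding Lg_def using gnz[OF that] c by simp
  have Lg_hol: "Lg holomorphic_on ball 0 ra"
    by (auto simp: holomorphic_on_open intro!: exI dLg)
  have Lg0: "Lg 0 = 0" using c by (simp add: Lg_def g0)
  define F where "F s = exp (Lg s / of_real M)" for s
  define B where "B s = exp (- Lg s / 2)" for s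
  have F_hol: "F holomorphic_on ball 0 ra" unfolding F_def
    by (intro holomorphic_intros Lg_hol) (use M in auto)
  have B_hol: "B holomorphic_on ball 0 ra" unfolding B_def
    by (intro holomorphic_intros Lg_hol) auto
  have "2 / M \<ge> 0" using M by simp
  then obtain Q where Q: "Q holomorphic_on ball 0 ra" "Q 0 = B 0"
    "\<And>s. s \<in> ball 0 ra \<Longrightarrow> Q s + of_real (2 / M) * s * deriv Q s = B s"
    using euler_ode_solvable[OF B_hol] by blast
  define N where "N s = Q s * exp (Lg s / 2)" for s
  have N_hol: "N holomorphic_on ball 0 ra" unfolding N_def
    by (intro holomorphic_intros Q Lg_hol) auto
  have N0: "N 0 = 1" by (simp add: N_def Q(2) B_def Lg0)
  \<comment> \<open>\<open>S\<close> is the local inverse of \<open>s \<mapsto> s/F(s)\<close>.\<close>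
  define \<psi> where "\<psi> s = s * exp (- Lg s / of_real M)" for s
  have psi_hol: "\<psi> holomorphic_on ball 0 ra" unfolding \<psi>_def
    by (intro holomorphic_intros Lg_hol) (use M in auto)
  have "(\<psi> has_field_derivative 1) (at 0)"
    unfolding \<psi>_def using M ra(1)
    by (auto intro!: derivative_eq_intros dLg simp: Lg0)
  hence dpsi: "deriv \<psi> 0 \<noteq> 0" by (simp add: DERIV_imp_deriv)
  have z0: "(0::complex) \<in> ball 0 ra" using ra(1) by simp
  obtain rb where rb: "rb > 0" "ball (0::complex) rb \<subseteq> ball 0 ra" "inj_on \<psi> (ball 0 rb)"
    by (rule has_complex_derivative_locally_injective[OF psi_hol z0 open_ball dpsi])
  have "isCont N 0"
    using holomorphic_on_imp_continuous_on[OF N_hol] ra(1)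
    by (simp add: continuous_on_eq_continuous_at)
  then obtain rc where rc: "rc > 0" "\<And>s. cmod s < rc \<Longrightarrow> cmod (N s - 1) < 1 / 2"
    unfolding continuous_at_eps_delta by (metis N0 dist_0_norm dist_commute dist_norm half_gt_zero zero_less_one)
  \<comment> \<open>The bound \<open>1\<close> gives \<open>\<bar>v\<bar> < \<bar>w\<bar>\<close> on the curve, which keeps it inside the polydisc.\<close>
  define r1 where "r1 = min 1 (min rb rc)"
  have r1: "r1 > 0" "r1 \<le> 1" "r1 \<le> rb" "r1 \<le> rc" using rb rc by (auto simp: r1_def)
  have sub: "ball (0::complex) r1 \<subseteq> ball 0 ra" using rb(2) r1(3) by (meson subset_ball subset_trans)
  have inj: "inj_on \<psi> (ball 0 r1)" using rb(3) r1(3) by (meson inj_on_subset subset_ball)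
  have psi_hol1: "\<psi> holomorphic_on ball 0 r1" using psi_hol sub holomorphic_on_subset by blast
  have "open (\<psi> ` ball 0 r1)" by (rule open_mapping_thm3[OF psi_hol1 _ inj]) auto
  moreover have "0 \<in> \<psi> ` ball 0 r1" using r1(1) by (force simp: \<psi>_def)
  ultimately obtain rd where rd: "rd > 0" "ball 0 rd \<subseteq> \<psi> ` ball 0 r1"
    by (meson open_contains_ball)
  obtain S where S: "S holomorphic_on \<psi> ` ball 0 r1" "\<And>s. s \<in> ball 0 r1 \<Longrightarrow> S (\<psi> s) = s"
    using holomorphic_has_inverse[OF psi_hol1 _ inj] by blast
  define r0 where "r0 = min rd r1"
  have r0: "r0 > 0" "r0 \<le> r1" "ball 0 r0 \<subseteq> \<psi> ` ball 0 r1"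
    using rd r1 by (auto simp: r0_def)
  have psiF: "\<psi> s * F s = s" for s
    by (simp add: \<psi>_def F_def exp_minus)
  have "puiseux_data m G r0 r1 F S N"
  proof
    show "m \<ge> 2" "degree G = m + 1" "0 < r0" "r0 \<le> r1" "r1 \<le> 1" by (fact m deg r0 r1)+
    show "F holomorphic_on ball 0 r1" "N holomorphic_on ball 0 r1"
      using F_hol N_hol sub holomorphic_on_subset by blast+
    show "S holomorphic_on ball 0 r0" using S(1) r0(3) holomorphic_on_subset by blast
    show "F 0 = 1" "N 0 = 1" by (simp_all add: N0 F_def Lg0)
    show "S z \<in> ball 0 r1" "S z = z * F (S z)" if z: "z \<in> ball 0 r0" for z
    proof -
      obtain s where s: "s \<in> ball 0 r1" "z = \<psi> s" using z r0(3) by blast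
      thus "S z \<in> ball 0 r1" "S z = z * F (S z)" using S(2)[OF s(1)] psiF[of s] by auto
    qed
    fix s :: complex assume s1: "s \<in> ball 0 r1"
    hence s: "s \<in> ball 0 ra" "cmod s < ra" using sub by auto
    show "poly (reflect_poly G) s \<noteq> 0" using gnz[OF s(2)] by (simp add: g_def)
    show "lead_coeff G * F s^(m-1) = poly (reflect_poly G) s"
    proof -
      have "F s^(m-1) = exp (of_nat (m-1) * (Lg s / of_real M))"
        unfolding F_def exp_of_nat_mult ..
      also have "of_nat (m-1) * (Lg s / of_real M) = Lg s" using M by (simp add: M_def)
      finally show ?thesis using eLg[OF s(2)] c by (simp add: c_def g_def)
    qed
    show "cmod (N s - 1) < 1 / 2" using rc(2) s1 r1 by auto
    show "s = S z" if "z \<in> ball 0 r0" "s = z * F s" for z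
    proof -
      have "\<psi> s * F s = z * F s" using psiF[of s] that(2) by simp
      hence "z = \<psi> s" by (simp add: F_def)
      thus ?thesis using S(2)[OF s1] by simp
    qed
    have dQ: "(Q has_field_derivative deriv Q s) (at s)"
      using holomorphic_derivI[OF Q(1) _ s(1)] by simp
    define e where "e = exp (Lg s / 2)"
    have "(N has_field_derivative deriv Q s * e + Q s * (e * (g' s / g s / 2))) (at s)"
      unfolding N_def e_def
      by (auto intro!: derivative_eq_intros dQ dLg s simp: mult_ac)
    hence dN: "deriv N s = deriv Q s * e + Q s * (e * (g' s / g s / 2))"
      by (rule DERIV_imp_deriv)
    have Be: "B s * e = 1" by (simp add: B_def e_def flip: exp_add)
    have "of_real M * Q s + 2 * s * deriv Q s = of_real M * B s"
      using Q(3)[OF s(1)] M(1) by (simp add: field_simps)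
    hence "(of_real M * Q s + 2 * s * deriv Q s) * e * g s = of_real M * g s"
      using Be by (simp add: algebra_simps)
    moreover have "(of_real M * g s - s * g' s) * (Q s * e) +
        2 * s * g s * (deriv Q s * e + Q s * (e * (g' s / g s / 2)))
        = (of_real M * Q s + 2 * s * deriv Q s) * e * g s"
      using gnz[OF s(2)] by (simp add: field_simps)
    ultimately show "(of_nat (m-1) * poly (reflect_poly G) s - s * poly (pderiv (reflect_poly G)) s) * N s
         + 2 * s * poly (reflect_poly G) s * deriv N s = of_nat (m-1) * poly (reflect_poly G) s"
      unfolding dN by (simp add: N_def e_def g_def g'_def M_def)
  qed
  thus ?thesis by blast
qed

context puiseux_data
begin

lemma lead_coeff_nz: "lead_coeff G \<noteq> 0"
  using deg by (metis degree_0 leading_coeff_0_iff Suc_eq_plus1 nat.simps(3))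

lemma F_nz: "s \<in> ball 0 r1 \<Longrightarrow> F s \<noteq> 0"
  using F_pow[of s] G_nz[of s] m by (auto simp: power_0_left)

lemma S_0: "S 0 = 0" using S_eq[of 0] r by simp

lemma S_inj: "\<lbrakk>z \<in> ball 0 r0; z' \<in> ball 0 r0; S z = S z'\<rbrakk> \<Longrightarrow> z = z'"
  by (metis F_nz S_eq S_in mult_cancel_right)

lemma S_nz: "\<lbrakk>z \<in> ball 0 r0; z \<noteq> 0\<rbrakk> \<Longrightarrow> S z \<noteq> 0"
  using S_inj[of z 0] S_0 r by auto

lemma S_deriv_nz: "z \<in> ball 0 r0 \<Longrightarrow> deriv S z \<noteq> 0"
  by (rule holomorphic_injective_imp_regular[OF S_hol]) (auto simp: inj_on_def intro!: S_inj)

lemma N_nz: "s \<in> ball 0 r1 \<Longrightarrow> N s \<noteq> 0"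
  using N_near[of s] by auto

lemma N_not_nonpos: "s \<in> ball 0 r1 \<Longrightarrow> N s \<notin> \<real>\<^sub>\<le>\<^sub>0"
proof
  assume s: "s \<in> ball 0 r1" and "N s \<in> \<real>\<^sub>\<le>\<^sub>0"
  then obtain x where x: "N s = of_real x" "x \<le> 0" by (auto elim!: nonpos_Reals_cases)
  hence "cmod (N s - 1) = \<bar>x - 1\<bar>" by (metis norm_of_real of_real_1 of_real_diff)
  thus False using N_near[OF s] x(2) by auto
qed

text \<open>
  Original time, normalized to \<open>0\<close> at the blow-up, as a function of the position on the level
  curve. It does not refer to the parameter \<open>\<theta>\<close>, so it can be evaluated along loops and
  real solutions directly.
\<close>
definition blowup_time :: "complex \<times> complex \<Rightarrow> complex" where
  "blowup_time p = - (2 / of_nat (m-1)) * snd p * N (fst p / snd p)"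

text \<open>
  The derivative along the vector field \<open>(y, G'(x))\<close> is \<open>1\<close>. On the level curve, where
  \<open>y\<^sup>2 = 2 x\<^sup>m\<^sup>+\<^sup>1 \<Gamma>(1/x)\<close>, both \<open>y\<close> and \<open>x\<close> drop out of this statement, and what remains is the
  differential equation of \<open>N\<close>.
\<close>
lemma blowup_time_derivative:
  assumes X: "x \<noteq> 0" "y \<noteq> 0" "1 / x \<in> ball 0 r1" and H: "Hxy G x y = 0"
  obtains A B where
    "((\<lambda>(x, y). blowup_time (1 / y, x / y)) has_derivative (\<lambda>(h, k). A * h + B * k)) (at (x, y))"
    "A * y + B * poly (pderiv G) x = 1"
proof -
  define s where "s = 1 / x"
  define c where "c = - (2 / of_nat (m-1) :: complex)"
  define n where "n = N s" define n' where "n' = deriv N s"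
  have m1: "of_nat (m-1) \<noteq> (0::complex)" using m by simp
  have s: "s \<in> ball 0 r1" "s \<noteq> 0" using X by (auto simp: s_def)
  have dN: "(N has_field_derivative n') (at s)"
    using holomorphic_derivI[OF N_hol _ s(1)] by (simp add: n'_def)
  define A where "A = c * (n / y - n' / (x * y))"
  define B where "B = - c * x * n / y^2"
  have d_inv: "((\<lambda>p. 1 / fst p) has_derivative (\<lambda>h. - (fst h / x^2))) (at (x, y))"
    using X by (auto intro!: derivative_eq_intros simp: power2_eq_square field_simps)
  have dN': "((\<lambda>p. N (1 / fst p)) has_derivative (\<lambda>h. n' * (- (fst h / x^2)))) (at (x, y))"
  proof (rule has_derivative_compose[OF d_inv])
    show "(N has_derivative (*) n') (at (1 / fst (x, y)))"
      using dN by (simp add: s_def has_field_derivative_def)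
  qed
  have "((\<lambda>p. c * (fst p / snd p) * N (1 / fst p)) has_derivative (\<lambda>h. A * fst h + B * snd h)) (at (x, y))"
    using X by (auto intro!: derivative_eq_intros dN' simp: A_def B_def n_def s_def power2_eq_square divide_simps)
      (auto simp: algebra_simps)
  hence D: "((\<lambda>(x, y). c * (x / y) * N (1 / x)) has_derivative (\<lambda>(h, k). A * h + B * k)) (at (x, y))"
    by (simp add: case_prod_unfold)
  have ev: "\<forall>\<^sub>F p in nhds (x, y). (\<lambda>(x, y). c * (x / y) * N (1 / x)) p = (\<lambda>(x, y). blowup_time (1 / y, x / y)) p"
  proof -
    have "open (UNIV \<times> (- {0}) :: (complex \<times> complex) set)" by (intro open_Times) auto
    hence "\<forall>\<^sub>F p in nhds (x, y). p \<in> UNIV \<times> (- {0})" 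
      by (rule eventually_nhds_in_open) (use X in auto)
    thus ?thesis by eventually_elim (auto simp: blowup_time_def c_def)
  qed
  have 1: "((\<lambda>(x, y). blowup_time (1 / y, x / y)) has_derivative (\<lambda>(h, k). A * h + B * k)) (at (x, y))"
    by (rule has_derivative_transform_eventually[OF D]) 
       (use ev in \<open>auto simp: eventually_nhds_conv_at\<close>)
  have y2: "y^2 = 2 * poly G x" using H by (simp add: Hxy_def)
  define g where "g = poly (reflect_poly G) s"
  define g' where "g' = poly (pderiv (reflect_poly G)) s"
  have g: "g \<noteq> 0" using G_nz[OF s(1)] by (simp add: g_def)
  have Gx: "poly G x = x^(m+1) * g"
    using poly_conv_reflect_poly[OF deg X(1)] by (simp add: g_def s_def)
  \<comment> \<open>Differentiate \<open>G(x) = x^(m+1) \<Gamma>(1/x)\<close>.\<close>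
  have G': "x * poly (pderiv G) x = x^(m+1) * (of_nat (m+1) * g - s * g')"
  proof -
    have "\<forall>\<^sub>F z in nhds x. z \<in> - {0}" by (rule eventually_nhds_in_open) (use X in auto)
    hence ev: "\<forall>\<^sub>F z in nhds x. poly G z = z^(m+1) * poly (reflect_poly G) (1 / z)"
      by eventually_elim (use poly_conv_reflect_poly[OF deg] in auto)
    have 1: "((\<lambda>z. z^(m+1) * poly (reflect_poly G) (1 / z)) has_field_derivative poly (pderiv G) x) (at x)"
      by (rule iffD1[OF DERIV_cong_ev[OF refl ev refl] poly_DERIV])
    have "((\<lambda>z. z^(m+1)) has_field_derivative of_nat (m+1) * x^m) (at x)"
      using DERIV_power[OF DERIV_ident, where n = "m+1"] by simp
    moreover have "((\<lambda>z. poly (reflect_poly G) (1 / z)) has_field_derivative g' * (- 1 / (x * x))) (at x)"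
    proof -
      have "((\<lambda>z. 1 / z) has_field_derivative - 1 / (x * x)) (at x)"
        using X(1) by (auto intro!: derivative_eq_intros)
      from DERIV_chain2[OF poly_DERIV this] show ?thesis by (simp add: g'_def s_def)
    qed
    ultimately have "((\<lambda>z. z^(m+1) * poly (reflect_poly G) (1 / z)) has_field_derivative
        of_nat (m+1) * x^m * g + g' * (- 1 / (x * x)) * x^(m+1)) (at x)"
      unfolding g_def s_def by (rule DERIV_mult)
    from DERIV_unique[OF 1 this]
    have "poly (pderiv G) x = of_nat (m+1) * x^m * g + g' * (- 1 / (x * x)) * x^(m+1)" .
    thus ?thesis unfolding s_def using X(1) by (simp only: field_simps) (simp add: algebra_simps)
  qed
  have y2': "y^2 = 2 * x^(m+1) * g" using y2 Gx by simp
  have ode: "(of_nat (m-1) * g - s * g') * n + 2 * s * g * n' = of_nat (m-1) * g"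
    using N_ode[OF s(1)] by (simp add: g_def g'_def n_def n'_def)
  have Ay: "A * y = c * (n - s * n')"
    using X by (simp add: A_def s_def field_simps)
  have Bg: "B * poly (pderiv G) x = - c * n * (of_nat (m+1) * g - s * g') / (2 * g)"
  proof -
    have "B * poly (pderiv G) x = - c * n * (x * poly (pderiv G) x) / y^2"
      by (simp add: B_def)
    also have "\<dots> = - c * n * (of_nat (m+1) * g - s * g') / (2 * g)"
      unfolding G' y2' using X(1) by simp
    finally show ?thesis .
  qed
  have mm: "of_nat (m+1) = of_nat (m-1) + (2::complex)" using m by (simp flip: of_nat_add)
  have "(A * y + B * poly (pderiv G) x) * (2 * g) = c * (2 * g * (n - s * n') - n * (of_nat (m+1) * g - s * g'))"
    unfolding Ay Bg using g by (simp add: field_simps)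
  also have "2 * g * (n - s * n') - n * (of_nat (m+1) * g - s * g') =
     - ((of_nat (m-1) * g - s * g') * n + 2 * s * g * n')"
    unfolding mm by (simp add: algebra_simps)
  also have "c * \<dots> = 1 * (2 * g)" unfolding ode using m1 by (simp add: c_def)
  finally have "A * y + B * poly (pderiv G) x = 1" using g by simp
  with 1 show ?thesis using that by blast
qed

text \<open>
  The linear map \<open>L\<close> is the differential of time: the identity for holomorphic solutions, and
  the embedding of the reals for real-time solutions.
\<close>
lemma blowup_time_along:
  fixes x y :: "'b::real_normed_vector \<Rightarrow> complex"
  assumes x: "(x has_derivative (\<lambda>h. y t * L h)) (at t)"
    and y: "(y has_derivative (\<lambda>h. poly (pderiv G) (x t) * L h)) (at t)"
    and nz: "x t \<noteq> 0" "y t \<noteq> 0" "1 / x t \<in> ball 0 r1" and H: "Hxy G (x t) (y t) = 0"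
  shows "((\<lambda>t. blowup_time (1 / y t, x t / y t)) has_derivative L) (at t)"
proof -
  obtain A B where AB:
    "((\<lambda>(x, y). blowup_time (1 / y, x / y)) has_derivative (\<lambda>(h, k). A * h + B * k)) (at (x t, y t))"
    "A * y t + B * poly (pderiv G) (x t) = 1"
    using blowup_time_derivative[OF nz H] .
  have "((\<lambda>t. (x t, y t)) has_derivative (\<lambda>h. (y t * L h, poly (pderiv G) (x t) * L h))) (at t)"
    by (intro has_derivative_Pair x y)
  from has_derivative_compose[OF this AB(1)]
  have "((\<lambda>t. blowup_time (1 / y t, x t / y t)) has_derivative
     (\<lambda>h. A * (y t * L h) + B * (poly (pderiv G) (x t) * L h))) (at t)"
    by simp
  moreover have "A * (y t * L h) + B * (poly (pderiv G) (x t) * L h) = L h" for h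
  proof -
    have "A * (y t * L h) + B * (poly (pderiv G) (x t) * L h) = (A * y t + B * poly (pderiv G) (x t)) * L h"
      by (simp add: algebra_simps)
    thus ?thesis by (simp add: AB(2))
  qed
  ultimately show ?thesis by simp
qed

text \<open>
  The curve \<open>w = \<theta>^(m-1)\<close>, \<open>v/w = S(a \<theta>\<^sup>2)\<close>, written so that the expansion of \<open>v\<close> is visible.
\<close>
definition param :: "complex \<Rightarrow> complex \<Rightarrow> complex \<times> complex" where
  "param a \<theta> = (a * \<theta>^(m+1) * F (S (a * \<theta>^2)), \<theta>^(m-1))"

definition param_time :: "complex \<Rightarrow> complex \<Rightarrow> complex" where
  "param_time a \<theta> = - (2 / of_nat (m-1)) * \<theta>^(m-1) * N (S (a * \<theta>^2))"

text \<open>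
  Implicit differentiation of \<open>S(z) = z F(S(z))\<close> turns the differential equation of \<open>N\<close> into this
  equation for \<open>N \<circ> S\<close>.
\<close>
lemma N_S_ode:
  assumes z: "z \<in> ball 0 r0"
  shows "N (S z) + 2 / of_nat (m-1) * z * deriv S z * deriv N (S z) = deriv S z / F (S z)"
proof -
  define s s' where "s = S z" and "s' = deriv S z"
  define g g' where "g = poly (reflect_poly G) s" and "g' = poly (pderiv (reflect_poly G)) s"
  define M where "M = (of_nat (m-1) :: complex)"
  obtain n where n: "m = Suc (Suc n)" using m by (metis add_2_eq_Suc less_eqE)
  have M: "M \<noteq> 0" using m by (simp add: M_def)
  have s: "s \<in> ball 0 r1" "s = z * F s" using S_in[OF z] S_eq[OF z] by (simp_all add: s_def)
  have nz: "F s \<noteq> 0" "g \<noteq> 0" using F_nz G_nz s by (auto simp: g_def)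
  have dS: "(S has_field_derivative s') (at z)"
    using holomorphic_derivI[OF S_hol _ z] by (simp add: s'_def)
  have dF: "(F has_field_derivative deriv F s) (at s)"
    using holomorphic_derivI[OF F_hol _ s(1)] by simp
  have imp: "s' = F s + z * (deriv F s * s')"
  proof (rule DERIV_unique[OF dS])
    have ev: "\<forall>\<^sub>F z in nhds z. S z = z * F (S z)"
      using eventually_nhds_in_open[OF open_ball z] by eventually_elim (rule S_eq)
    have "((\<lambda>z. z * F (S z)) has_field_derivative F s + z * (deriv F s * s')) (at z)"
      using DERIV_mult[OF DERIV_ident DERIV_chain2[OF dF[unfolded s_def] dS]]
      by (simp add: s_def mult_ac)
    thus "(S has_field_derivative F s + z * (deriv F s * s')) (at z)"
      by (rule iffD2[OF DERIV_cong_ev[OF refl ev refl]])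
  qed
  have F': "M * deriv F s * g = F s * g'"
  proof -
    have ev: "\<forall>\<^sub>F s in nhds s. lead_coeff G * F s^(m-1) = poly (reflect_poly G) s"
      using eventually_nhds_in_open[OF open_ball s(1)] by eventually_elim (rule F_pow)
    have 1: "((\<lambda>s. lead_coeff G * F s^(m-1)) has_field_derivative g') (at s)"
      unfolding g'_def by (rule iffD2[OF DERIV_cong_ev[OF refl ev refl] poly_DERIV])
    have "((\<lambda>s. lead_coeff G * F s^(m-1)) has_field_derivative
        lead_coeff G * (of_nat (m-1) * (deriv F s * F s^(m-1-Suc 0)))) (at s)"
      by (intro DERIV_cmult DERIV_power dF)
    from DERIV_unique[OF 1 this]
    have "g' * F s = M * deriv F s * (lead_coeff G * (F s^(m-1-Suc 0) * F s))"
      by (simp add: M_def mult_ac)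
    also have "F s^(m-1-Suc 0) * F s = F s^(m-1)"
      by (simp add: n)
    also have "lead_coeff G * \<dots> = g" unfolding g_def by (rule F_pow[OF s(1)])
    finally show ?thesis by (simp add: mult_ac)
  qed
  have ode: "(M * g - s * g') * N s + 2 * s * g * deriv N s = M * g"
    using N_ode[OF s(1)] by (simp add: M_def g_def g'_def)
  have A: "s * g' = M * g * (z * deriv F s)"
  proof -
    have "s * g' = (z * F s) * g'" by (rule arg_cong[OF s(2), of "\<lambda>q. q * g'"])
    also have "\<dots> = z * (F s * g')" by simp
    also have "\<dots> = z * (M * deriv F s * g)" by (simp only: F')
    finally show ?thesis by (simp only: mult_ac)
  qed
  have "M * g * ((1 - z * deriv F s) * N s + 2 / M * s * deriv N s) = M * g * 1"
    using ode M unfolding A by (simp add: field_simps)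
  hence "(1 - z * deriv F s) * N s + 2 / M * s * deriv N s = 1"
    using M nz by simp
  hence "s' * ((1 - z * deriv F s) * N s + 2 / M * s * deriv N s) = s'" by simp
  moreover have "s' * ((1 - z * deriv F s) * N s + 2 / M * s * deriv N s) =
     (s' - z * (deriv F s * s')) * N s + 2 / M * (z * F s) * s' * deriv N s"
    unfolding s(2)[symmetric] by (simp add: algebra_simps)
  moreover have "s' - z * (deriv F s * s') = F s" using imp by (simp add: algebra_simps)
  ultimately have "s' = F s * N s + 2 / M * (z * F s) * s' * deriv N s" by (simp only:)
  also have "\<dots> = F s * (N s + 2 / M * z * s' * deriv N s)" by (simp add: algebra_simps)
  finally have "F s * (N s + 2 / M * z * s' * deriv N s) = s'" by (rule sym)
  hence "N s + 2 / M * z * s' * deriv N s = s' / F s"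
    using nz(1) by (metis nonzero_mult_div_cancel_left)
  thus ?thesis by (simp only: s_def s'_def M_def)
qed

lemma param_time_derivative:
  assumes z: "a * \<theta>^2 \<in> ball 0 r0"
  shows "(param_time a has_field_derivative
     - 2 * \<theta>^(m-2) * deriv S (a * \<theta>^2) / F (S (a * \<theta>^2))) (at \<theta>)"
proof -
  obtain n where n: "m = Suc (Suc n)" using m by (metis add_2_eq_Suc less_eqE)
  define z where "z = a * \<theta>^2"
  have zb: "z \<in> ball 0 r0" using z by (simp add: z_def)
  have dS: "(S has_field_derivative deriv S z) (at z)"
    using holomorphic_derivI[OF S_hol _ zb] by simp
  have dN: "(N has_field_derivative deriv N (S z)) (at (S z))"
    using holomorphic_derivI[OF N_hol _ S_in[OF zb]] by simp
  have dz: "((\<lambda>\<theta>. a * \<theta>^2) has_field_derivative a * (2 * \<theta>)) (at \<theta>)"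
    by (auto intro!: derivative_eq_intros)
  have d1: "((\<lambda>\<theta>. N (S (a * \<theta>^2))) has_field_derivative deriv N (S z) * (deriv S z * (a * (2 * \<theta>)))) (at \<theta>)"
    by (rule DERIV_chain2[OF dN[unfolded z_def] DERIV_chain2[OF dS[unfolded z_def] dz], folded z_def])
  have d2: "((\<lambda>\<theta>. - (2 / of_nat (m-1)) * \<theta>^(m-1)) has_field_derivative - 2 * \<theta>^n) (at \<theta>)"
    by (rule derivative_eq_intros refl | simp add: n del: power_Suc of_nat_Suc)+
  have D: "(param_time a has_field_derivative
      - 2 * \<theta>^n * N (S z) + deriv N (S z) * (deriv S z * (a * (2 * \<theta>))) * (- (2 / of_nat (m-1)) * \<theta>^(m-1))) (at \<theta>)"
    using DERIV_mult[OF d2 d1] unfolding param_time_def z_def[symmetric] by simp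
  have "- 2 * \<theta>^n * N (S z) + deriv N (S z) * (deriv S z * (a * (2 * \<theta>))) * (- (2 / of_nat (m-1)) * \<theta>^(m-1))
     = - 2 * \<theta>^n * (N (S z) + 2 / of_nat (m-1) * z * deriv S z * deriv N (S z))"
    by (simp add: z_def n power2_eq_square algebra_simps)
  also have "\<dots> = - 2 * \<theta>^(m-2) * deriv S z / F (S z)"
    unfolding N_S_ode[OF zb] by (simp add: n)
  finally show ?thesis using D by (simp add: z_def)
qed

end

section \<open>Leafs in a small polydisc\<close>

text \<open>
  The condition on \<open>R\<close> excludes points of the level curve with \<open>\<bar>w\<bar> \<le> \<bar>v\<bar>\<close>. The condition on \<open>\<delta>\<close>
  serves twice: it brings \<open>v/w\<close> into the domain of the germs for all points of the curve in the
  polydisc, and it brings \<open>a \<theta>\<^sup>2\<close> into the domain of \<open>S\<close> for all parameters \<open>\<theta>\<close>.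
\<close>
locale pendulum_polydisc = puiseux_data +
  fixes R \<delta> :: real
  assumes R: "0 < \<delta>" "\<delta> \<le> R"
    and R_small: "(\<Sum>j\<le>m+1. cmod (coeff G j)) * R^2 < 1/2"
    and \<delta>_small: "2 * (\<Sum>j\<le>m+1. cmod (coeff G j)) * \<delta>^2 \<le> r0^(m-1)"

lemma pendulum_polydisc_exists:
  assumes "puiseux_data m G r0 r1 F S N"
  obtains R0 where "R0 > 0"
    "\<And>R. R \<in> {0<..<R0} \<Longrightarrow> \<exists>\<delta>0>0. \<forall>\<delta>\<in>{0<..<\<delta>0}. pendulum_polydisc m G r0 r1 F S N R \<delta>"
proof -
  interpret puiseux_data m G r0 r1 F S N by (rule assms)
  define C where "C = (\<Sum>j\<le>m+1. cmod (coeff G j))"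
  have C: "C \<ge> 0" unfolding C_def by (intro sum_nonneg) auto
  show ?thesis
  proof (rule that[of "1 / (2 * C + 1)"])
    show "1 / (2 * C + 1) > 0" using C by simp
    fix R assume "R \<in> {0<..<1 / (2 * C + 1)}"
    hence R: "0 < R" "R < 1 / (2 * C + 1)" by auto
    have "1 / (2 * C + 1) \<le> 1" using C by simp
    hence R1: "R < 1" using R(2) by linarith
    have "R^2 \<le> R" using R(1) R1 by (simp add: power2_eq_square mult_left_le)
    hence "C * R^2 \<le> C * R" using C by (rule mult_left_mono)
    also have "C * R < 1 / 2"
    proof -
      have "R * (2 * C + 1) < 1" using R(2) C by (simp add: less_divide_eq)
      thus ?thesis using R(1) by (simp add: algebra_simps)
    qed
    finally have RC: "C * R^2 < 1 / 2" .
    define \<delta>0 where "\<delta>0 = min R (r0^(m-1) / (2 * C + 1))"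
    have "\<delta>0 > 0" using R(1) r(1) C by (simp add: \<delta>0_def)
    moreover have "pendulum_polydisc m G r0 r1 F S N R \<delta>" if "\<delta> \<in> {0<..<\<delta>0}" for \<delta>
    proof
      have \<delta>: "0 < \<delta>" "\<delta> < R" "\<delta> < r0^(m-1) / (2 * C + 1)" using that by (auto simp: \<delta>0_def)
      show "0 < \<delta>" "\<delta> \<le> R" using \<delta> by auto
      show "(\<Sum>j\<le>m+1. cmod (coeff G j)) * R^2 < 1 / 2" using RC by (simp only: C_def)
      have "\<delta>^2 \<le> \<delta>" using \<delta>(1,2) R1 by (simp add: power2_eq_square mult_left_le)
      hence "2 * C * \<delta>^2 \<le> 2 * C * \<delta>" using C by (intro mult_left_mono) auto
      also have "\<dots> \<le> (2 * C + 1) * \<delta>" using \<delta>(1) by (simp add: algebra_simps)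
      also have "\<dots> \<le> r0^(m-1)" using \<delta>(3) C by (simp add: less_divide_eq mult.commute)
      finally show "2 * (\<Sum>j\<le>m+1. cmod (coeff G j)) * \<delta>^2 \<le> r0^(m-1)" by (simp only: C_def)
    qed
    ultimately show "\<exists>\<delta>0>0. \<forall>\<delta>\<in>{0<..<\<delta>0}. pendulum_polydisc m G r0 r1 F S N R \<delta>" by blast
  qed
qed

context pendulum_polydisc
begin

abbreviation U :: "(complex \<times> complex) set" where "U \<equiv> ball 0 R \<times> ball 0 \<delta>"
definition \<rho> :: real where "\<rho> = root (m-1) \<delta>"
definition D :: "complex set" where "D = ball 0 \<rho> - {0}"
definition A :: "complex set" where "A = {a. a^(m-1) = 2 * lead_coeff G}"
definition leaf :: "complex \<Rightarrow> (complex \<times> complex) set" where "leaf a = param a ` D"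
definition level :: "(complex \<times> complex) set" where
  "level = {p \<in> U. Hvw m G (fst p) (snd p) = 0} - {(0, 0)}"

lemma \<rho>_pos: "\<rho> > 0" using R m by (simp add: \<rho>_def)

lemma \<rho>_iff: "\<theta> \<in> ball 0 \<rho> \<longleftrightarrow> \<theta>^(m-1) \<in> ball (0::complex) \<delta>"
proof -
  have "\<rho>^(m-1) = \<delta>" using R m by (simp add: \<rho>_def)
  moreover have "cmod \<theta> < \<rho> \<longleftrightarrow> cmod \<theta>^(m-1) < \<rho>^(m-1)"
    using \<rho>_pos m power_mono_iff[of \<rho> "cmod \<theta>" "m-1"] by (simp flip: not_le)
  ultimately show ?thesis by (simp add: norm_power)
qed

lemma norm_root_of_unity: "c^(m-1) = 1 \<Longrightarrow> cmod c = 1" for c :: complex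
  by (rule power_eq_imp_eq_base[of _ "m-1"]) (use m in \<open>auto simp flip: norm_power\<close>)

lemma A_nz: "a \<in> A \<Longrightarrow> a \<noteq> 0"
  using lead_coeff_nz m by (auto simp: A_def power_0_left)

lemma finite_A: "finite A"
  unfolding A_def using m by (intro finite_nth_roots) auto

lemma A_nonempty: "A \<noteq> {}"
proof -
  have "card A = m - 1"
    unfolding A_def using m lead_coeff_nz by (intro card_nth_roots) auto
  thus ?thesis using m by auto
qed

lemma lead_coeff_le: "cmod (lead_coeff G) \<le> (\<Sum>j\<le>m+1. cmod (coeff G j))"
  unfolding deg by (rule member_le_sum) auto

lemma arg_in: "\<lbrakk>a \<in> A; \<theta> \<in> ball 0 \<rho>\<rbrakk> \<Longrightarrow> a * \<theta>^2 \<in> ball 0 r0"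
proof -
  assume a: "a \<in> A" and \<theta>: "\<theta> \<in> ball 0 \<rho>"
  define x where "x = cmod \<theta>^(m-1)"
  have x: "0 \<le> x" "x < \<delta>" using \<theta>[unfolded \<rho>_iff] by (auto simp: x_def norm_power)
  have "cmod (a * \<theta>^2)^(m-1) = cmod (a^(m-1)) * x^2"
    by (simp add: x_def norm_mult norm_power power_mult_distrib mult.commute flip: power_mult)
  also have "\<dots> = 2 * cmod (lead_coeff G) * x^2" using a by (simp add: A_def norm_mult)
  also have "\<dots> < 2 * cmod (lead_coeff G) * \<delta>^2"
    using lead_coeff_nz x by (intro mult_strict_left_mono power_strict_mono) auto
  also have "\<dots> \<le> 2 * (\<Sum>j\<le>m+1. cmod (coeff G j)) * \<delta>^2"
    using lead_coeff_le by (intro mult_right_mono mult_left_mono) auto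
  also note \<delta>_small
  finally have "cmod (a * \<theta>^2)^(m-1) < r0^(m-1)" .
  hence "cmod (a * \<theta>^2) < r0" by (rule power_less_imp_less_base) (use r in auto)
  thus ?thesis by simp
qed

text \<open>
  On the level curve \<open>v^(m-1)/2 = v^(m+1) G(w/v)\<close>. For \<open>\<bar>w\<bar> \<le> \<bar>v\<bar>\<close> this forces \<open>1/2 = v\<^sup>2 G(w/v)\<close> with a
  bounded value of \<open>G\<close>, so \<open>v\<close> is not small. Hence \<open>\<bar>v\<bar> < \<bar>w\<bar>\<close> near the origin, and then the relation
  \<open>(v/w)^(m-1) = 2 w\<^sup>2 (v/w)^(m+1) G(w/v)\<close> bounds \<open>v/w\<close>.
\<close>
lemma level_ratio:
  assumes "(v, w) \<in> level"
  shows "v \<noteq> 0" "w \<noteq> 0" "v / w \<in> ball 0 r0"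
    "(v / w)^(m-1) = 2 * w^2 * poly (reflect_poly G) (v / w)"
proof -
  define C where "C = (\<Sum>j\<le>m+1. cmod (coeff G j))"
  have C: "C \<ge> 0" unfolding C_def by (intro sum_nonneg) auto
  have vw: "cmod v < R" "cmod w < \<delta>" "Hvw m G v w = 0" "(v, w) \<noteq> (0, 0)"
    using assms by (auto simp: level_def)
  have lt: "cmod v < cmod w"
  proof (rule ccontr)
    assume "\<not> cmod v < cmod w"
    hence le: "cmod w \<le> cmod v" by simp
    hence v: "v \<noteq> 0" using vw(4) by auto
    have "v^(m+1) * (v^(m-1) / 2) = v^(m+1) * (v^(m+1) * poly G (w / v))"
      using vw(3) deg v by (simp add: Hvw_def homogenize_eq)
    hence "v^(m-1) / 2 = v^(m-1) * (v^2 * poly G (w / v))"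
    proof -
      have "v^(m+1) = v^(m-1) * v^2" using m by (simp flip: power_add)
      thus ?thesis using vw(3) deg v by (simp add: Hvw_def homogenize_eq)
    qed
    hence "1 / 2 = v^2 * poly G (w / v)" using v by (simp add: mult.assoc)
    hence "1 / 2 = cmod (v^2 * poly G (w / v))" by (metis norm_divide norm_numeral norm_one)
    hence "1 / 2 = cmod v^2 * cmod (poly G (w / v))" by (simp add: norm_mult norm_power)
    moreover have "cmod (poly G (w / v)) \<le> C"
      unfolding C_def poly_altdef deg
    proof (rule order_trans[OF norm_sum sum_mono])
      fix j
      have "cmod (w / v) \<le> 1" using le v by (simp add: norm_divide)
      hence "cmod (w / v)^j \<le> 1" by (simp add: power_le_one)
      thus "cmod (coeff G j * (w / v)^j) \<le> cmod (coeff G j)"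
        unfolding norm_mult norm_power by (simp add: mult_left_le)
    qed
    moreover have "cmod v^2 \<le> R^2" using vw(1) by (intro power_mono) auto
    ultimately have "1 / 2 \<le> R^2 * C" by (metis mult_mono norm_ge_zero zero_le_power2)
    thus False using R_small by (simp add: C_def mult.commute)
  qed
  thus w: "w \<noteq> 0" by auto
  define s where "s = v / w"
  have v_eq: "v = s * w" using w by (simp add: s_def)
  have s: "cmod s < 1" using lt w by (simp add: s_def norm_divide)
  have "v^(m-1) / 2 = w^(m+1) * poly (reflect_poly G) s"
    using vw(3) homogenize_conv_reflect_poly[OF deg w] by (simp add: Hvw_def s_def)
  moreover have "w^(m+1) = w^(m-1) * w^2" using m by (simp flip: power_add)
  ultimately have "w^(m-1) * s^(m-1) = w^(m-1) * (2 * w^2 * poly (reflect_poly G) s)"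
    by (simp add: v_eq power_mult_distrib field_simps)
  thus eq: "(v / w)^(m-1) = 2 * w^2 * poly (reflect_poly G) (v / w)"
    using w by (simp add: s_def)
  have "poly (reflect_poly G) s = homogenize (m+1) G s 1"
    using homogenize_conv_reflect_poly[OF deg, of 1 s] by simp
  also have "cmod \<dots> \<le> C" unfolding homogenize_def C_def
    using s by (intro order_trans[OF norm_sum sum_mono])
      (auto simp: norm_mult norm_power power_le_one mult_left_le)
  finally have gC: "cmod (poly (reflect_poly G) s) \<le> C" .
  have "cmod s^(m-1) = 2 * cmod w^2 * cmod (poly (reflect_poly G) s)"
    using arg_cong[OF eq, of cmod] by (simp add: s_def norm_mult norm_power)
  also have "\<dots> \<le> 2 * cmod w^2 * C" using gC by (intro mult_left_mono) auto
  finally have le: "cmod s^(m-1) \<le> 2 * cmod w^2 * C" .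
  have w2: "cmod w^2 < \<delta>^2" using vw(2) by (intro power_strict_mono) auto
  have "0 < cmod (lead_coeff G)" using lead_coeff_nz by simp
  hence Cpos: "C > 0" unfolding C_def using lead_coeff_le by (rule order_less_le_trans)
  have "2 * cmod w^2 * C < 2 * \<delta>^2 * C" using w2 Cpos by simp
  also have "\<dots> = 2 * C * \<delta>^2" by simp
  also have "\<dots> \<le> r0^(m-1)" unfolding C_def by (rule \<delta>_small)
  finally have "cmod s^(m-1) < r0^(m-1)" using le by simp
  hence sr: "cmod s < r0" by (rule power_less_imp_less_base) (use r in auto)
  thus "v / w \<in> ball 0 r0" by (simp add: s_def)
  have "s \<noteq> 0" 
  proof
    assume "s = 0"
    hence "(0::complex)^(m-1) = 2 * w^2 * lead_coeff G" using eq unfolding s_def[symmetric] by simp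
    thus False using m w lead_coeff_nz by (simp add: power_0_left)
  qed
  thus "v \<noteq> 0" by (simp add: v_eq w)
qed

lemma param_eq: "\<lbrakk>a \<in> A; \<theta> \<in> ball 0 \<rho>\<rbrakk> \<Longrightarrow> param a \<theta> = (\<theta>^(m-1) * S (a * \<theta>^2), \<theta>^(m-1))"
proof -
  assume a: "a \<in> A" and \<theta>: "\<theta> \<in> ball 0 \<rho>"
  have "\<theta>^(m+1) = \<theta>^(m-1) * \<theta>^2" using m by (simp flip: power_add)
  hence "a * \<theta>^(m+1) * F (S (a * \<theta>^2)) = \<theta>^(m-1) * (a * \<theta>^2 * F (S (a * \<theta>^2)))"
    by (simp only: mult_ac)
  also have "a * \<theta>^2 * F (S (a * \<theta>^2)) = S (a * \<theta>^2)" by (rule S_eq[symmetric, OF arg_in[OF a \<theta>]])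
  finally show ?thesis unfolding param_def by simp
qed

lemma param_0: "param a 0 = (0, 0)" using m by (simp add: param_def)

lemma param_ratio: "\<lbrakk>a \<in> A; \<theta> \<in> D\<rbrakk> \<Longrightarrow> fst (param a \<theta>) / snd (param a \<theta>) = S (a * \<theta>^2)"
  by (simp add: D_def param_eq)

lemma S_D: "\<lbrakk>a \<in> A; \<theta> \<in> D\<rbrakk> \<Longrightarrow> S (a * \<theta>^2) \<noteq> 0"
  using S_nz arg_in A_nz by (simp add: D_def)

lemma param_in_level: "\<lbrakk>a \<in> A; \<theta> \<in> D\<rbrakk> \<Longrightarrow> param a \<theta> \<in> level"
proof -
  assume a: "a \<in> A" and \<theta>: "\<theta> \<in> D"
  hence \<theta>': "\<theta> \<in> ball 0 \<rho>" "\<theta> \<noteq> 0" by (auto simp: D_def)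
  define w s where "w = \<theta>^(m-1)" and "s = S (a * \<theta>^2)"
  have w: "w \<noteq> 0" "cmod w < \<delta>" using \<theta>' \<rho>_iff[of \<theta>] by (auto simp: w_def)
  have s: "s \<in> ball 0 r1" "s = a * \<theta>^2 * F s"
    using S_in S_eq arg_in[OF a \<theta>'(1)] by (auto simp: s_def)
  have p: "param a \<theta> = (w * s, w)" by (simp add: param_eq[OF a \<theta>'(1)] w_def s_def)
  have "cmod s < 1" using s(1) r by simp
  hence "cmod (w * s) \<le> cmod w" by (simp add: norm_mult mult_left_le)
  hence "cmod (w * s) < R" using w R by linarith
  moreover have "Hvw m G (w * s) w = 0"
  proof -
    have "s^(m-1) = a^(m-1) * w^2 * F s^(m-1)"
      by (subst s(2)) (simp add: w_def power_mult_distrib mult.commute flip: power_mult)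
    also have "\<dots> = 2 * w^2 * poly (reflect_poly G) s"
      using a F_pow[OF s(1)] by (simp add: A_def mult_ac)
    finally have "s^(m-1) = 2 * w^2 * poly (reflect_poly G) s" .
    moreover have "w^(m+1) = w^(m-1) * w^2" using m by (simp flip: power_add)
    ultimately show ?thesis
      using w homogenize_conv_reflect_poly[OF deg, of w "w * s"]
      by (simp add: Hvw_def power_mult_distrib)
  qed
  ultimately show ?thesis using w by (simp add: p level_def)
qed

lemma param_fst_nz: "\<lbrakk>a \<in> A; \<theta> \<in> D\<rbrakk> \<Longrightarrow> fst (param a \<theta>) \<noteq> 0"
  using param_in_level level_ratio(1) by (metis prod.collapse)

text \<open>
  Choose any \<open>\<theta>\<close> with \<open>\<theta>\<^sup>m\<^sup>-\<^sup>1 = w\<close> and define \<open>a\<close> by \<open>s = a \<theta>\<^sup>2 F(s)\<close>; the equation of the curve says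
  that \<open>a\<close> is an admissible coefficient.
\<close>
lemma level_param:
  assumes p: "p \<in> level"
  obtains a \<theta> where "a \<in> A" "\<theta> \<in> D" "p = param a \<theta>"
proof -
  obtain v w where vw: "p = (v, w)" by (cases p)
  note lr = level_ratio[OF p[unfolded vw]]
  define s where "s = v / w"
  have s: "s \<in> ball 0 r0" "s \<in> ball 0 r1" using lr(3) r by (auto simp: s_def)
  obtain \<theta> where \<theta>: "w = \<theta>^(m-1)"
    using exists_complex_root[of "m-1" w] m by auto
  have wd: "cmod w < \<delta>" using p by (auto simp: level_def vw)
  have \<theta>D: "\<theta> \<in> D" using wd \<theta> lr(2) m \<rho>_iff[of \<theta>] by (auto simp: D_def power_0_left)
  hence \<theta>0: "\<theta> \<noteq> 0" by (simp add: D_def)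
  define a where "a = s / (\<theta>^2 * F s)"
  have "a^(m-1) = s^(m-1) / (w^2 * F s^(m-1))"
    by (simp add: a_def \<theta> power_divide power_mult_distrib mult.commute flip: power_mult)
  also have "\<dots> = 2 * lead_coeff G"
    using lr F_pow[OF s(2)] F_nz[OF s(2)] G_nz[OF s(2)] by (simp add: s_def[symmetric] field_simps)
  finally have a: "a \<in> A" by (simp add: A_def)
  have "s = a * \<theta>^2 * F s" using F_nz[OF s(2)] \<theta>0 by (simp add: a_def)
  moreover have \<theta>b: "\<theta> \<in> ball 0 \<rho>" using \<theta>D by (simp add: D_def)
  ultimately have "s = S (a * \<theta>^2)" using S_unique[OF s(2)] arg_in[OF a] by blast
  hence "param a \<theta> = p"
    unfolding param_eq[OF a \<theta>b] vw \<theta>[symmetric] using lr(2) by (simp add: s_def flip: \<open>s = S (a * \<theta>^2)\<close>)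
  thus ?thesis using that a \<theta>D by blast
qed

lemma param_eq_iff:
  assumes "a \<in> A" "a' \<in> A" "\<theta> \<in> ball 0 \<rho>" "\<theta>' \<in> ball 0 \<rho>"
  shows "param a \<theta> = param a' \<theta>' \<longleftrightarrow> \<theta>^(m-1) = \<theta>'^(m-1) \<and> a * \<theta>^2 = a' * \<theta>'^2"
proof
  assume L: "param a \<theta> = param a' \<theta>'"
  hence w: "\<theta>^(m-1) = \<theta>'^(m-1)" by (simp add: param_def)
  show "\<theta>^(m-1) = \<theta>'^(m-1) \<and> a * \<theta>^2 = a' * \<theta>'^2"
  proof (cases "\<theta> = 0")
    case True
    thus ?thesis using w m by (simp add: power_0_left)
  next
    case False
    have "\<theta>' \<noteq> 0"
    proof
      assume "\<theta>' = 0"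
      thus False using w m False by (simp add: power_0_left)
    qed
    with False have "S (a * \<theta>^2) = S (a' * \<theta>'^2)"
      using L w assms by (simp add: param_eq)
    thus ?thesis using w S_inj arg_in assms by blast
  qed
qed (use assms in \<open>simp add: param_eq\<close>)

lemma leaf_subset_level: "a \<in> A \<Longrightarrow> leaf a \<subseteq> level"
  using param_in_level by (auto simp: leaf_def)

lemma level_eq_leafs: "level = (\<Union>a\<in>A. leaf a)"
  using leaf_subset_level by (auto simp: leaf_def elim!: level_param)

text \<open>
  A parametrization is determined up to multiplication of \<open>\<theta>\<close> by a root of unity \<open>c\<close> of order
  dividing \<open>m - 1\<close>, which divides the coefficient \<open>a\<close> by \<open>c\<^sup>2\<close>.
\<close>
lemma leafs_common_point:
  assumes a: "a \<in> A" "a' \<in> A" and p: "p \<in> leaf a" "p \<in> leaf a'"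
  shows "\<exists>c. c^(m-1) = 1 \<and> a = a' * c^2"
proof -
  obtain \<theta> \<theta>' where t: "\<theta> \<in> D" "\<theta>' \<in> D" "param a \<theta> = param a' \<theta>'"
    using p by (auto simp: leaf_def)
  have nz: "\<theta> \<noteq> 0" "\<theta>' \<noteq> 0" using t by (auto simp: D_def)
  have "\<theta>^(m-1) = \<theta>'^(m-1)" "a * \<theta>^2 = a' * \<theta>'^2"
    using param_eq_iff[OF a] t by (auto simp: D_def)
  hence "(\<theta>' / \<theta>)^(m-1) = 1" "a = a' * (\<theta>' / \<theta>)^2"
    using nz by (auto simp: power_divide field_simps)
  thus ?thesis by blast
qed

lemma param_rotate:
  assumes a: "a \<in> A" "a' \<in> A" and c: "c^(m-1) = 1" "a = a' * c^2" and \<theta>: "\<theta> \<in> D"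
  shows "c * \<theta> \<in> D" "param a \<theta> = param a' (c * \<theta>)"
proof -
  show c\<theta>: "c * \<theta> \<in> D"
    using \<theta> norm_root_of_unity[OF c(1)] c(1) m by (auto simp: D_def norm_mult power_0_left)
  show "param a \<theta> = param a' (c * \<theta>)"
    using param_eq_iff[OF a, of \<theta> "c * \<theta>"] \<theta> c\<theta> c
    by (simp add: D_def power_mult_distrib mult_ac)
qed

lemma leaf_eq_or_disjoint:
  assumes a: "a \<in> A" "a' \<in> A" and p: "p \<in> leaf a" "p \<in> leaf a'"
  shows "leaf a = leaf a'"
proof -
  have "leaf a \<subseteq> leaf a'" if "a \<in> A" "a' \<in> A" "p \<in> leaf a" "p \<in> leaf a'" for a a'
    using leafs_common_point[OF that] param_rotate[OF that(1,2)] unfolding leaf_def by blast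
  thus ?thesis using a p by blast
qed

lemma leaf_eq_iff:
  assumes a: "a \<in> A" "a' \<in> A"
  shows "leaf a = leaf a' \<longleftrightarrow> (\<exists>c. c^(m-1) = 1 \<and> a = a' * c^2)"
proof -
  have "of_real (\<rho> / 2) \<in> D" using \<rho>_pos by (simp add: D_def)
  hence p: "param a (of_real (\<rho> / 2)) \<in> leaf a" by (simp add: leaf_def)
  show ?thesis
  proof
    assume "leaf a = leaf a'"
    thus "\<exists>c. c^(m-1) = 1 \<and> a = a' * c^2" using leafs_common_point[OF a p] p by simp
  next
    assume "\<exists>c. c^(m-1) = 1 \<and> a = a' * c^2"
    hence "param a (of_real (\<rho> / 2)) \<in> leaf a'"
      using param_rotate[OF a] \<open>of_real (\<rho> / 2) \<in> D\<close> unfolding leaf_def by blast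
    thus "leaf a = leaf a'" by (rule leaf_eq_or_disjoint[OF a p])
  qed
qed

lemma param_holomorphic:
  assumes a: "a \<in> A"
  shows "(\<lambda>\<theta>. fst (param a \<theta>)) holomorphic_on ball 0 \<rho>" "(\<lambda>\<theta>. snd (param a \<theta>)) holomorphic_on ball 0 \<rho>"
    "(\<lambda>\<theta>. F (S (a * \<theta>^2))) holomorphic_on ball 0 \<rho>" "(\<lambda>\<theta>. N (S (a * \<theta>^2))) holomorphic_on ball 0 \<rho>"
    "(\<lambda>\<theta>. S (a * \<theta>^2)) holomorphic_on ball 0 \<rho>" "(\<lambda>\<theta>. deriv S (a * \<theta>^2)) holomorphic_on ball 0 \<rho>"
proof -
  have 1: "(\<lambda>\<theta>. a * \<theta>^2) holomorphic_on ball 0 \<rho>" "(\<lambda>\<theta>. a * \<theta>^2) ` ball 0 \<rho> \<subseteq> ball 0 r0"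
    using arg_in[OF a] by (auto intro!: holomorphic_intros)
  show 2: "(\<lambda>\<theta>. S (a * \<theta>^2)) holomorphic_on ball 0 \<rho>"
    using holomorphic_on_compose_gen[OF 1(1) S_hol 1(2)] by (simp add: o_def)
  have 3: "(\<lambda>\<theta>. S (a * \<theta>^2)) ` ball 0 \<rho> \<subseteq> ball 0 r1" using S_in arg_in[OF a] by blast
  show F: "(\<lambda>\<theta>. F (S (a * \<theta>^2))) holomorphic_on ball 0 \<rho>"
    using holomorphic_on_compose_gen[OF 2 F_hol 3] by (simp add: o_def)
  show "(\<lambda>\<theta>. N (S (a * \<theta>^2))) holomorphic_on ball 0 \<rho>"
    using holomorphic_on_compose_gen[OF 2 N_hol 3] by (simp add: o_def)
  have "deriv S holomorphic_on ball 0 r0" by (intro holomorphic_deriv S_hol) auto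
  from holomorphic_on_compose_gen[OF 1(1) this 1(2)]
  show "(\<lambda>\<theta>. deriv S (a * \<theta>^2)) holomorphic_on ball 0 \<rho>" by (simp add: o_def)
  show "(\<lambda>\<theta>. fst (param a \<theta>)) holomorphic_on ball 0 \<rho>" "(\<lambda>\<theta>. snd (param a \<theta>)) holomorphic_on ball 0 \<rho>"
    unfolding param_def fst_conv snd_conv by (intro holomorphic_intros F)+
qed

lemma param_continuous: "a \<in> A \<Longrightarrow> continuous_on (ball 0 \<rho>) (param a)"
proof -
  assume a: "a \<in> A"
  have "continuous_on (ball 0 \<rho>) (\<lambda>\<theta>. (fst (param a \<theta>), snd (param a \<theta>)))"
    by (intro continuous_on_Pair holomorphic_on_imp_continuous_on param_holomorphic[OF a])
  thus ?thesis by simp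
qed

lemma param_ball: "param a ` ball 0 \<rho> = insert (0, 0) (leaf a)"
proof -
  have "ball (0::complex) \<rho> = insert 0 D" using \<rho>_pos by (auto simp: D_def)
  thus ?thesis by (simp add: leaf_def param_0)
qed

text \<open>
  The second component of \<open>param a \<theta>\<close> controls \<open>\<bar>\<theta>\<bar>\<close>, so limit points inside the polydisc are
  limits over a compact set of parameters.
\<close>
lemma closure_leaf:
  assumes a: "a \<in> A"
  shows "(0, 0) \<in> closure (leaf a)" "closure (leaf a) \<inter> U = insert (0, 0) (leaf a)"
proof -
  have 0: "(0, 0) \<in> closure (leaf a)"
  proof -
    have "(param a \<longlongrightarrow> param a 0) (at 0)"
      using param_continuous[OF a] \<rho>_pos
      by (simp add: continuous_on_eq_continuous_at isCont_def)
    moreover have "\<forall>\<^sub>F \<theta> in at 0. param a \<theta> \<in> closure (leaf a)"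
      using eventually_at_ball[OF \<rho>_pos, of "0::complex" UNIV] eventually_neq_at_within[of "0::complex" 0 UNIV]
      by eventually_elim (rule closure_subset[THEN subsetD], auto simp: leaf_def D_def)
    ultimately show ?thesis
      using Lim_in_closed_set[of "closure (leaf a)" "param a" "at 0" "param a 0"] by (simp add: param_0)
  qed
  thus "(0, 0) \<in> closure (leaf a)" .
  have "p \<in> insert (0, 0) (leaf a)" if p: "p \<in> closure (leaf a)" "p \<in> U" for p
  proof -
    have "cmod (snd p) < \<delta>" using p(2) by auto
    then obtain e where e: "cmod (snd p) < e" "e < \<delta>" using dense by blast
    define r' where "r' = root (m-1) e"
    have e0: "e > 0" using e(1) norm_ge_zero[of "snd p"] by linarith
    have r': "r' > 0" "r'^(m-1) = e" "r' < \<rho>"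
      using e e0 m by (auto simp: r'_def \<rho>_def)
    let ?K = "param a ` cball 0 r'"
    have "compact ?K"
      using r' by (intro compact_continuous_image continuous_on_subset[OF param_continuous[OF a]]) auto
    hence "closed ?K" by (rule compact_imp_closed)
    let ?O = "snd -` ball 0 e :: (complex \<times> complex) set"
    have oO: "open ?O" by (intro open_vimage_snd) auto
    have "?O \<inter> leaf a \<subseteq> ?K"
    proof
      fix q assume "q \<in> ?O \<inter> leaf a"
      then obtain \<theta> where \<theta>: "q = param a \<theta>" "cmod (snd q) < e" by (auto simp: leaf_def)
      hence "cmod \<theta>^(m-1) < r'^(m-1)" using r'(2) by (simp add: param_def norm_power)
      hence "cmod \<theta> < r'" using r'(1) by (meson less_imp_le power_less_imp_less_base)
      thus "q \<in> ?K" using \<theta>(1) by auto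
    qed
    moreover have "p \<in> closure (?O \<inter> leaf a)"
      using open_Int_closure_subset[OF oO, of "leaf a"] p(1) e(1) by auto
    ultimately have "p \<in> ?K" using \<open>closed ?K\<close> closure_minimal by blast
    thus ?thesis using param_ball[of a] r'(3) by (auto simp: subset_iff)
  qed
  moreover have "insert (0, 0) (leaf a) \<subseteq> U"
    using leaf_subset_level[OF a] R by (auto simp: level_def zero_prod_def)
  ultimately show "closure (leaf a) \<inter> U = insert (0, 0) (leaf a)"
    using 0 closure_subset[of "leaf a"] by blast
qed

text \<open>
  There are only finitely many leafs, they are disjoint, and each is closed relative to the
  level curve. Hence a connected set cannot pass from one to another.
\<close>
lemma connected_in_leaf:
  fixes f :: "'b::topological_space \<Rightarrow> complex \<times> complex"
  assumes T: "connected T" "continuous_on T f" "f ` T \<subseteq> level"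
    and a: "a \<in> A" and t0: "t0 \<in> T" "f t0 \<in> leaf a"
  shows "f ` T \<subseteq> leaf a"
proof -
  have cl: "closedin (top_of_set T) {t \<in> T. f t \<in> leaf b}" if b: "b \<in> A" for b
  proof -
    have "f t \<in> leaf b \<longleftrightarrow> f t \<in> closure (leaf b)" if "t \<in> T" for t
    proof -
      have "f t \<in> U" "f t \<noteq> (0, 0)" using T(3) that by (auto simp: level_def)
      moreover have "f t \<in> closure (leaf b) \<and> f t \<in> U \<longleftrightarrow> f t = (0, 0) \<or> f t \<in> leaf b"
        using arg_cong[OF closure_leaf(2)[OF b], of "\<lambda>X. f t \<in> X"] by (simp only: Int_iff insert_iff)
      ultimately show ?thesis by metis
    qed
    hence "{t \<in> T. f t \<in> leaf b} = T \<inter> f -` closure (leaf b)" by blast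
    thus ?thesis using continuous_closedin_preimage[OF T(2) closed_closure] by simp
  qed
  have "T \<subseteq> {t \<in> T. f t \<in> leaf a}"
  proof (rule connected_finite_closed_cover[OF T(1), where K = "leaf ` A" and C = "\<lambda>L. {t \<in> T. f t \<in> L}"])
    show "T \<subseteq> (\<Union>L\<in>leaf ` A. {t \<in> T. f t \<in> L})"
      using T(3) unfolding level_eq_leafs by blast
    show "{t \<in> T. f t \<in> L} \<inter> {t \<in> T. f t \<in> L'} = {}" if "L \<in> leaf ` A" "L' \<in> leaf ` A" "L \<noteq> L'" for L L'
      using that leaf_eq_or_disjoint by blast
  qed (use finite_A cl a t0 in auto)
  thus ?thesis by blast
qed

lemma level_energy:
  assumes "(v, w) \<in> level"
  shows "Hxy G (w / v) (1 / v) = 0"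
proof -
  have "v \<noteq> 0" by (rule level_ratio(1)[OF assms])
  moreover have "Hvw m G v w = 0" using assms by (simp add: level_def)
  ultimately show ?thesis using Hvw_eq[OF m deg, of v w] by (metis mult_eq_0_iff power_not_zero)
qed

lemma energy_in_level:
  assumes "(v, w) \<in> U" "v \<noteq> 0" "Hxy G (w / v) (1 / v) = 0"
  shows "(v, w) \<in> level"
  using assms Hvw_eq[OF m deg, of v w] by (auto simp: level_def)

lemma param_time_holomorphic: "a \<in> A \<Longrightarrow> param_time a holomorphic_on ball 0 \<rho>"
  unfolding param_time_def by (intro holomorphic_intros param_holomorphic) auto

lemma param_time_eq: "\<lbrakk>a \<in> A; \<theta> \<in> D\<rbrakk> \<Longrightarrow> blowup_time (param a \<theta>) = param_time a \<theta>"
  unfolding blowup_time_def param_ratio by (simp add: param_time_def param_def)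

lemma deriv_param_time:
  "\<lbrakk>a \<in> A; \<theta> \<in> ball 0 \<rho>\<rbrakk> \<Longrightarrow> deriv (param_time a) \<theta> =
     - 2 * \<theta>^(m-2) * deriv S (a * \<theta>^2) / F (S (a * \<theta>^2))"
  by (rule DERIV_imp_deriv[OF param_time_derivative[OF arg_in]])

lemma deriv_param_time_nz: "\<lbrakk>a \<in> A; \<theta> \<in> D\<rbrakk> \<Longrightarrow> deriv (param_time a) \<theta> \<noteq> 0"
  using deriv_param_time[of a \<theta>] arg_in[of a \<theta>] S_deriv_nz F_nz S_in by (simp add: D_def)

lemma open_D: "open D" by (simp add: D_def open_delete)

lemma connected_D: "connected D"
  unfolding D_def by (rule connected_punctured_ball) simp

text \<open>
  The equation for \<open>x = 1/S(a \<theta>\<^sup>2)\<close> is a computation; the one for \<open>y\<close> follows by differentiation of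
  the energy \<open>y\<^sup>2/2 = G(x)\<close>, because \<open>y\<close> does not vanish.
\<close>
lemma original_time:
  assumes a: "a \<in> A"
  shows "original_time_along G D (param_time a) (param a)"
  unfolding original_time_along_def
proof (intro ballI conjI)
  fix \<theta> assume \<theta>: "\<theta> \<in> D"
  hence \<theta>': "\<theta> \<in> ball 0 \<rho>" "\<theta> \<noteq> 0" by (auto simp: D_def)
  define z where "z = a * \<theta>^2"
  have z: "z \<in> ball 0 r0" using arg_in[OF a \<theta>'(1)] by (simp add: z_def)
  show v: "fst (param a \<theta>) \<noteq> 0" by (rule param_fst_nz[OF a \<theta>])
  have S0: "S z \<noteq> 0" using S_D[OF a \<theta>] by (simp add: z_def)
  obtain n where n: "m = Suc (Suc n)" using m by (metis add_2_eq_Suc less_eqE)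
  have ev: "\<forall>\<^sub>F \<theta> in nhds \<theta>. \<theta> \<in> D" by (rule eventually_nhds_in_open[OF open_D \<theta>])
  define x y where "x = (\<lambda>\<theta>. snd (param a \<theta>) / fst (param a \<theta>))" and "y = (\<lambda>\<theta>. 1 / fst (param a \<theta>))"
  have x_eq: "x \<theta> = 1 / S (a * \<theta>^2)" if "\<theta> \<in> D" for \<theta>
    using that S_D[OF a that] by (simp add: x_def D_def param_eq[OF a])
  have dS: "(S has_field_derivative deriv S z) (at z)"
    using holomorphic_derivI[OF S_hol _ z] by simp
  have "((\<lambda>\<theta>. a * \<theta>^2) has_field_derivative a * (2 * \<theta>)) (at \<theta>)"
    by (auto intro!: derivative_eq_intros)
  hence "((\<lambda>\<theta>. S (a * \<theta>^2)) has_field_derivative deriv S z * (a * (2 * \<theta>))) (at \<theta>)"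
    unfolding z_def
    by (rule DERIV_chain2[where f = S and g = "\<lambda>\<theta>. a * \<theta>^2", OF dS[unfolded z_def]])
  hence "((\<lambda>\<theta>. 1 / S (a * \<theta>^2)) has_field_derivative - (deriv S z * (a * (2 * \<theta>))) / (S z * S z)) (at \<theta>)"
    using S0 by (auto intro!: derivative_eq_intros simp: z_def)
  also have "- (deriv S z * (a * (2 * \<theta>))) / (S z * S z) = y \<theta> * deriv (param_time a) \<theta>"
  proof -
    define q \<sigma> \<sigma>' where "q = \<theta>^n" and "\<sigma> = S z" and "\<sigma>' = deriv S z"
    have fv: "fst (param a \<theta>) = \<theta> * q * \<sigma>" 
      unfolding param_eq[OF a \<theta>'(1)] z_def q_def \<sigma>_def by (simp add: n)
    have fF: "F \<sigma> = \<sigma> / (a * \<theta> * \<theta>)"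
    proof -
      have "\<sigma> = a * \<theta> * \<theta> * F \<sigma>" using S_eq[OF z] by (simp add: \<sigma>_def z_def power2_eq_square mult.assoc)
      thus ?thesis using \<theta>'(2) A_nz[OF a] by (metis mult_eq_0_iff nonzero_mult_div_cancel_left)
    qed
    have fd: "deriv (param_time a) \<theta> = - 2 * q * \<sigma>' / F \<sigma>"
      using deriv_param_time[OF a \<theta>'(1)] by (simp add: z_def q_def \<sigma>_def \<sigma>'_def n)
    have "q \<noteq> 0" "\<sigma> \<noteq> 0" using \<theta>'(2) S0 by (auto simp: q_def \<sigma>_def)
    thus ?thesis using \<theta>'(2) A_nz[OF a]
      unfolding y_def \<sigma>_def[symmetric] \<sigma>'_def[symmetric] fv fd fF by (simp add: field_simps)
  qed
  finally have dS': "((\<lambda>\<theta>. 1 / S (a * \<theta>^2)) has_field_derivative y \<theta> * deriv (param_time a) \<theta>) (at \<theta>)" .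
  have dx: "(x has_field_derivative y \<theta> * deriv (param_time a) \<theta>) (at \<theta>)"
    by (rule has_field_derivative_transform_within_open[OF dS' open_D \<theta>]) (rule x_eq[symmetric])
  thus "((\<lambda>\<theta>. snd (param a \<theta>) / fst (param a \<theta>)) has_field_derivative
           1 / fst (param a \<theta>) * deriv (param_time a) \<theta>) (at \<theta>)"
    by (simp add: x_def y_def)
  have "(\<lambda>\<theta>. fst (param a \<theta>)) field_differentiable at \<theta>"
    by (rule holomorphic_on_imp_differentiable_at[OF param_holomorphic(1)[OF a] open_ball \<theta>'(1)])
  then obtain v' where "((\<lambda>\<theta>. fst (param a \<theta>)) has_field_derivative v') (at \<theta>)"
    by (auto simp: field_differentiable_def)
  hence "(y has_field_derivative - v' / (fst (param a \<theta>) * fst (param a \<theta>))) (at \<theta>)"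
    unfolding y_def using v by (auto intro!: derivative_eq_intros)
  then obtain y' where dy: "(y has_field_derivative y') (at \<theta>)" by blast
  have energy: "Hxy G (x \<theta>) (y \<theta>) = 0" if "\<theta> \<in> D" for \<theta>
    using level_energy[of "fst (param a \<theta>)" "snd (param a \<theta>)"] param_in_level[OF a that]
    by (simp add: x_def y_def)
  have d1: "((\<lambda>\<theta>. Hxy G (x \<theta>) (y \<theta>)) has_field_derivative
      y \<theta> * y' - poly (pderiv G) (x \<theta>) * (y \<theta> * deriv (param_time a) \<theta>)) (at \<theta>)"
    unfolding Hxy_def
    by (rule DERIV_cong[OF DERIV_diff[OF DERIV_cdivide[OF DERIV_power[OF dy, where n = 2], where c = 2]
          DERIV_chain2[OF poly_DERIV dx]]]) simp
  have ev_H: "\<forall>\<^sub>F \<theta> in nhds \<theta>. Hxy G (x \<theta>) (y \<theta>) = 0" using ev by eventually_elim (rule energy)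
  have "((\<lambda>\<theta>. Hxy G (x \<theta>) (y \<theta>)) has_field_derivative 0) (at \<theta>)"
    by (rule iffD2[OF DERIV_cong_ev[OF refl ev_H refl] DERIV_const])
  from DERIV_unique[OF d1 this]
  have "y \<theta> * y' = y \<theta> * (poly (pderiv G) (x \<theta>) * deriv (param_time a) \<theta>)"
    by (simp add: algebra_simps)
  hence "y' = poly (pderiv G) (x \<theta>) * deriv (param_time a) \<theta>"
    using v by (simp add: y_def)
  with dy show "((\<lambda>\<theta>. 1 / fst (param a \<theta>)) has_field_derivative
            poly (pderiv G) (snd (param a \<theta>) / fst (param a \<theta>)) * deriv (param_time a) \<theta>) (at \<theta>)"
    by (simp add: x_def y_def)
qed

lemma S_deriv_0: "deriv S 0 = 1"
  using N_S_ode[of 0] r(1) by (simp add: S_0 N_0 F_0)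

lemma param_time_deriv_expansion:
  assumes a: "a \<in> A"
  shows "\<exists>h. h holomorphic_on ball 0 \<rho> \<and> h 0 = 0 \<and>
     (\<forall>\<theta>\<in>ball 0 \<rho>. deriv (param_time a) \<theta> =
        - (2 / of_nat (m-1)) * (1 + h \<theta>) * deriv (\<lambda>\<theta>. snd (param a \<theta>)) \<theta>)"
proof (rule exI[of _ "\<lambda>\<theta>. deriv S (a * \<theta>^2) / F (S (a * \<theta>^2)) - 1"], intro conjI ballI)
  show "(\<lambda>\<theta>. deriv S (a * \<theta>^2) / F (S (a * \<theta>^2)) - 1) holomorphic_on ball 0 \<rho>"
    by (intro holomorphic_intros param_holomorphic[OF a]) (use F_nz S_in arg_in[OF a] in blast)
  show "deriv S (a * 0^2) / F (S (a * 0^2)) - 1 = 0" by (simp add: S_0 F_0 S_deriv_0)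
  fix \<theta> :: complex assume \<theta>: "\<theta> \<in> ball 0 \<rho>"
  obtain n where n: "m = Suc (Suc n)" using m by (metis add_2_eq_Suc less_eqE)
  have "((\<lambda>\<theta>. snd (param a \<theta>)) has_field_derivative of_nat (m-1) * \<theta>^(m-2)) (at \<theta>)"
    unfolding param_def snd_conv
    using DERIV_power[OF DERIV_ident, where n = "m-1"] by (simp add: n)
  hence d: "deriv (\<lambda>\<theta>. snd (param a \<theta>)) \<theta> = of_nat (m-1) * \<theta>^(m-2)" by (rule DERIV_imp_deriv)
  have "of_nat (m-1) \<noteq> (0::complex)" using m by simp
  thus "deriv (param_time a) \<theta> = - (2 / of_nat (m-1)) *
      (1 + (deriv S (a * \<theta>^2) / F (S (a * \<theta>^2)) - 1)) * deriv (\<lambda>\<theta>. snd (param a \<theta>)) \<theta>"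
    unfolding deriv_param_time[OF a \<theta>] d by (simp add: field_simps del: of_nat_diff)
qed

lemma param_time_expansion:
  assumes a: "a \<in> A"
  shows "\<exists>k. k holomorphic_on ball 0 \<rho> \<and> k 0 = 0 \<and>
     (\<forall>\<theta>\<in>ball 0 \<rho>. param_time a \<theta> = - (2 / of_nat (m-1)) * \<theta>^(m-1) * (1 + k \<theta>))"
  by (rule exI[of _ "\<lambda>\<theta>. N (S (a * \<theta>^2)) - 1"])
     (auto simp: S_0 N_0 param_time_def intro!: holomorphic_intros param_holomorphic[OF a])

lemma level_ratio_r1: "(v, w) \<in> level \<Longrightarrow> v / w \<in> ball 0 r1"
  using level_ratio(3) r(2) by fastforce

section \<open>Orbits on the level curve\<close>

text \<open>
  Time has non-vanishing derivative on the punctured disc, so it may replace \<open>\<theta>\<close> as a local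
  parameter; in this parameter the curve solves the pendulum equation.
\<close>
lemma leaf_local_solution:
  assumes a: "a \<in> A" and \<theta>0: "\<theta>0 \<in> D"
  obtains r W g where "r > 0" "open W" "\<theta>0 \<in> W" "W \<subseteq> D"
    "g holomorphic_on ball (param_time a \<theta>0) r"
    "g ` ball (param_time a \<theta>0) r = W"
    "\<And>\<theta>. \<theta> \<in> W \<Longrightarrow> g (param_time a \<theta>) = \<theta> \<and> param_time a \<theta> \<in> ball (param_time a \<theta>0) r"
    "pendulum_solution G (ball (param_time a \<theta>0) r)
       (\<lambda>t. snd (param a (g t)) / fst (param a (g t))) (\<lambda>t. 1 / fst (param a (g t)))"
proof -
  let ?T = "param_time a"
  have hol: "?T holomorphic_on D"
    using param_time_holomorphic[OF a] by (rule holomorphic_on_subset) (auto simp: D_def)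
  obtain r W g where rgW: "r > 0" "open W" "\<theta>0 \<in> W" "W \<subseteq> D" "?T ` W = ball (?T \<theta>0) r"
    "g holomorphic_on ball (?T \<theta>0) r" "g ` ball (?T \<theta>0) r = W"
    "\<And>y. y \<in> ball (?T \<theta>0) r \<Longrightarrow> ?T (g y) = y" "\<And>z. z \<in> W \<Longrightarrow> g (?T z) = z"
    "\<And>y. y \<in> ball (?T \<theta>0) r \<Longrightarrow> deriv ?T (g y) \<noteq> 0"
    "\<And>y. y \<in> ball (?T \<theta>0) r \<Longrightarrow> (g has_field_derivative 1 / deriv ?T (g y)) (at y)"
    using holomorphic_local_inverse[OF hol open_D \<theta>0 deriv_param_time_nz[OF a \<theta>0]] by blast
  have sol: "pendulum_solution G (ball (?T \<theta>0) r)
       (\<lambda>t. snd (param a (g t)) / fst (param a (g t))) (\<lambda>t. 1 / fst (param a (g t)))"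
    unfolding pendulum_solution_def
  proof (intro ballI conjI)
    fix t assume t: "t \<in> ball (?T \<theta>0) r"
    hence gD: "g t \<in> D" using rgW(4,7) by blast
    note d = original_time[OF a, unfolded original_time_along_def, rule_format, OF gD]
    have nz: "deriv ?T (g t) \<noteq> 0" by (rule rgW(10)[OF t])
    have "((\<lambda>t. snd (param a (g t)) / fst (param a (g t))) has_field_derivative
       1 / fst (param a (g t)) * deriv ?T (g t) * (1 / deriv ?T (g t))) (at t)"
      by (rule DERIV_chain2[where g = g, OF _ rgW(11)[OF t]]) (use d in blast)
    thus "((\<lambda>t. snd (param a (g t)) / fst (param a (g t))) has_field_derivative
       1 / fst (param a (g t))) (at t)" using nz by simp
    have "((\<lambda>t. 1 / fst (param a (g t))) has_field_derivative
       poly (pderiv G) (snd (param a (g t)) / fst (param a (g t))) * deriv ?T (g t) * (1 / deriv ?T (g t))) (at t)"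
      by (rule DERIV_chain2[where g = g, OF _ rgW(11)[OF t]]) (use d in blast)
    thus "((\<lambda>t. 1 / fst (param a (g t))) has_field_derivative
       poly (pderiv G) (snd (param a (g t)) / fst (param a (g t)))) (at t)" using nz by simp
  qed
  show ?thesis
  proof (rule that[OF rgW(1-4) rgW(6,7) _ sol])
    fix \<theta> assume "\<theta> \<in> W"
    thus "g (?T \<theta>) = \<theta> \<and> ?T \<theta> \<in> ball (?T \<theta>0) r" using rgW(5,9) by blast
  qed
qed

text \<open>
  The rescaled time \<open>t\<^sub>2\<close> is a primitive \<open>h\<close> of \<open>1/v\<^sup>m\<^sup>-\<^sup>1\<close> with respect to original time, and its local
  inverse \<open>k\<close> is the change of time that leads to the \<open>(v, w)\<close>-system.
\<close>
lemma joined_locally: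
  assumes a: "a \<in> A" and \<theta>0: "\<theta>0 \<in> D"
  shows "\<exists>W. open W \<and> \<theta>0 \<in> W \<and> W \<subseteq> D \<and>
    (\<forall>\<theta>\<in>W. joined_by_solution m G U (param a \<theta>0) (param a \<theta>))"
proof -
  let ?T = "param_time a"
  obtain r W g where rgW: "r > 0" "open W" "\<theta>0 \<in> W" "W \<subseteq> D"
    "g holomorphic_on ball (?T \<theta>0) r" "g ` ball (?T \<theta>0) r = W"
    "\<And>\<theta>. \<theta> \<in> W \<Longrightarrow> g (?T \<theta>) = \<theta> \<and> ?T \<theta> \<in> ball (?T \<theta>0) r"
    and sol: "pendulum_solution G (ball (?T \<theta>0) r)
       (\<lambda>t. snd (param a (g t)) / fst (param a (g t))) (\<lambda>t. 1 / fst (param a (g t)))"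
    using leaf_local_solution[OF a \<theta>0] by blast
  define B where "B = ball (?T \<theta>0) r"
  define v w where "v = (\<lambda>t. fst (param a (g t)))" and "w = (\<lambda>t. snd (param a (g t)))"
  have gB: "g t \<in> D" if "t \<in> B" for t using that rgW(4,6) unfolding B_def by blast
  have v_nz: "v t \<noteq> 0" if "t \<in> B" for t unfolding v_def by (rule param_fst_nz[OF a gB[OF that]])
  have v_hol: "v holomorphic_on B"
  proof -
    have "g ` B \<subseteq> ball 0 \<rho>" using gB by (auto simp: D_def)
    from holomorphic_on_compose_gen[OF rgW(5)[folded B_def] param_holomorphic(1)[OF a] this]
    show ?thesis by (simp add: v_def o_def)
  qed
  have "(\<lambda>t. 1 / v t^(m-1)) holomorphic_on B"
    using v_nz by (intro holomorphic_intros v_hol) auto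
  moreover have "convex B" "open B" by (auto simp: B_def)
  ultimately obtain h where h': "\<And>t. t \<in> B \<Longrightarrow> (h has_field_derivative 1 / v t^(m-1)) (at t within B)"
    using holomorphic_convex_primitive' by metis
  have h: "(h has_field_derivative 1 / v t^(m-1)) (at t)" if "t \<in> B" for t
    using h'[OF that] at_within_open[OF that \<open>open B\<close>] by simp
  have h_hol: "h holomorphic_on B"
    unfolding holomorphic_on_open[OF \<open>open B\<close>] using h by blast
  have dh: "deriv h t = 1 / v t^(m-1)" if "t \<in> B" for t by (rule DERIV_imp_deriv[OF h[OF that]])
  have t0: "?T \<theta>0 \<in> B" using rgW(1) by (simp add: B_def)
  have dh0: "deriv h (?T \<theta>0) \<noteq> 0" using dh[OF t0] v_nz[OF t0] by simp
  obtain r' W' k where k: "r' > 0" "open W'" "?T \<theta>0 \<in> W'" "W' \<subseteq> B" "h ` W' = ball (h (?T \<theta>0)) r'"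
    "k holomorphic_on ball (h (?T \<theta>0)) r'" "k ` ball (h (?T \<theta>0)) r' = W'"
    "\<And>y. y \<in> ball (h (?T \<theta>0)) r' \<Longrightarrow> h (k y) = y" "\<And>z. z \<in> W' \<Longrightarrow> k (h z) = z"
    "\<And>y. y \<in> ball (h (?T \<theta>0)) r' \<Longrightarrow> deriv h (k y) \<noteq> 0"
    "\<And>y. y \<in> ball (h (?T \<theta>0)) r' \<Longrightarrow> (k has_field_derivative 1 / deriv h (k y)) (at y)"
    using holomorphic_local_inverse[OF h_hol \<open>open B\<close> t0 dh0] by blast
  define S2 where "S2 = ball (h (?T \<theta>0)) r'"
  have kB: "k \<tau> \<in> B" if "\<tau> \<in> S2" for \<tau> using that k(4,7) unfolding S2_def by blast
  have kd: "(k has_field_derivative v (k \<tau>)^(m-1)) (at \<tau>)" if "\<tau> \<in> S2" for \<tau>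
    using k(11)[of \<tau>] that dh[OF kB[OF that]] by (simp add: S2_def)
  have inj: "inj_on k S2" using k(8) unfolding S2_def by (metis inj_onI)
  have sol': "pendulum_solution G (k ` S2) (\<lambda>t. w t / v t) (\<lambda>t. 1 / v t)"
    using sol k(4,7) unfolding pendulum_solution_def S2_def B_def v_def w_def by blast
  have "\<forall>\<tau>\<in>S2. 1 / v (k \<tau>) \<noteq> 0 \<and> (k has_field_derivative (1 / (1 / v (k \<tau>)))^(m-1)) (at \<tau>)"
    using kd v_nz[OF kB] by simp
  from pendulum_vw_iff[OF m deg _ inj this, where x = "\<lambda>t. w t / v t"] sol'
  have fields: "((\<lambda>\<tau>. v (k \<tau>)) has_field_derivative
              fst (vw_field m G (v (k \<tau>), w (k \<tau>) / v (k \<tau>) / (1 / v (k \<tau>))))) (at \<tau>)"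
     "((\<lambda>\<tau>. w (k \<tau>) / v (k \<tau>) / (1 / v (k \<tau>))) has_field_derivative
              snd (vw_field m G (v (k \<tau>), w (k \<tau>) / v (k \<tau>) / (1 / v (k \<tau>))))) (at \<tau>)" if "\<tau> \<in> S2" for \<tau>
    using that by (auto simp: S2_def)
  have joined: "joined_by_solution m G U (param a \<theta>0) (param a \<theta>)" if \<theta>: "\<theta> \<in> W" "?T \<theta> \<in> W'" for \<theta>
    unfolding joined_by_solution_def
  proof (rule exI[of _ S2], rule exI[of _ "\<lambda>\<tau>. v (k \<tau>)"], rule exI[of _ "\<lambda>\<tau>. w (k \<tau>)"],
      intro conjI ballI)
    show "open S2" "connected S2" by (auto simp: S2_def)
    have im: "param a \<phi> \<in> (\<lambda>\<tau>. (v (k \<tau>), w (k \<tau>))) ` S2" if \<phi>: "\<phi> \<in> W" "?T \<phi> \<in> W'" for \<phi>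
    proof -
      have "?T \<phi> \<in> k ` S2" using \<phi>(2) k(7) by (simp add: S2_def)
      then obtain \<tau> where \<tau>: "?T \<phi> = k \<tau>" "\<tau> \<in> S2" by (rule imageE)
      have eq: "param a \<phi> = (v (k \<tau>), w (k \<tau>))"
        unfolding \<tau>(1)[symmetric] v_def w_def using rgW(7)[OF \<phi>(1)] by simp
      show ?thesis by (rule image_eqI[where x = \<tau>]) (rule eq, rule \<tau>(2))
    qed
    show "param a \<theta>0 \<in> (\<lambda>\<tau>. (v (k \<tau>), w (k \<tau>))) ` S2" by (rule im[OF rgW(3) k(3)])
    show "param a \<theta> \<in> (\<lambda>\<tau>. (v (k \<tau>), w (k \<tau>))) ` S2" by (rule im[OF \<theta>])
    fix \<tau> assume \<tau>: "\<tau> \<in> S2"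
    have lev: "(v (k \<tau>), w (k \<tau>)) \<in> level"
      using param_in_level[OF a gB[OF kB[OF \<tau>]]] by (simp add: v_def w_def)
    show "(v (k \<tau>), w (k \<tau>)) \<in> U" "Hvw m G (v (k \<tau>)) (w (k \<tau>)) = 0"
      using lev by (auto simp: level_def)
    have w_eq: "w (k s) / v (k s) / (1 / v (k s)) = w (k s)" if "s \<in> S2" for s
      using v_nz[OF kB[OF that]] by simp
    show "((\<lambda>\<tau>. v (k \<tau>)) has_field_derivative fst (vw_field m G (v (k \<tau>), w (k \<tau>)))) (at \<tau>)"
      using fields(1)[OF \<tau>] unfolding w_eq[OF \<tau>] .
    show "((\<lambda>\<tau>. w (k \<tau>)) has_field_derivative snd (vw_field m G (v (k \<tau>), w (k \<tau>)))) (at \<tau>)"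
      using fields(2)[OF \<tau>] unfolding w_eq[OF \<tau>]
      by (rule has_field_derivative_transform_within_open[where S = S2]) (use \<tau> w_eq in \<open>auto simp: S2_def\<close>)
  qed
  have "open (W \<inter> ?T -` W')"
  proof (rule continuous_open_preimage[OF _ rgW(2) k(2)])
    show "continuous_on W ?T"
      by (rule continuous_on_subset[OF holomorphic_on_imp_continuous_on[OF param_time_holomorphic[OF a]]])
         (use rgW(4) in \<open>auto simp: D_def\<close>)
  qed
  thus ?thesis
    by (intro exI[of _ "W \<inter> ?T -` W'"]) (use rgW(3,4) k(3) joined in auto)
qed

lemma leaf_joined:
  assumes a: "a \<in> A" and p: "p \<in> leaf a" "q \<in> leaf a"
  shows "(joined_by_solution m G U)\<^sup>*\<^sup>* p q"
proof -
  let ?J = "(joined_by_solution m G U)\<^sup>*\<^sup>*"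
  obtain \<theta> \<theta>' where t: "\<theta> \<in> D" "\<theta>' \<in> D" "p = param a \<theta>" "q = param a \<theta>'"
    using p by (auto simp: leaf_def)
  have "?J (param a \<theta>) (param a \<theta>')"
  proof (rule connected_equivalence_relation[where R = "\<lambda>x y. ?J (param a x) (param a y)", OF connected_D t(1,2)])
    have "symp (joined_by_solution m G U)" by (auto intro!: sympI joined_sym)
    hence "symp ?J" by (rule symp_rtranclp)
    thus "?J (param a y) (param a x)" if "?J (param a x) (param a y)" for x y
      using that by (rule sympD)
    show "\<exists>T. openin (top_of_set D) T \<and> x \<in> T \<and> (\<forall>y\<in>T. ?J (param a x) (param a y))" if x: "x \<in> D" for x
    proof -
      obtain W where W: "open W" "x \<in> W" "W \<subseteq> D"
        "\<forall>\<theta>\<in>W. joined_by_solution m G U (param a x) (param a \<theta>)"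
        using joined_locally[OF a x] by blast
      have "openin (top_of_set D) W" using W(1,3) by (simp add: open_subset)
      thus ?thesis using W(2,4) by blast
    qed
  qed auto
  thus ?thesis using t by simp
qed

text \<open>
  The component \<open>v\<close> satisfies a linear equation, so a solution that starts outside the
  equilibrium never reaches it and stays in the level curve without the origin.
\<close>
lemma joined_in_leaf:
  assumes j: "joined_by_solution m G U p q" and a: "a \<in> A" and p: "p \<in> leaf a"
  shows "q \<in> leaf a"
proof -
  obtain T v w where T: "open T" "connected T"
    and sol: "\<And>\<tau>. \<tau> \<in> T \<Longrightarrow> (v \<tau>, w \<tau>) \<in> U \<and> Hvw m G (v \<tau>) (w \<tau>) = 0 \<and>
           (v has_field_derivative fst (vw_field m G (v \<tau>, w \<tau>))) (at \<tau>) \<and>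
           (w has_field_derivative snd (vw_field m G (v \<tau>, w \<tau>))) (at \<tau>)"
    and pq: "p \<in> (\<lambda>\<tau>. (v \<tau>, w \<tau>)) ` T" "q \<in> (\<lambda>\<tau>. (v \<tau>, w \<tau>)) ` T"
    using j unfolding joined_by_solution_def by blast
  obtain tp where tp: "tp \<in> T" "p = (v tp, w tp)" using pq(1) by blast
  obtain tq where tq: "tq \<in> T" "q = (v tq, w tq)" using pq(2) by blast
  have hol: "v holomorphic_on T" "w holomorphic_on T"
    unfolding holomorphic_on_open[OF T(1)] using sol by blast+
  let ?f = "\<lambda>\<tau>. homogenize m (pderiv G) (v \<tau>) (w \<tau>)"
  have f: "?f holomorphic_on T"
    unfolding homogenize_def by (intro holomorphic_intros hol)
  have v': "(v has_field_derivative - v \<tau> * ?f \<tau>) (at \<tau>)" if "\<tau> \<in> T" for \<tau>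
    using sol[OF that] by (simp add: vw_field_def)
  have "p \<in> level" using p leaf_subset_level[OF a] by blast
  hence "v tp \<noteq> 0" using level_ratio(1) tp(2) by blast
  hence nz: "v \<tau> \<noteq> 0" if "\<tau> \<in> T" for \<tau>
    using linear_ode_nonvanishing[OF T f v' tp(1) _ that] by blast
  have "(\<lambda>\<tau>. (v \<tau>, w \<tau>)) ` T \<subseteq> leaf a"
  proof (rule connected_in_leaf[OF T(2) _ _ a tp(1)])
    show "continuous_on T (\<lambda>\<tau>. (v \<tau>, w \<tau>))"
      by (intro continuous_on_Pair holomorphic_on_imp_continuous_on hol)
    show "(\<lambda>\<tau>. (v \<tau>, w \<tau>)) ` T \<subseteq> level" using sol nz by (auto simp: level_def)
    show "(v tp, w tp) \<in> leaf a" using p tp(2) by simp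
  qed
  thus ?thesis using tq by blast
qed

lemma local_leaf_iff: "local_leaf m G U L \<longleftrightarrow> (\<exists>a\<in>A. L = leaf a)"
proof -
  let ?J = "(joined_by_solution m G U)\<^sup>*\<^sup>*"
  have orbit: "{q. ?J p q} = leaf a" if a: "a \<in> A" and p: "p \<in> leaf a" for a p
  proof -
    have "q \<in> leaf a" if "?J p q" for q
      using that by (induction rule: rtranclp_induct) (use p joined_in_leaf a in blast)+
    thus ?thesis using leaf_joined[OF a p] by blast
  qed
  show ?thesis
  proof
    assume "local_leaf m G U L"
    then obtain p where p: "p \<in> U" "Hvw m G (fst p) (snd p) = 0" "vw_field m G p \<noteq> 0" "L = {q. ?J p q}"
      unfolding local_leaf_def by blast
    have "vw_field m G (0, 0) = 0" using vw_field_infinity_eq_0_iff[OF m deg] by simp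
    hence "p \<noteq> (0, 0)" using p(3) by metis
    hence "p \<in> level" using p by (simp add: level_def)
    then obtain a where "a \<in> A" "p \<in> leaf a" unfolding level_eq_leafs by blast
    thus "\<exists>a\<in>A. L = leaf a" using orbit p(4) by blast
  next
    assume "\<exists>a\<in>A. L = leaf a"
    then obtain a where a: "a \<in> A" "L = leaf a" by blast
    define p where "p = param a (of_real (\<rho> / 2))"
    have "of_real (\<rho> / 2) \<in> D" using \<rho>_pos by (simp add: D_def)
    hence p: "p \<in> leaf a" by (simp add: leaf_def p_def)
    hence lev: "p \<in> level" using leaf_subset_level[OF a(1)] by blast
    have "fst p \<noteq> 0" using lev level_ratio(1) by (metis prod.collapse)
    hence "vw_field m G p \<noteq> 0" using m by (cases p) (auto simp: vw_field_def zero_prod_def)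
    thus "local_leaf m G U L"
      unfolding local_leaf_def using lev orbit[OF a(1) p] a(2) by (intro bexI[of _ p]) (auto simp: level_def)
  qed
qed

section \<open>The number of leafs\<close>

lemma minus_in_A_iff: "a \<in> A \<Longrightarrow> - a \<in> A \<longleftrightarrow> odd m"
proof -
  assume a: "a \<in> A"
  show ?thesis
  proof (cases "even m")
    case True
    hence "odd (m-1)" using m by (metis even_Suc Suc_pred' gr0I not_numeral_le_zero)
    thus ?thesis using a True lead_coeff_nz by (simp add: A_def)
  next
    case False
    thus ?thesis using a by (simp add: A_def)
  qed
qed

lemma leafs_eq: "{L. local_leaf m G U L} = leaf ` A"
  using local_leaf_iff by auto

text \<open>
  For even \<open>m\<close> squaring is a bijection on the roots of unity of odd order \<open>m - 1\<close>: a root \<open>b\<close> is the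
  square of \<open>b\<^sup>m\<^sup>/\<^sup>2\<close>.
\<close>
lemma leaf_eq_even:
  assumes "even m" and a: "a \<in> A" "a' \<in> A"
  shows "leaf a = leaf a'"
proof -
  obtain k where k: "m = 2 * k" using assms(1) by (elim evenE)
  define b where "b = a / a'"
  have b: "b^(m-1) = 1" using a lead_coeff_nz by (simp add: b_def A_def power_divide)
  have "(b^k)^(m-1) = (b^(m-1))^k" by (metis power_mult mult.commute)
  moreover have "(b^k)^2 = b"
  proof -
    have "(b^k)^2 = b^Suc (m-1)" using m by (simp add: k mult.commute flip: power_mult)
    also have "\<dots> = b" unfolding power_Suc b by simp
    finally show ?thesis .
  qed
  ultimately have "(b^k)^(m-1) = 1 \<and> a = a' * (b^k)^2"
    using b A_nz[OF a(2)] by (simp add: b_def)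
  thus ?thesis unfolding leaf_eq_iff[OF a] by blast
qed

lemma leaf_unique_even: "even m \<Longrightarrow> \<exists>!L. local_leaf m G U L"
  using A_nonempty leaf_eq_even unfolding local_leaf_iff by blast

text \<open>
  For odd \<open>m\<close> the squares are exactly the roots of unity of order dividing \<open>(m-1)/2\<close>.
\<close>
lemma leaf_eq_odd:
  assumes "odd m" and a: "a \<in> A" "a' \<in> A"
  shows "leaf a = leaf a' \<longleftrightarrow> a^((m-1) div 2) = a'^((m-1) div 2)"
proof -
  define n where "n = (m-1) div 2"
  have n: "m - 1 = 2 * n" using assms(1) by (simp add: n_def)
  have nz: "a' \<noteq> 0" by (rule A_nz[OF a(2)])
  have "(\<exists>c. c^(m-1) = 1 \<and> a = a' * c^2) \<longleftrightarrow> a^n = a'^n"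
  proof
    assume "\<exists>c. c^(m-1) = 1 \<and> a = a' * c^2"
    then obtain c where "c^(2 * n) = 1" "a = a' * c^2" unfolding n by blast
    thus "a^n = a'^n" by (simp add: power_mult power_mult_distrib)
  next
    assume "a^n = a'^n"
    hence "(a / a')^n = 1" using nz by (simp add: power_divide)
    hence "csqrt (a / a')^(m-1) = 1" unfolding n by (simp add: power_mult)
    moreover have "a = a' * csqrt (a / a')^2" using nz by simp
    ultimately show "\<exists>c. c^(m-1) = 1 \<and> a = a' * c^2" by blast
  qed
  thus ?thesis unfolding leaf_eq_iff[OF a] n_def .
qed

lemma A_odd:
  assumes "odd m"
  shows "a \<in> A \<longleftrightarrow> a^((m-1) div 2) = csqrt (2 * lead_coeff G) \<or> a^((m-1) div 2) = - csqrt (2 * lead_coeff G)"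
proof -
  define n where "n = (m-1) div 2"
  have n: "m - 1 = n * 2" using assms by (simp add: n_def)
  have "a \<in> A \<longleftrightarrow> (a^n)^2 = csqrt (2 * lead_coeff G)^2"
    unfolding A_def n by (simp add: power_mult)
  thus ?thesis unfolding power2_eq_iff n_def .
qed

lemma leafs_card_odd:
  assumes "odd m"
  shows "card {L. local_leaf m G U L} = 2"
proof -
  let ?n = "(m-1) div 2" and ?c = "csqrt (2 * lead_coeff G)"
  have n: "?n \<noteq> 0" using assms m by (auto elim!: oddE)
  obtain a where a: "a^?n = ?c" using exists_complex_root[OF n] by metis
  obtain b where b: "b^?n = - ?c" using exists_complex_root[OF n] by metis
  have A: "a \<in> A" "b \<in> A" using A_odd[OF assms] a b by auto
  have "?c \<noteq> - ?c" using lead_coeff_nz by (simp add: eq_neg_iff_add_eq_0)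
  hence "leaf a \<noteq> leaf b" using leaf_eq_odd[OF assms A] a b by simp
  moreover have "leaf ` A = {leaf a, leaf b}"
  proof (intro subset_antisym subsetI)
    fix L assume "L \<in> leaf ` A"
    then obtain d where d: "d \<in> A" "L = leaf d" by blast
    hence "d^?n = ?c \<or> d^?n = - ?c" using A_odd[OF assms] by blast
    hence "leaf d = leaf a \<or> leaf d = leaf b"
      using leaf_eq_odd[OF assms d(1)] A a b by metis
    thus "L \<in> {leaf a, leaf b}" using d(2) by blast
  qed (use A in blast)
  ultimately show ?thesis unfolding leafs_eq by simp
qed

lemma leafs_opposite:
  assumes m4: "m mod 4 = 3" and a: "a \<in> A"
  shows "{L. local_leaf m G U L} = {leaf a, leaf (- a)}" "leaf a \<noteq> leaf (- a)"
proof -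
  let ?n = "(m-1) div 2" and ?c = "csqrt (2 * lead_coeff G)"
  have m_odd: "odd m" using m4 by presburger
  have n_odd: "odd ?n" using m4 by presburger
  have a': "- a \<in> A" using minus_in_A_iff[OF a] m_odd by simp
  have mp: "(- a)^?n = - (a^?n)" using n_odd by simp
  have "a^?n \<noteq> 0" using A_nz[OF a] by simp
  hence "a^?n \<noteq> - (a^?n)" by (simp add: eq_neg_iff_add_eq_0)
  thus ne: "leaf a \<noteq> leaf (- a)" using leaf_eq_odd[OF m_odd a a'] mp by simp
  show "{L. local_leaf m G U L} = {leaf a, leaf (- a)}"
    unfolding leafs_eq
  proof (intro subset_antisym subsetI)
    fix L assume "L \<in> leaf ` A"
    then obtain d where d: "d \<in> A" "L = leaf d" by blast
    have "d^?n = ?c \<or> d^?n = - ?c" "a^?n = ?c \<or> a^?n = - ?c"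
      using A_odd[OF m_odd] d(1) a by blast+
    hence "d^?n = a^?n \<or> d^?n = (- a)^?n" unfolding mp by auto
    thus "L \<in> {leaf a, leaf (- a)}"
      using leaf_eq_odd[OF m_odd d(1)] a a' d(2) by blast
  qed (use a a' in blast)
qed

section \<open>Blow-up loops\<close>

lemma continued_along_param:
  assumes a: "a \<in> A" and \<theta>: "continuous_on I \<theta>" "\<theta> ` I \<subseteq> D"
  shows "continued_along G I (param_time a \<circ> \<theta>) (param a \<circ> \<theta>)"
  unfolding continued_along_def
proof (intro conjI ballI)
  show "continuous_on I (param_time a \<circ> \<theta>)"
    by (rule continuous_on_compose[OF \<theta>(1) continuous_on_subset[OF
          holomorphic_on_imp_continuous_on[OF param_time_holomorphic[OF a]]]])
       (use \<theta>(2) in \<open>auto simp: D_def\<close>)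
  fix s assume s: "s \<in> I"
  hence \<theta>s: "\<theta> s \<in> D" using \<theta>(2) by blast
  obtain r W g where rgW: "r > 0" "open W" "\<theta> s \<in> W" "W \<subseteq> D"
    "g holomorphic_on ball (param_time a (\<theta> s)) r" "g ` ball (param_time a (\<theta> s)) r = W"
    "\<And>\<phi>. \<phi> \<in> W \<Longrightarrow> g (param_time a \<phi>) = \<phi> \<and> param_time a \<phi> \<in> ball (param_time a (\<theta> s)) r"
    and sol: "pendulum_solution G (ball (param_time a (\<theta> s)) r)
       (\<lambda>t. snd (param a (g t)) / fst (param a (g t))) (\<lambda>t. 1 / fst (param a (g t)))"
    using leaf_local_solution[OF a \<theta>s] by blast
  obtain d where d: "d > 0" "\<And>s'. s' \<in> I \<Longrightarrow> \<bar>s' - s\<bar> < d \<Longrightarrow> \<theta> s' \<in> W"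
  proof -
    obtain e where e: "e > 0" "ball (\<theta> s) e \<subseteq> W" using rgW(2,3) by (meson open_contains_ball)
    then obtain d where "d > 0" "\<forall>s'\<in>I. dist s' s < d \<longrightarrow> dist (\<theta> s') (\<theta> s) < e"
      using \<theta>(1) s unfolding continuous_on_iff by metis
    thus ?thesis using e(2) by (intro that[of d]) (auto simp: dist_commute dist_real_def subset_iff)
  qed
  show "\<exists>r>0. \<exists>d>0. \<exists>v w.
        (\<forall>t\<in>ball ((param_time a \<circ> \<theta>) s) r. v t \<noteq> 0) \<and>
        pendulum_solution G (ball ((param_time a \<circ> \<theta>) s) r) (\<lambda>t. w t / v t) (\<lambda>t. 1 / v t) \<and>
        (\<forall>s'\<in>I. \<bar>s' - s\<bar> < d \<longrightarrow> (param_time a \<circ> \<theta>) s' \<in> ball ((param_time a \<circ> \<theta>) s) r \<and>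
           (param a \<circ> \<theta>) s' = (v ((param_time a \<circ> \<theta>) s'), w ((param_time a \<circ> \<theta>) s')))"
  proof (rule exI[of _ r], intro conjI rgW(1), rule exI[of _ d], intro conjI d(1),
      rule exI[of _ "\<lambda>t. fst (param a (g t))"], rule exI[of _ "\<lambda>t. snd (param a (g t))"], intro conjI ballI impI)
    show "fst (param a (g t)) \<noteq> 0" if "t \<in> ball ((param_time a \<circ> \<theta>) s) r" for t
    proof (rule param_fst_nz[OF a])
      show "g t \<in> D" using that rgW(4,6) by (metis comp_apply image_eqI subsetD)
    qed
    fix s' assume s': "s' \<in> I" "\<bar>s' - s\<bar> < d"
    note * = rgW(7)[OF d(2)[OF s']]
    show "(param_time a \<circ> \<theta>) s' \<in> ball ((param_time a \<circ> \<theta>) s) r" using * by simp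
    show "(param a \<circ> \<theta>) s' = (fst (param a (g ((param_time a \<circ> \<theta>) s'))), snd (param a (g ((param_time a \<circ> \<theta>) s'))))"
      using * by simp
  qed (use sol in simp)
qed

text \<open>
  The blow-up is reached along the segment from \<open>\<theta>\<^sub>0\<close> to \<open>0\<close>.
\<close>
lemma param_blows_up:
  assumes a: "a \<in> A" and \<theta>0: "\<theta>0 \<in> D"
  shows "blows_up_at_0 G (leaf a) (param_time a \<theta>0) (param a \<theta>0)"
proof -
  define \<theta> where "\<theta> s = \<theta>0 * of_real (1 - s)" for s :: real
  have \<theta>D: "\<theta> ` {0..<1} \<subseteq> D"
  proof
    fix z assume "z \<in> \<theta> ` {0..<1}"
    then obtain s where s: "0 \<le> s" "s < 1" "z = \<theta> s" by auto
    have "cmod z = cmod \<theta>0 * (1 - s)" using s by (simp add: \<theta>_def norm_mult del: of_real_diff)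
    also have "\<dots> \<le> cmod \<theta>0" using s by (simp add: mult_left_le)
    finally show "z \<in> D" using \<theta>0 s by (auto simp: D_def \<theta>_def)
  qed
  have cont: "continuous_on {0..<1} \<theta>" unfolding \<theta>_def by (intro continuous_intros)
  have "(\<theta> \<longlongrightarrow> \<theta> 1) (at_left 1)" unfolding \<theta>_def by (intro tendsto_intros)
  hence lim: "(\<theta> \<longlongrightarrow> 0) (at_left 1)" by (simp add: \<theta>_def)
  have "isCont (param_time a) 0" "isCont (param a) 0"
    using holomorphic_on_imp_continuous_on[OF param_time_holomorphic[OF a]] param_continuous[OF a] \<rho>_pos
    by (auto simp: continuous_on_eq_continuous_at)
  hence "((\<lambda>s. param_time a (\<theta> s)) \<longlongrightarrow> param_time a 0) (at_left 1)"
     "((\<lambda>s. param a (\<theta> s)) \<longlongrightarrow> param a 0) (at_left 1)"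
    using lim isCont_tendsto_compose by blast+
  hence "((param_time a \<circ> \<theta>) \<longlongrightarrow> 0) (at_left 1)" "((param a \<circ> \<theta>) \<longlongrightarrow> (0, 0)) (at_left 1)"
    using m by (auto simp: o_def param_0) (simp add: param_time_def power_0_left)
  moreover have "(param a \<circ> \<theta>) ` {0..<1} \<subseteq> leaf a" using \<theta>D by (auto simp: leaf_def)
  ultimately show ?thesis
    unfolding blows_up_at_0_def using continued_along_param[OF a cont \<theta>D]
    by (intro exI[of _ "param_time a \<circ> \<theta>"] exI[of _ "param a \<circ> \<theta>"]) (simp add: \<theta>_def)
qed

text \<open>
  Near each parameter the continued curve comes from a holomorphic solution. Its energy is
  conserved, so it stays in the level curve, where \<open>blowup_time\<close> grows at unit speed; hence time
  and \<open>blowup_time\<close> differ by a locally constant amount.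
\<close>
lemma continued_along_local:
  assumes c: "continued_along G I \<gamma>t \<gamma>" and lev: "\<gamma> ` I \<subseteq> level" and s: "s \<in> I"
  shows "(\<gamma> \<longlongrightarrow> \<gamma> s) (at s within I)"
    "\<forall>\<^sub>F s' in at s within I. blowup_time (\<gamma> s) - \<gamma>t s = blowup_time (\<gamma> s') - \<gamma>t s'"
proof -
  obtain r d v w where r: "r > 0" and d: "d > 0" and v: "\<forall>t\<in>ball (\<gamma>t s) r. v t \<noteq> 0"
    and sol: "pendulum_solution G (ball (\<gamma>t s) r) (\<lambda>t. w t / v t) (\<lambda>t. 1 / v t)"
    and \<gamma>: "\<forall>s'\<in>I. \<bar>s' - s\<bar> < d \<longrightarrow> \<gamma>t s' \<in> ball (\<gamma>t s) r \<and> \<gamma> s' = (v (\<gamma>t s'), w (\<gamma>t s'))"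
    using c s unfolding continued_along_def by blast
  define t0 where "t0 = \<gamma>t s"
  define x y where "x = (\<lambda>t. w t / v t)" and "y = (\<lambda>t. 1 / v t)"
  have v': "v t \<noteq> 0" if "t \<in> ball t0 r" for t using v that unfolding t0_def by blast
  have sol: "pendulum_solution G (ball t0 r) x y" using sol by (simp add: t0_def x_def y_def)
  have dx: "(x has_field_derivative y t) (at t)" and dy: "(y has_field_derivative poly (pderiv G) (x t)) (at t)"
    if "t \<in> ball t0 r" for t using sol that unfolding pendulum_solution_def by blast+
  define p where "p = (\<lambda>t. (1 / y t, x t / y t))"
  have p_eq: "p t = (v t, w t)" if "t \<in> ball t0 r" for t
    using v'[OF that] by (simp add: p_def x_def y_def)
  have contp: "isCont p t" if t: "t \<in> ball t0 r" for t
  proof -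
    have "y t \<noteq> 0" using v'[OF t] by (simp add: y_def)
    thus ?thesis unfolding p_def
      by (intro continuous_intros DERIV_isCont[OF dx[OF t]] DERIV_isCont[OF dy[OF t]])
  qed
  have s_I: "s \<in> I" "\<bar>s - s\<bar> < d" using s d by auto
  have p0: "p t0 = \<gamma> s"
    using \<gamma> s_I p_eq[of t0] r unfolding t0_def by auto
  hence p0_lev: "p t0 \<in> level" using lev s by auto
  have limt: "(\<gamma>t \<longlongrightarrow> t0) (at s within I)"
    using c s unfolding continued_along_def continuous_on_def t0_def by blast
  have ev_d: "\<forall>\<^sub>F s' in at s within I. s' \<in> I \<and> \<bar>s' - s\<bar> < d"
    using eventually_at_ball[OF d, of s I] eventually_at_topological
    by (auto elim!: eventually_mono simp: dist_real_def abs_minus_commute)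
  have ev_eq: "\<forall>\<^sub>F s' in at s within I. \<gamma> s' = p (\<gamma>t s')"
    using ev_d
  proof eventually_elim
    case (elim s')
    thus ?case using \<gamma> p_eq[of "\<gamma>t s'"] unfolding t0_def by auto
  qed
  have t0r: "t0 \<in> ball t0 r" using r by simp
  have "((\<lambda>s'. p (\<gamma>t s')) \<longlongrightarrow> p t0) (at s within I)"
    by (rule isCont_tendsto_compose[OF contp[OF t0r] limt])
  thus "(\<gamma> \<longlongrightarrow> \<gamma> s) (at s within I)"
    unfolding p0 using tendsto_cong[OF ev_eq] by blast
  have "open U" by (intro open_Times) auto
  moreover have "p t0 \<in> U" using p0_lev by (auto simp: level_def)
  moreover have "(p \<longlongrightarrow> p t0) (nhds t0)" using contp[OF t0r] by (simp add: isCont_def tendsto_at_iff_tendsto_nhds)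
  ultimately have "\<forall>\<^sub>F t in nhds t0. p t \<in> U" by (metis topological_tendstoD)
  then obtain r1' where r1': "r1' > 0" "\<And>t. t \<in> ball t0 r1' \<Longrightarrow> p t \<in> U"
    unfolding eventually_nhds_metric by (auto simp: dist_commute)
  define r2 where "r2 = min r r1'"
  have r2: "r2 > 0" using r r1'(1) by (simp add: r2_def)
  have "\<exists>c. \<forall>t\<in>ball t0 r2. blowup_time (p t) - t = c"
  proof (rule has_field_derivative_zero_constant)
    fix t assume t2: "t \<in> ball t0 r2"
    hence t: "t \<in> ball t0 r" "p t \<in> U" using r1'(2) by (auto simp: r2_def)
    have "Hxy G (x t) (y t) = Hxy G (x t0) (y t0)"
      by (rule pendulum_energy_const[OF sol convex_ball t(1) t0r])
    also have "\<dots> = 0"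
    proof -
      have "(v t0, w t0) \<in> level" using p0_lev p_eq[OF t0r] by simp
      thus ?thesis using level_energy by (simp add: x_def y_def)
    qed
    finally have H: "Hxy G (x t) (y t) = 0" .
    have lev_t: "(v t, w t) \<in> level"
      by (rule energy_in_level) (use t p_eq[OF t(1)] v'[OF t(1)] H in \<open>auto simp: x_def y_def\<close>)
    have "((\<lambda>t. blowup_time (1 / y t, x t / y t)) has_derivative (\<lambda>h. h)) (at t)"
    proof (rule blowup_time_along)
      show "(x has_derivative (\<lambda>h. y t * h)) (at t)" "(y has_derivative (\<lambda>h. poly (pderiv G) (x t) * h)) (at t)"
        using dx[OF t(1)] dy[OF t(1)] by (simp_all add: has_field_derivative_def)
      show "x t \<noteq> 0" "y t \<noteq> 0" "1 / x t \<in> ball 0 r1"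
        using level_ratio(1,2)[OF lev_t] level_ratio_r1[OF lev_t] by (simp_all add: x_def y_def)
    qed (rule H)
    hence "((\<lambda>t. blowup_time (p t)) has_field_derivative 1) (at t)"
      by (simp add: p_def has_field_derivative_def lambda_one)
    from DERIV_diff[OF this DERIV_ident]
    show "((\<lambda>t. blowup_time (p t) - t) has_field_derivative 0) (at t within ball t0 r2)"
      by (simp add: has_field_derivative_at_within)
  qed auto
  then obtain c where c: "\<And>t. t \<in> ball t0 r2 \<Longrightarrow> blowup_time (p t) - t = c" by blast
  have "\<forall>\<^sub>F s' in at s within I. \<gamma>t s' \<in> ball t0 r2"
    by (rule topological_tendstoD[OF limt]) (use r2 in auto)
  thus "\<forall>\<^sub>F s' in at s within I. blowup_time (\<gamma> s) - \<gamma>t s = blowup_time (\<gamma> s') - \<gamma>t s'"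
    using ev_eq
  proof eventually_elim
    case (elim s')
    thus ?case using c[of t0] c[of "\<gamma>t s'"] r2 p0 by (simp add: t0_def)
  qed
qed

lemma continued_along_continuous:
  "\<lbrakk>continued_along G I \<gamma>t \<gamma>; \<gamma> ` I \<subseteq> level\<rbrakk> \<Longrightarrow> continuous_on I \<gamma>"
  unfolding continuous_on_def using continued_along_local(1) by blast

lemma continued_along_time:
  assumes c: "continued_along G I \<gamma>t \<gamma>" "\<gamma> ` I \<subseteq> level" "connected I" and s: "s \<in> I" "s' \<in> I"
  shows "blowup_time (\<gamma> s) - \<gamma>t s = blowup_time (\<gamma> s') - \<gamma>t s'"
  by (rule connected_local_const[OF c(3) s]) (use continued_along_local(2)[OF c(1,2)] in blast)

lemma blowup_time_bound:
  assumes "p \<in> level"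
  shows "cmod (blowup_time p) \<le> 4 * cmod (snd p)"
proof -
  obtain v w where p: "p = (v, w)" by (cases p)
  have vw: "v / w \<in> ball 0 r1" using level_ratio_r1 assms by (simp add: p)
  have "cmod (N (v / w)) \<le> cmod (N (v / w) - 1) + cmod 1" by (metis diff_add_cancel norm_triangle_ineq)
  hence N2: "cmod (N (v / w)) \<le> 2" using N_near[OF vw] by simp
  have "cmod (2 / of_nat (m-1)) = 2 / real (m-1)" by (simp add: norm_divide)
  hence "cmod (2 / of_nat (m-1)) \<le> 2" using m by (simp add: divide_le_eq)
  hence "cmod (2 / of_nat (m-1)) * cmod w * cmod (N (v / w)) \<le> 2 * cmod w * 2"
    using N2 by (intro mult_mono) auto
  thus ?thesis by (simp add: blowup_time_def p norm_mult norm_divide)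
qed

lemma tendsto_blowup_time:
  assumes "(\<sigma> \<longlongrightarrow> (0, 0)) F'" "\<forall>\<^sub>F s in F'. \<sigma> s \<in> level"
  shows "((\<lambda>s. blowup_time (\<sigma> s)) \<longlongrightarrow> 0) F'"
proof (rule tendsto_norm_zero_cancel, rule tendsto_sandwich)
  show "\<forall>\<^sub>F s in F'. 0 \<le> cmod (blowup_time (\<sigma> s))" by simp
  show "\<forall>\<^sub>F s in F'. cmod (blowup_time (\<sigma> s)) \<le> 4 * cmod (snd (\<sigma> s))"
    using assms(2) by eventually_elim (rule blowup_time_bound)
  have "((\<lambda>s. 4 * cmod (snd (\<sigma> s))) \<longlongrightarrow> 4 * cmod (snd (0::complex, 0::complex))) F'"
    by (intro tendsto_intros tendsto_snd assms(1))
  thus "((\<lambda>s. 4 * cmod (snd (\<sigma> s))) \<longlongrightarrow> 0) F'" by simp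
qed auto

text \<open>
  The remaining shift of time is computed along the curve that tends to the origin at time \<open>0\<close>,
  where \<open>blowup_time\<close> tends to \<open>0\<close> as well.
\<close>
lemma blowup_loop_time:
  assumes c: "continued_along G {0..1} \<gamma>t \<gamma>" "\<gamma> ` {0..1} \<subseteq> level"
    and b: "blows_up_at_0 G L (\<gamma>t 0) (\<gamma> 0)" "L \<subseteq> level" and s: "s \<in> {0..1}"
  shows "\<gamma>t s = blowup_time (\<gamma> s)"
proof -
  obtain \<sigma>t \<sigma> where \<sigma>: "continued_along G {0..<1} \<sigma>t \<sigma>" "\<sigma> ` {0..<1} \<subseteq> L" "\<sigma>t 0 = \<gamma>t 0" "\<sigma> 0 = \<gamma> 0"
    "(\<sigma>t \<longlongrightarrow> 0) (at_left 1)" "(\<sigma> \<longlongrightarrow> (0, 0)) (at_left 1)"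
    using b(1) unfolding blows_up_at_0_def by blast
  have lev: "\<sigma> ` {0..<1} \<subseteq> level" using \<sigma>(2) b(2) by blast
  have ev: "\<forall>\<^sub>F s in at_left (1::real). s \<in> {0..<1}"
    using eventually_at_left_real[of 0 1] by (auto elim!: eventually_mono)
  have "((\<lambda>s. blowup_time (\<sigma> s) - \<sigma>t s) \<longlongrightarrow> 0 - 0) (at_left 1)"
    by (intro tendsto_diff tendsto_blowup_time \<sigma>) (use ev lev in \<open>auto elim!: eventually_mono\<close>)
  moreover have "\<forall>\<^sub>F s in at_left 1. blowup_time (\<sigma> s) - \<sigma>t s = blowup_time (\<sigma> 0) - \<sigma>t 0"
    using ev by eventually_elim (rule continued_along_time[OF \<sigma>(1) lev], auto)
  ultimately have "((\<lambda>s::real. blowup_time (\<sigma> 0) - \<sigma>t 0) \<longlongrightarrow> 0) (at_left 1)"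
    using tendsto_cong by force
  hence "blowup_time (\<sigma> 0) - \<sigma>t 0 = 0" by (simp add: tendsto_const_iff)
  moreover have "blowup_time (\<gamma> s) - \<gamma>t s = blowup_time (\<gamma> 0) - \<gamma>t 0"
    by (rule continued_along_time[OF c _ s]) auto
  ultimately show ?thesis using \<sigma>(3,4) by simp
qed

text \<open>
  Up to a constant, time and \<open>w\<close> differ by the factor \<open>N(v/w)\<close>, which has a logarithm, so they wind equally often.
  In the same way \<open>w\<^sup>2\<close> winds like \<open>(v/w)\<^sup>m\<^sup>-\<^sup>1\<close>, so twice the winding number of time is
  \<open>m - 1\<close> times the integer winding number of \<open>v/w\<close>. This bounds all loops from below without
  lifting them to the parameter.
\<close>
lemma blowup_loop_winding:
  assumes a: "a \<in> A" and loop: "blowup_loop G (leaf a) \<gamma>t \<gamma>"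
  shows "Re (winding_number \<gamma>t 0) \<ge> real (wind_t m)"
proof -
  have \<gamma>t: "path \<gamma>t" "0 \<notin> path_image \<gamma>t" "pathfinish \<gamma>t = pathstart \<gamma>t" "Re (winding_number \<gamma>t 0) > 0"
    and c: "continued_along G {0..1} \<gamma>t \<gamma>" and im: "\<gamma> ` {0..1} \<subseteq> leaf a"
    and b: "blows_up_at_0 G (leaf a) (\<gamma>t 0) (\<gamma> 0)" and closed: "\<gamma> 1 = \<gamma> 0"
    using loop unfolding blowup_loop_def by auto
  have lev: "\<gamma> ` {0..1} \<subseteq> level" using im leaf_subset_level[OF a] by blast
  define W where "W = snd \<circ> \<gamma>"
  define X where "X = (\<lambda>s. fst (\<gamma> s) / snd (\<gamma> s))"
  have lr: "fst (\<gamma> s) \<noteq> 0" "W s \<noteq> 0" "X s \<in> ball 0 r1" "X s^(m-1) = 2 * W s^2 * poly (reflect_poly G) (X s)"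
    "X s \<noteq> 0" if "s \<in> {0..1}" for s
  proof -
    have l: "(fst (\<gamma> s), snd (\<gamma> s)) \<in> level" using lev that by auto
    show "fst (\<gamma> s) \<noteq> 0" "W s \<noteq> 0" "X s \<in> ball 0 r1" "X s^(m-1) = 2 * W s^2 * poly (reflect_poly G) (X s)"
      using level_ratio[OF l] level_ratio_r1[OF l] by (simp_all add: W_def X_def)
    thus "X s \<noteq> 0" by (simp add: X_def W_def)
  qed
  have cont: "continuous_on {0..1} \<gamma>" by (rule continued_along_continuous[OF c lev])
  have pW: "path W" unfolding path_def W_def by (intro continuous_on_compose cont continuous_on_snd continuous_on_id)
  have pX: "path X" unfolding path_def X_def
    by (intro continuous_intros cont) (use lr(2) in \<open>auto simp: W_def\<close>)
  have W0: "0 \<notin> path_image W" and X0: "0 \<notin> path_image X"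
    using lr(2,5) unfolding path_image_def by fastforce+
  have Xcl: "X 1 = X 0" by (simp add: X_def closed)
  have Xim: "X ` {0..1} \<subseteq> ball 0 r1" using lr(3) by blast
  define c where "c = - (2 / of_nat (m-1) :: complex)"
  have c0: "c \<noteq> 0" using m by (simp add: c_def)
  obtain n where n: "n holomorphic_on ball 0 r1" "\<And>s. s \<in> ball 0 r1 \<Longrightarrow> N s = exp (n s)"
    using contractible_imp_holomorphic_log[OF N_hol convex_imp_contractible[OF convex_ball] N_nz] by blast
  have "(\<lambda>s. 2 * poly (reflect_poly G) s) holomorphic_on ball 0 r1" by (intro holomorphic_intros)
  moreover have "2 * poly (reflect_poly G) s \<noteq> 0" if "s \<in> ball 0 r1" for s using G_nz[OF that] by simp
  ultimately obtain g where g: "g holomorphic_on ball 0 r1"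
    "\<And>s. s \<in> ball 0 r1 \<Longrightarrow> 2 * poly (reflect_poly G) s = exp (g s)"
    using contractible_imp_holomorphic_log[OF _ convex_imp_contractible[OF convex_ball]] by blast
  have path_comp: "path (\<lambda>s. f (X s))" if "f holomorphic_on ball 0 r1" for f
    using continuous_on_compose2[OF holomorphic_on_imp_continuous_on[OF that] pX[unfolded path_def] Xim]
    by (simp add: path_def)
  have "of_nat 1 * winding_number \<gamma>t 0 = of_nat 1 * winding_number W 0 +
     ((Ln c + n (X 1)) - (Ln c + n (X 0))) / (2 * of_real pi * \<i>)"
  proof (rule winding_number_power_relation[OF pW W0 \<gamma>t(1,2)])
    show "path (\<lambda>s. Ln c + n (X s))"
      using path_comp[OF n(1)] unfolding path_def by (intro continuous_intros)
    fix s :: real assume s: "s \<in> {0..1}"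
    have "\<gamma>t s = blowup_time (\<gamma> s)"
      by (rule blowup_loop_time[OF \<open>continued_along G {0..1} \<gamma>t \<gamma>\<close> lev b leaf_subset_level[OF a] s])
    also have "\<dots> = c * W s * exp (n (X s))"
      using n(2)[OF lr(3)[OF s]] by (simp add: blowup_time_def c_def W_def X_def)
    finally show "\<gamma>t s ^ 1 = W s ^ 1 * exp (Ln c + n (X s))"
      using c0 by (simp add: exp_add)
  qed
  hence tW: "winding_number \<gamma>t 0 = winding_number W 0" using Xcl by simp
  have "of_nat 2 * winding_number W 0 = of_nat (m-1) * winding_number X 0 +
     (- g (X 1) - - g (X 0)) / (2 * of_real pi * \<i>)"
  proof (rule winding_number_power_relation[OF pX X0 pW W0])
    show "path (\<lambda>s. - g (X s))"
      using path_comp[OF g(1)] unfolding path_def by (intro continuous_intros)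
    fix s :: real assume s: "s \<in> {0..1}"
    show "W s ^ 2 = X s ^ (m-1) * exp (- g (X s))"
      unfolding lr(4)[OF s] exp_minus g(2)[OF lr(3)[OF s], symmetric]
      using G_nz[OF lr(3)[OF s]] by simp
  qed
  hence WX: "2 * winding_number W 0 = of_nat (m-1) * winding_number X 0" using Xcl by simp
  obtain k where k: "winding_number X 0 = of_int k"
    using integer_winding_number[OF pX _ X0] Xcl by (auto simp: pathfinish_def pathstart_def elim: Ints_cases)
  obtain l where l: "winding_number \<gamma>t 0 = of_int l"
    using integer_winding_number[OF \<gamma>t(1,3,2)] by (auto elim: Ints_cases)
  have "(of_int (2 * l) :: complex) = of_int (int (m-1) * k)"
    using WX unfolding tW[symmetric] k l by simp
  hence lk: "2 * l = int (m-1) * k" by (simp only: of_int_eq_iff)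
  have lpos: "l > 0" using \<gamma>t(4) by (simp add: l)
  have kpos: "k > 0"
  proof (rule ccontr)
    assume "\<not> k > 0"
    hence "2 * l \<le> 0" unfolding lk by (intro mult_nonneg_nonpos) auto
    thus False using lpos by simp
  qed
  have "int (wind_t m) \<le> l"
  proof (cases "even m")
    case True
    \<comment> \<open>Here \<open>m - 1\<close> is odd, so twice the winding number can only be an even multiple of it.\<close>
    hence "odd (int (m-1))" using m by simp
    moreover have "even (int (m-1) * k)" unfolding lk[symmetric] by simp
    ultimately have "even k" by simp
    then obtain j where j: "k = 2 * j" by (elim evenE)
    have "l = int (m-1) * j" using lk j by simp
    moreover have "j \<ge> 1" using kpos j by simp
    ultimately have "l \<ge> int (m-1) * 1" by (simp only: mult_left_mono of_nat_0_le_iff)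
    thus ?thesis using True by (simp add: wind_t_def)
  next
    case False
    hence "2 * int (wind_t m) = int (m-1)" by (elim oddE) (simp add: wind_t_def)
    moreover have "int (m-1) * 1 \<le> int (m-1) * k" using kpos by (intro mult_left_mono) auto
    ultimately show ?thesis using lk by simp
  qed
  thus ?thesis unfolding l by simp
qed

lemma param_loop:
  fixes cyc :: complex
  assumes a: "a \<in> A" and \<gamma>: "path \<gamma>" "path_image \<gamma> \<subseteq> D"
    and cyc: "cyc = (if even m then 1 else 1/2)" and wind: "winding_number \<gamma> 0 = cyc"
  shows "minimal_blowup_loop G (leaf a) (param_time a \<circ> \<gamma>) (param a \<circ> \<gamma>)"
    "winding_number (param_time a \<circ> \<gamma>) 0 = of_nat (wind_t m)"
    "winding_number (snd \<circ> param a \<circ> \<gamma>) 0 = of_nat (wind_t m)"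
    "winding_number (fst \<circ> param a \<circ> \<gamma>) 0 = of_nat (wind_v m)"
proof -
  have \<gamma>D: "\<gamma> s \<in> D" if "s \<in> {0..1}" for s using \<gamma>(2) that by (auto simp: path_image_def)
  have \<gamma>b: "\<gamma> s \<in> ball 0 \<rho>" "\<gamma> s \<noteq> 0" if "s \<in> {0..1}" for s using \<gamma>D[OF that] by (auto simp: D_def)
  have \<gamma>0: "0 \<notin> path_image \<gamma>" using \<gamma>(2) by (auto simp: D_def)
  have "pathfinish \<gamma> = exp (2 * pi * \<i> * cyc) * pathstart \<gamma>"
    using winding_number_exp_2pi[OF \<gamma>(1) \<gamma>0] by (simp add: wind)
  moreover have "exp (2 * pi * \<i> * cyc) = (if even m then 1 else -1)"
    by (simp add: cyc)
  ultimately have fin: "\<gamma> 1 = (if even m then 1 else -1) * \<gamma> 0"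
    by (simp add: pathfinish_def pathstart_def)
  have sq: "\<gamma> 1^2 = \<gamma> 0^2" unfolding fin by simp
  have pw: "\<gamma> 1^(m-1) = \<gamma> 0^(m-1)"
    using m by (cases "even m") (auto simp: fin power_minus_even)
  have closed: "param a (\<gamma> 1) = param a (\<gamma> 0)" "param_time a (\<gamma> 1) = param_time a (\<gamma> 0)"
    using param_eq[OF a] \<gamma>b[of 0] \<gamma>b[of 1] sq pw by (auto simp: param_time_def)
  define X where "X = (\<lambda>s. S (a * \<gamma> s^2))"
  have X1: "X 1 = X 0" by (simp add: X_def sq)
  have Xim: "X ` {0..1} \<subseteq> ball 0 r1" using S_in arg_in[OF a] \<gamma>b(1) by (auto simp: X_def)
  have "continuous_on (ball 0 \<rho>) (\<lambda>\<theta>. S (a * \<theta>^2))"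
    by (rule holomorphic_on_imp_continuous_on[OF param_holomorphic(5)[OF a]])
  hence pX: "continuous_on {0..1} X" unfolding X_def
    by (rule continuous_on_compose2[OF _ \<gamma>(1)[unfolded path_def]]) (use \<gamma>b(1) in auto)
  obtain n where n: "n holomorphic_on ball 0 r1" "\<And>s. s \<in> ball 0 r1 \<Longrightarrow> N s = exp (n s)"
    using contractible_imp_holomorphic_log[OF N_hol convex_imp_contractible[OF convex_ball] N_nz] by blast
  obtain f where f: "f holomorphic_on ball 0 r1" "\<And>s. s \<in> ball 0 r1 \<Longrightarrow> F s = exp (f s)"
    using contractible_imp_holomorphic_log[OF F_hol convex_imp_contractible[OF convex_ball] F_nz] by blast
  have path_comp: "path (\<lambda>s. h (X s))" if "h holomorphic_on ball 0 r1" for h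
    using continuous_on_compose2[OF holomorphic_on_imp_continuous_on[OF that] pX Xim]
    by (simp add: path_def)
  define c where "c = - (2 / of_nat (m-1) :: complex)"
  have c0: "c \<noteq> 0" using m by (simp add: c_def)
  have path_T: "path (param_time a \<circ> \<gamma>)"
    by (rule path_continuous_image[OF \<gamma>(1) continuous_on_subset[OF
          holomorphic_on_imp_continuous_on[OF param_time_holomorphic[OF a]]]])
       (use \<gamma>(2) in \<open>auto simp: D_def\<close>)
  have path_P: "path (param a \<circ> \<gamma>)"
    by (rule path_continuous_image[OF \<gamma>(1) continuous_on_subset[OF param_continuous[OF a]]])
       (use \<gamma>(2) in \<open>auto simp: D_def\<close>)
  have path_v: "path (fst \<circ> param a \<circ> \<gamma>)" and path_w: "path (snd \<circ> param a \<circ> \<gamma>)"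
    using path_P by (auto simp: path_def o_def intro: continuous_on_fst continuous_on_snd)
  have XN: "X s \<in> ball 0 r1" if "s \<in> {0..1}" for s using Xim that by blast
  have T0: "0 \<notin> path_image (param_time a \<circ> \<gamma>)"
    using \<gamma>b(2) N_nz[OF XN] c0 unfolding path_image_def X_def param_time_def c_def by fastforce
  have v0: "0 \<notin> path_image (fst \<circ> param a \<circ> \<gamma>)"
    using param_fst_nz[OF a \<gamma>D] unfolding path_image_def by fastforce
  have w0: "0 \<notin> path_image (snd \<circ> param a \<circ> \<gamma>)"
    using \<gamma>b(2) unfolding path_image_def by (fastforce simp: param_def)
  have cyc_t: "of_nat (m-1) * cyc = of_nat (wind_t m)"
  proof (cases "even m")
    case False
    then obtain k where "m = 2 * k + 1" by (elim oddE)
    thus ?thesis by (simp add: cyc wind_t_def)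
  qed (simp add: cyc wind_t_def)
  have cyc_v: "of_nat (m+1) * cyc = of_nat (wind_v m)"
  proof (cases "even m")
    case False
    then obtain k where "m = 2 * k + 1" by (elim oddE)
    thus ?thesis by (simp add: cyc wind_v_def)
  qed (simp add: cyc wind_v_def)
  have "of_nat 1 * winding_number (param_time a \<circ> \<gamma>) 0 = of_nat (m-1) * winding_number \<gamma> 0 +
     ((Ln c + n (X 1)) - (Ln c + n (X 0))) / (2 * of_real pi * \<i>)"
  proof (rule winding_number_power_relation[OF \<gamma>(1) \<gamma>0 path_T T0])
    show "path (\<lambda>s. Ln c + n (X s))"
      using path_comp[OF n(1)] unfolding path_def by (intro continuous_intros)
    fix s :: real assume s: "s \<in> {0..1}"
    show "(param_time a \<circ> \<gamma>) s ^ 1 = \<gamma> s ^ (m-1) * exp (Ln c + n (X s))"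
      using c0 n(2)[OF XN[OF s]] by (simp add: exp_add param_time_def X_def c_def)
  qed
  thus T: "winding_number (param_time a \<circ> \<gamma>) 0 = of_nat (wind_t m)"
    using X1 cyc_t wind by simp
  have "of_nat 1 * winding_number (snd \<circ> param a \<circ> \<gamma>) 0 = of_nat (m-1) * winding_number \<gamma> 0 +
     (0 - 0) / (2 * of_real pi * \<i>)"
    by (rule winding_number_power_relation[OF \<gamma>(1) \<gamma>0 path_w w0, where l = "\<lambda>_. 0"])
       (auto simp: param_def path_def)
  thus "winding_number (snd \<circ> param a \<circ> \<gamma>) 0 = of_nat (wind_t m)"
    using cyc_t wind by simp
  have "of_nat 1 * winding_number (fst \<circ> param a \<circ> \<gamma>) 0 = of_nat (m+1) * winding_number \<gamma> 0 +
     ((Ln a + f (X 1)) - (Ln a + f (X 0))) / (2 * of_real pi * \<i>)"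
  proof (rule winding_number_power_relation[OF \<gamma>(1) \<gamma>0 path_v v0])
    show "path (\<lambda>s. Ln a + f (X s))"
      using path_comp[OF f(1)] unfolding path_def by (intro continuous_intros)
    fix s :: real assume s: "s \<in> {0..1}"
    show "(fst \<circ> param a \<circ> \<gamma>) s ^ 1 = \<gamma> s ^ (m+1) * exp (Ln a + f (X s))"
      using A_nz[OF a] f(2)[OF XN[OF s]] by (simp add: exp_add param_def X_def)
  qed
  thus "winding_number (fst \<circ> param a \<circ> \<gamma>) 0 = of_nat (wind_v m)"
    using X1 cyc_v wind by simp
  have "wind_t m > 0" using m by (auto simp: wind_t_def elim!: oddE)
  have "blowup_loop G (leaf a) (param_time a \<circ> \<gamma>) (param a \<circ> \<gamma>)"
    unfolding blowup_loop_def
  proof (intro conjI path_T T0)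
    show "pathfinish (param_time a \<circ> \<gamma>) = pathstart (param_time a \<circ> \<gamma>)"
      using closed by (simp add: pathfinish_def pathstart_def)
    show "Re (winding_number (param_time a \<circ> \<gamma>) 0) > 0" using T \<open>wind_t m > 0\<close> by simp
    show "continued_along G {0..1} (param_time a \<circ> \<gamma>) (param a \<circ> \<gamma>)"
      by (rule continued_along_param[OF a]) (use \<gamma>(1) \<gamma>D in \<open>auto simp: path_def\<close>)
    show "(param a \<circ> \<gamma>) ` {0..1} \<subseteq> leaf a" using \<gamma>D by (auto simp: leaf_def)
    show "blows_up_at_0 G (leaf a) ((param_time a \<circ> \<gamma>) 0) ((param a \<circ> \<gamma>) 0)"
      using param_blows_up[OF a \<gamma>D[of 0]] by simp
    show "(param a \<circ> \<gamma>) 1 = (param a \<circ> \<gamma>) 0" using closed by simp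
  qed
  thus "minimal_blowup_loop G (leaf a) (param_time a \<circ> \<gamma>) (param a \<circ> \<gamma>)"
    unfolding minimal_blowup_loop_def using blowup_loop_winding[OF a] T by simp
qed

section \<open>The Riemann surface\<close>

text \<open>
  For odd \<open>m\<close> the curve \<open>param a\<close> is a function of \<open>\<theta>\<^sup>2\<close>. In the coordinate \<open>\<zeta> = \<theta>\<close> or \<open>\<zeta> = \<theta>\<^sup>2\<close>, according to
  the parity of \<open>m\<close>, the closure of a leaf is an injective image of a disc.
\<close>
definition cover_deg :: nat where "cover_deg = (if even m then 1 else 2)"

definition surf :: "complex \<Rightarrow> complex \<Rightarrow> complex \<times> complex" where
  "surf a \<zeta> = (a * \<zeta>^(wind_v m) * F (S (a * \<zeta>^(if even m then 2 else 1))), \<zeta>^(wind_t m))"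

lemma cover_deg_pos: "cover_deg > 0" by (simp add: cover_deg_def)

lemma wind_t_pos: "wind_t m > 0" using m by (auto simp: wind_t_def elim!: oddE)

lemma wind_v_gt_1: "wind_v m > 1" using m by (auto simp: wind_v_def elim!: oddE)

lemma cover_deg_wind: "cover_deg * wind_t m = m - 1" "cover_deg * wind_v m = m + 1"
  by (auto simp: cover_deg_def wind_t_def wind_v_def elim!: oddE)

lemma surf_power: "surf a (\<theta>^cover_deg) = param a \<theta>"
proof -
  have "(\<theta>^cover_deg)^(if even m then 2 else 1) = \<theta>^2" by (simp add: cover_deg_def)
  thus ?thesis unfolding surf_def param_def by (simp add: cover_deg_wind flip: power_mult)
qed

lemma disc_root:
  assumes "\<zeta> \<in> ball (0::complex) (\<rho>^cover_deg)"
  obtains \<theta> where "\<theta> \<in> ball 0 \<rho>" "\<zeta> = \<theta>^cover_deg"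
proof -
  obtain \<theta> where \<theta>: "\<zeta> = \<theta>^cover_deg" using exists_complex_root[of cover_deg \<zeta>] cover_deg_pos by auto
  have "cmod \<theta>^cover_deg < \<rho>^cover_deg" using assms by (simp add: \<theta> norm_power)
  hence "cmod \<theta> < \<rho>" by (rule power_less_imp_less_base) (use \<rho>_pos in auto)
  thus ?thesis using that \<theta> by simp
qed

lemma surf_image: "surf a ` ball 0 (\<rho>^cover_deg) = insert (0, 0) (leaf a)"
proof -
  have "surf a ` ball 0 (\<rho>^cover_deg) = param a ` ball 0 \<rho>"
  proof (intro subset_antisym subsetI)
    fix p assume "p \<in> surf a ` ball 0 (\<rho>^cover_deg)"
    then obtain \<zeta> where "\<zeta> \<in> ball 0 (\<rho>^cover_deg)" "p = surf a \<zeta>" by blast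
    thus "p \<in> param a ` ball 0 \<rho>" by (metis disc_root surf_power image_eqI)
  next
    fix p assume "p \<in> param a ` ball 0 \<rho>"
    then obtain \<theta> where \<theta>: "cmod \<theta> < \<rho>" "p = param a \<theta>" by auto
    have "cmod (\<theta>^cover_deg) < \<rho>^cover_deg"
      unfolding norm_power using \<theta>(1) cover_deg_pos by (intro power_strict_mono) auto
    thus "p \<in> surf a ` ball 0 (\<rho>^cover_deg)" using \<theta>(2) surf_power by (metis image_eqI mem_ball_0)
  qed
  thus ?thesis by (simp only: param_ball)
qed

text \<open>
  Equal points force \<open>\<theta>\<^sup>2 = \<theta>'\<^sup>2\<close> and \<open>\<theta>\<^sup>m\<^sup>-\<^sup>1 = \<theta>'\<^sup>m\<^sup>-\<^sup>1\<close>; if \<open>m - 1\<close> is odd, both together give \<open>\<theta> = \<theta>'\<close>.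
\<close>
lemma param_eq_imp_power_eq:
  assumes a: "a \<in> A" and \<theta>: "\<theta> \<in> ball 0 \<rho>" "\<theta>' \<in> ball 0 \<rho>" and eq: "param a \<theta> = param a \<theta>'"
  shows "\<theta>^cover_deg = \<theta>'^cover_deg"
proof -
  have e: "\<theta>^(m-1) = \<theta>'^(m-1)" "\<theta>^2 = \<theta>'^2"
    using param_eq_iff[OF a a \<theta>] eq A_nz[OF a] by auto
  show ?thesis
  proof (cases "even m")
    case True
    then obtain j where "m = 2 * j" by (elim evenE)
    hence "m - 1 = Suc (2 * (j - 1))" using m by linarith
    then obtain k where k: "m - 1 = Suc (2 * k)" by blast
    have "\<theta> * (\<theta>^2)^k = \<theta>' * (\<theta>'^2)^k" using e(1) unfolding k by (simp add: power_mult)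
    hence "\<theta> * (\<theta>^2)^k = \<theta>' * (\<theta>^2)^k" using e(2) by simp
    moreover have "\<theta> = 0 \<longleftrightarrow> \<theta>' = 0" using e(2) by (metis power_eq_0_iff zero_power2)
    ultimately have "\<theta> = \<theta>'" by auto
    thus ?thesis by simp
  next
    case False
    thus ?thesis using e(2) by (simp add: cover_deg_def)
  qed
qed

lemma surf_inj:
  assumes a: "a \<in> A"
  shows "inj_on (surf a) (ball 0 (\<rho>^cover_deg))"
proof (rule inj_onI)
  fix \<zeta> \<zeta>' assume z: "\<zeta> \<in> ball 0 (\<rho>^cover_deg)" "\<zeta>' \<in> ball 0 (\<rho>^cover_deg)" "surf a \<zeta> = surf a \<zeta>'"
  obtain \<theta> where \<theta>: "\<theta> \<in> ball 0 \<rho>" "\<zeta> = \<theta>^cover_deg" using z(1) by (rule disc_root)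
  obtain \<theta>' where \<theta>': "\<theta>' \<in> ball 0 \<rho>" "\<zeta>' = \<theta>'^cover_deg" using z(2) by (rule disc_root)
  have "param a \<theta> = param a \<theta>'" using z(3) by (simp add: \<theta>(2) \<theta>'(2) surf_power)
  thus "\<zeta> = \<zeta>'" unfolding \<theta>(2) \<theta>'(2) by (rule param_eq_imp_power_eq[OF a \<theta>(1) \<theta>'(1)])
qed

lemma surf_holomorphic:
  assumes a: "a \<in> A"
  shows "(\<lambda>\<zeta>. F (S (a * \<zeta>^(if even m then 2 else 1)))) holomorphic_on ball 0 (\<rho>^cover_deg)"
    "(\<lambda>\<zeta>. fst (surf a \<zeta>)) holomorphic_on ball 0 (\<rho>^cover_deg)"
    "(\<lambda>\<zeta>. snd (surf a \<zeta>)) holomorphic_on ball 0 (\<rho>^cover_deg)"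
proof -
  let ?j = "if even m then 2 else 1 :: nat"
  have 1: "(\<lambda>\<zeta>. a * \<zeta>^?j) holomorphic_on ball 0 (\<rho>^cover_deg)" by (intro holomorphic_intros)
  have 2: "(\<lambda>\<zeta>. a * \<zeta>^?j) ` ball 0 (\<rho>^cover_deg) \<subseteq> ball 0 r0"
  proof
    fix z assume "z \<in> (\<lambda>\<zeta>. a * \<zeta>^?j) ` ball 0 (\<rho>^cover_deg)"
    then obtain \<zeta> where \<zeta>: "\<zeta> \<in> ball 0 (\<rho>^cover_deg)" "z = a * \<zeta>^?j" by blast
    obtain \<theta> where \<theta>: "\<theta> \<in> ball 0 \<rho>" "\<zeta> = \<theta>^cover_deg" using \<zeta>(1) by (rule disc_root)
    have "\<zeta>^?j = \<theta>^2" by (simp add: \<theta>(2) cover_deg_def)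
    thus "z \<in> ball 0 r0" using arg_in[OF a \<theta>(1)] \<zeta>(2) by simp
  qed
  have 3: "(\<lambda>\<zeta>. S (a * \<zeta>^?j)) holomorphic_on ball 0 (\<rho>^cover_deg)"
    using holomorphic_on_compose_gen[OF 1 S_hol 2] by (simp add: o_def)
  have 4: "(\<lambda>\<zeta>. S (a * \<zeta>^?j)) ` ball 0 (\<rho>^cover_deg) \<subseteq> ball 0 r1"
  proof
    fix z assume "z \<in> (\<lambda>\<zeta>. S (a * \<zeta>^?j)) ` ball 0 (\<rho>^cover_deg)"
    then obtain \<zeta> where "\<zeta> \<in> ball 0 (\<rho>^cover_deg)" "z = S (a * \<zeta>^?j)" by blast
    moreover from this(1) have "a * \<zeta>^?j \<in> ball 0 r0" using 2 by blast
    ultimately show "z \<in> ball 0 r1" using S_in by simp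
  qed
  show "(\<lambda>\<zeta>. F (S (a * \<zeta>^?j))) holomorphic_on ball 0 (\<rho>^cover_deg)"
    using holomorphic_on_compose_gen[OF 3 F_hol 4] by (simp add: o_def)
  thus "(\<lambda>\<zeta>. fst (surf a \<zeta>)) holomorphic_on ball 0 (\<rho>^cover_deg)"
    unfolding surf_def fst_conv by (intro holomorphic_intros)
  show "(\<lambda>\<zeta>. snd (surf a \<zeta>)) holomorphic_on ball 0 (\<rho>^cover_deg)"
    unfolding surf_def snd_conv by (intro holomorphic_intros)
qed

text \<open>
  One chart suffices, the inverse of \<open>surf a\<close>. It is continuous because \<open>\<bar>w\<bar>\<close> is a power of \<open>\<bar>\<zeta>\<bar>\<close>:
  points near a given one have parameters in a compact disc, on which an injective continuous
  map is a homeomorphism. The ramification indices are the exponents of \<open>\<zeta>\<close> in \<open>surf a \<zeta>\<close>.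
\<close>
lemma closure_leaf_riemann_surface:
  assumes a: "a \<in> A"
  shows "\<exists>\<A>. riemann_surface (insert (0, 0) (leaf a)) \<A> \<and>
               holomorphic_in_charts \<A> fst \<and> holomorphic_in_charts \<A> snd \<and>
               branch_point \<A> fst (0, 0) \<and>
               has_ramification_index \<A> fst (0, 0) (wind_v m) \<and>
               has_ramification_index \<A> snd (0, 0) (wind_t m)"
proof -
  define B where "B = ball (0::complex) (\<rho>^cover_deg)"
  define X where "X = insert (0, 0) (leaf a)"
  have X: "X = surf a ` B" by (simp add: X_def B_def surf_image)
  have inj: "inj_on (surf a) B" unfolding B_def by (rule surf_inj[OF a])
  define \<psi> where "\<psi> = inv_into B (surf a)"
  have \<psi>_surf: "\<psi> (surf a \<zeta>) = \<zeta>" if "\<zeta> \<in> B" for \<zeta> using inv_into_f_f[OF inj that] by (simp add: \<psi>_def)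
  have \<psi>X: "\<psi> ` X = B"
  proof -
    have "\<psi> ` X = (\<lambda>\<zeta>. \<psi> (surf a \<zeta>)) ` B" unfolding X by (simp only: image_image)
    also have "\<dots> = (\<lambda>\<zeta>. \<zeta>) ` B" by (intro image_cong refl \<psi>_surf)
    finally show ?thesis by simp
  qed
  have \<psi>_inj: "inj_on \<psi> X" unfolding \<psi>_def X by (rule inj_on_inv_into) simp
  have inv: "inv_into X \<psi> \<zeta> = surf a \<zeta>" if "\<zeta> \<in> B" for \<zeta>
  proof -
    have "surf a \<zeta> \<in> X" using that by (auto simp: X)
    from inv_into_f_f[OF \<psi>_inj this] show ?thesis by (simp add: \<psi>_surf[OF that])
  qed
  have cont_surf: "continuous_on B (surf a)"
  proof -
    have "continuous_on B (\<lambda>\<zeta>. (fst (surf a \<zeta>), snd (surf a \<zeta>)))"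
      unfolding B_def by (intro continuous_on_Pair holomorphic_on_imp_continuous_on surf_holomorphic[OF a])
    thus ?thesis by simp
  qed
  have cont_\<psi>: "continuous_on X \<psi>"
    unfolding continuous_on_eq_continuous_within
  proof
    fix p assume "p \<in> X"
    then obtain \<zeta> where \<zeta>: "\<zeta> \<in> B" "p = surf a \<zeta>" unfolding X by blast
    have "cmod \<zeta> < \<rho>^cover_deg" using \<zeta>(1) by (simp add: B_def)
    then obtain r' where r': "cmod \<zeta> < r'" "r' < \<rho>^cover_deg" using dense by blast
    have r'0: "r' > 0" using r'(1) norm_ge_zero[of \<zeta>] by linarith
    let ?K = "surf a ` cball 0 r'"
    let ?O = "snd -` ball 0 (r'^wind_t m) :: (complex \<times> complex) set"
    have sub: "cball 0 r' \<subseteq> B" using r'(2) by (auto simp: B_def)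
    have "continuous_on ?K \<psi>"
      by (rule continuous_on_inv[OF continuous_on_subset[OF cont_surf sub]]) (use sub \<psi>_surf in auto)
    moreover have "p \<in> ?K" using r'(1) \<zeta>(2) by auto
    ultimately have "continuous (at p within ?K) \<psi>"
      unfolding continuous_on_eq_continuous_within by blast
    moreover have "at p within X = at p within ?K"
    proof (rule at_within_nhd[of _ ?O])
      show "open ?O" by (intro open_vimage_snd) auto
      show "p \<in> ?O" unfolding \<zeta>(2) using r'(1) wind_t_pos
        by (simp add: surf_def norm_power power_strict_mono)
      have "\<xi> \<in> cball 0 r'" if "\<xi> \<in> B" "surf a \<xi> \<in> ?O" for \<xi>
      proof -
        have "cmod \<xi>^wind_t m < r'^wind_t m" using that(2) by (simp add: surf_def norm_power)
        hence "cmod \<xi> < r'" by (rule power_less_imp_less_base) (use r'0 in auto)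
        thus ?thesis by simp
      qed
      hence "X \<inter> ?O \<subseteq> ?K" unfolding X by blast
      moreover have "?K \<subseteq> X" unfolding X using sub by blast
      ultimately show "X \<inter> ?O - {p} = ?K \<inter> ?O - {p}" by blast
    qed
    ultimately show "continuous (at p within X) \<psi>" by simp
  qed
  have hom: "homeomorphism X (\<psi> ` X) \<psi> (inv_into X \<psi>)"
    unfolding homeomorphism_def
  proof (intro conjI ballI)
    show "continuous_on X \<psi>" by (rule cont_\<psi>)
    show "continuous_on (\<psi> ` X) (inv_into X \<psi>)"
      unfolding \<psi>X by (rule continuous_on_eq[OF cont_surf]) (simp add: inv)
    show "inv_into X \<psi> ` \<psi> ` X = X" by (rule inv_into_image_cancel[OF \<psi>_inj]) simp
  qed (auto simp: inv_into_f_f[OF \<psi>_inj] f_inv_into_f)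
  let ?\<A> = "{(X, \<psi>)}"
  have B0: "0 \<in> B" using \<rho>_pos by (simp add: B_def)
  have surf0: "surf a 0 = (0, 0)" using wind_t_pos wind_v_gt_1 by (simp add: surf_def)
  have \<psi>0: "\<psi> (0, 0) = 0" using \<psi>_surf[OF B0] by (simp add: surf0)
  have "riemann_surface X ?\<A>"
    unfolding riemann_surface_def
  proof (intro conjI)
    show "X \<noteq> {}" by (simp add: X_def)
    show "connected X" unfolding X by (rule connected_continuous_image[OF cont_surf]) (simp add: B_def)
    have "(\<psi> \<circ> inv_into X \<psi>) holomorphic_on B"
      by (rule holomorphic_transform[of "\<lambda>\<zeta>. \<zeta>"]) (auto simp: inv \<psi>_surf)
    thus "\<forall>(V, \<psi>)\<in>?\<A>. \<forall>(V', \<psi>')\<in>?\<A>. (\<psi>' \<circ> inv_into V \<psi>) holomorphic_on \<psi> ` (V \<inter> V')"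
      by (simp add: \<psi>X)
    show "\<forall>(V, \<psi>)\<in>?\<A>. openin (top_of_set X) V \<and> open (\<psi> ` V) \<and>
        homeomorphism V (\<psi> ` V) \<psi> (inv_into V \<psi>)"
      using hom \<psi>X by (simp add: B_def)
  qed auto
  moreover have "holomorphic_in_charts ?\<A> fst"
  proof -
    have "(fst \<circ> inv_into X \<psi>) holomorphic_on B"
      by (rule holomorphic_transform[OF surf_holomorphic(2)[OF a, folded B_def]]) (simp add: inv)
    thus ?thesis by (simp add: holomorphic_in_charts_def \<psi>X)
  qed
  moreover have "holomorphic_in_charts ?\<A> snd"
  proof -
    have "(snd \<circ> inv_into X \<psi>) holomorphic_on B"
      by (rule holomorphic_transform[OF surf_holomorphic(3)[OF a, folded B_def]]) (simp add: inv)
    thus ?thesis by (simp add: holomorphic_in_charts_def \<psi>X)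
  qed
  moreover have ram_v: "has_ramification_index ?\<A> fst (0, 0) (wind_v m)"
  proof -
    have "zorder (\<lambda>\<zeta>. fst (inv_into X \<psi> \<zeta>) - fst (0::complex, 0::complex)) 0 = int (wind_v m)"
    proof (rule zorder_eqI[of B])
      show "(\<lambda>\<zeta>. a * F (S (a * \<zeta>^(if even m then 2 else 1)))) holomorphic_on B"
        unfolding B_def by (intro holomorphic_intros surf_holomorphic(1)[OF a])
      show "a * F (S (a * 0^(if even m then 2 else 1))) \<noteq> 0"
        using A_nz[OF a] by (simp add: S_0 F_0)
    qed (use B0 in \<open>auto simp: B_def[symmetric] inv surf_def\<close>, simp add: B_def)
    thus ?thesis by (simp add: has_ramification_index_def X_def[symmetric] \<psi>0) (simp add: X_def)
  qed
  moreover have "has_ramification_index ?\<A> snd (0, 0) (wind_t m)"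
  proof -
    have "zorder (\<lambda>\<zeta>. snd (inv_into X \<psi> \<zeta>) - snd (0::complex, 0::complex)) 0 = int (wind_t m)"
    proof (rule zorder_eqI[of B _ "\<lambda>_. 1"])
    qed (use B0 in \<open>auto simp: B_def[symmetric] inv surf_def\<close>, simp add: B_def)
    thus ?thesis by (simp add: has_ramification_index_def X_def[symmetric] \<psi>0) (simp add: X_def)
  qed
  moreover have "branch_point ?\<A> fst (0, 0)"
    unfolding branch_point_def using ram_v wind_v_gt_1 by blast
  ultimately show ?thesis unfolding X_def[symmetric] by blast
qed

lemma loop_not_closed_early:
  assumes a: "a \<in> A" and \<theta>: "\<theta> \<in> D" and s: "s \<in> {0<..<1}"
  shows "param a (\<theta> * exp (2 * pi * \<i> * (if even m then 1 else 1/2) * of_real s)) \<noteq> param a \<theta>"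
proof
  define E where "E = exp (2 * pi * \<i> * (if even m then 1 else 1/2) * of_real s)"
  assume "param a (\<theta> * exp (2 * pi * \<i> * (if even m then 1 else 1/2) * of_real s)) = param a \<theta>"
  hence eq: "param a (\<theta> * E) = param a \<theta>" by (simp only: E_def)
  have "cmod E = 1" unfolding E_def by (simp add: norm_exp_eq_Re)
  hence "\<theta> * E \<in> ball 0 \<rho>" using \<theta> by (simp add: D_def norm_mult)
  moreover have "\<theta> \<in> ball 0 \<rho>" "\<theta> \<noteq> 0" using \<theta> by (auto simp: D_def)
  ultimately have "(\<theta> * E)^cover_deg = \<theta>^cover_deg"
    by (intro param_eq_imp_power_eq[OF a _ _ eq])
  hence "E^cover_deg = 1" using \<open>\<theta> \<noteq> 0\<close> by (simp add: power_mult_distrib)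
  moreover have "E^cover_deg = exp (2 * pi * \<i> * of_real s)"
    by (simp add: E_def cover_deg_def mult_ac flip: exp_double)
  ultimately have "exp (2 * pi * \<i> * of_real s) = 1" by simp
  then obtain n :: int where "2 * pi * s = of_int (2 * n) * pi" by (auto simp: exp_eq_1)
  hence "s = of_int n" by simp
  thus False using s by auto
qed

section \<open>Real-time blow-up stars\<close>

text \<open>
  The coordinate \<open>\<sigma>\<close> in which time is a pure power: \<open>t = - 2/(m-1) \<sigma>\<^sup>m\<^sup>-\<^sup>1\<close>.
\<close>
definition sig :: "complex \<Rightarrow> complex \<Rightarrow> complex" where
  "sig a \<theta> = \<theta> * exp (Ln (N (S (a * \<theta>^2))) / of_nat (m-1))"

lemma sig_power:
  assumes "a \<in> A" "\<theta> \<in> ball 0 \<rho>"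
  shows "sig a \<theta>^(m-1) = \<theta>^(m-1) * N (S (a * \<theta>^2))"
proof -
  have nz: "N (S (a * \<theta>^2)) \<noteq> 0" using N_nz S_in arg_in[OF assms] by blast
  have "exp (Ln (N (S (a * \<theta>^2))) / of_nat (m-1))^(m-1)
      = exp (of_nat (m-1) * (Ln (N (S (a * \<theta>^2))) / of_nat (m-1)))"
    by (rule exp_of_nat_mult[symmetric])
  also have "\<dots> = N (S (a * \<theta>^2))" using nz m by simp
  finally show ?thesis by (simp add: sig_def power_mult_distrib)
qed

lemma param_time_sig:
  assumes "a \<in> A" "\<theta> \<in> ball 0 \<rho>"
  shows "param_time a \<theta> = - (2 / of_nat (m-1)) * sig a \<theta>^(m-1)"
  unfolding sig_power[OF assms] by (simp add: param_time_def mult.assoc)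

lemma N_root_holomorphic:
  assumes a: "a \<in> A"
  shows "(\<lambda>\<theta>. exp (Ln (N (S (a * \<theta>^2))) / of_nat (m-1))) holomorphic_on ball 0 \<rho>"
proof -
  have "(\<lambda>\<theta>. Ln (N (S (a * \<theta>^2)))) holomorphic_on ball 0 \<rho>"
    by (rule holomorphic_on_Ln'[OF _ param_holomorphic(4)[OF a]])
       (use N_not_nonpos S_in arg_in[OF a] in blast)
  hence "(\<lambda>\<theta>. Ln (N (S (a * \<theta>^2))) / of_nat (m-1)) holomorphic_on ball 0 \<rho>"
    by (rule holomorphic_on_divide[OF _ holomorphic_on_const]) (use m in auto)
  from holomorphic_on_compose[OF this holomorphic_on_exp] show ?thesis by (simp add: o_def)
qed

lemma sig_holomorphic: "a \<in> A \<Longrightarrow> sig a holomorphic_on ball 0 \<rho>"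
  unfolding sig_def by (rule holomorphic_on_mult[OF holomorphic_on_ident N_root_holomorphic])

lemma sig_0: "sig a 0 = 0" by (simp add: sig_def)

lemma sig_deriv_0:
  assumes a: "a \<in> A"
  shows "deriv (sig a) 0 = 1"
proof (rule DERIV_imp_deriv)
  define E where "E = (\<lambda>\<theta>. exp (Ln (N (S (a * \<theta>^2))) / of_nat (m-1)))"
  have "E holomorphic_on ball 0 \<rho>" unfolding E_def by (rule N_root_holomorphic[OF a])
  hence "(E has_field_derivative deriv E 0) (at 0)"
    by (rule holomorphic_derivI[OF _ open_ball]) (use \<rho>_pos in simp)
  from DERIV_mult[OF DERIV_ident this]
  have "((\<lambda>\<theta>. \<theta> * E \<theta>) has_field_derivative E 0) (at 0)" by simp
  moreover have "E 0 = 1" by (simp add: E_def S_0 N_0)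
  ultimately show "(sig a has_field_derivative 1) (at 0)"
    unfolding sig_def E_def by simp
qed

lemma sig_minus: "sig a (- \<theta>) = - sig a \<theta>" by (simp add: sig_def)

text \<open>
  The argument for loops, repeated with real time: \<open>blowup_time\<close> grows at unit speed and tends
  to \<open>0\<close> at the blow-up.
\<close>
lemma real_solution_time:
  assumes a: "a \<in> A" and I: "convex I" "open I"
    and \<phi>: "real_time_solution G (leaf a) I \<phi>"
    and F': "FF \<noteq> bot" "\<forall>\<^sub>F s in FF. s \<in> I" "((\<lambda>s. s) \<longlongrightarrow> 0) FF" "(\<phi> \<longlongrightarrow> (0, 0)) FF"
    and s: "s \<in> I"
  shows "blowup_time (\<phi> s) = of_real s"
proof -
  define x y where "x = (\<lambda>s. snd (\<phi> s) / fst (\<phi> s))" and "y = (\<lambda>s. 1 / fst (\<phi> s))"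
  have \<phi>': "\<phi> s \<in> leaf a" "fst (\<phi> s) \<noteq> 0"
    "(x has_vector_derivative y s) (at s)" "(y has_vector_derivative poly (pderiv G) (x s)) (at s)"
    if "s \<in> I" for s
    using \<phi> that unfolding real_time_solution_def x_def y_def by auto
  have lev: "\<phi> s \<in> level" if "s \<in> I" for s using \<phi>'(1)[OF that] leaf_subset_level[OF a] by blast
  have "\<exists>c. \<forall>s\<in>I. blowup_time (\<phi> s) - of_real s = c"
  proof (rule has_derivative_zero_constant[OF I(1)])
    fix s assume s: "s \<in> I"
    have l: "(fst (\<phi> s), snd (\<phi> s)) \<in> level" using lev[OF s] by simp
    have "((\<lambda>s. blowup_time (1 / y s, x s / y s)) has_derivative of_real) (at s)"
    proof (rule blowup_time_along)
      show "(x has_derivative (\<lambda>h. y s * of_real h)) (at s)"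
        "(y has_derivative (\<lambda>h. poly (pderiv G) (x s) * of_real h)) (at s)"
        using \<phi>'(3,4)[OF s] unfolding has_vector_derivative_def scaleR_conv_of_real
        by (simp_all add: mult.commute)
      show "Hxy G (x s) (y s) = 0" using level_energy[OF l] by (simp add: x_def y_def)
      show "x s \<noteq> 0" "y s \<noteq> 0" "1 / x s \<in> ball 0 r1"
        using level_ratio(1,2)[OF l] level_ratio_r1[OF l] by (simp_all add: x_def y_def)
    qed
    hence "((\<lambda>s. blowup_time (\<phi> s)) has_derivative of_real) (at s)"
    proof (rule has_derivative_transform_within_open[OF _ I(2) s])
      show "blowup_time (1 / y s, x s / y s) = blowup_time (\<phi> s)" if "s \<in> I" for s
      proof -
        have "(1 / y s, x s / y s) = \<phi> s" using \<phi>'(2)[OF that] by (simp add: x_def y_def)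
        thus ?thesis by simp
      qed
    qed
    from has_derivative_diff[OF this has_derivative_of_real[OF has_derivative_ident]]
    have "((\<lambda>s. blowup_time (\<phi> s) - of_real s) has_derivative (\<lambda>h. 0)) (at s)" by simp
    thus "((\<lambda>s. blowup_time (\<phi> s) - of_real s) has_derivative (\<lambda>h. 0)) (at s within I)"
      by (rule has_derivative_at_withinI)
  qed
  then obtain c where c: "\<And>s. s \<in> I \<Longrightarrow> blowup_time (\<phi> s) - of_real s = c" by blast
  have "((\<lambda>s. of_real s :: complex) \<longlongrightarrow> of_real 0) FF" by (intro tendsto_of_real F'(3))
  moreover have "((\<lambda>s. blowup_time (\<phi> s)) \<longlongrightarrow> 0) FF"
    by (rule tendsto_blowup_time[OF F'(4)]) (use F'(2) lev in \<open>auto elim!: eventually_mono\<close>)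
  ultimately have "((\<lambda>s. blowup_time (\<phi> s) - of_real s) \<longlongrightarrow> 0 - of_real 0) FF"
    by (intro tendsto_diff)
  hence lim: "((\<lambda>s. blowup_time (\<phi> s) - of_real s) \<longlongrightarrow> 0) FF" by simp
  have ev: "\<forall>\<^sub>F s in FF. blowup_time (\<phi> s) - of_real s = c"
    using F'(2) by eventually_elim (rule c)
  have "((\<lambda>s. c) \<longlongrightarrow> 0) FF" by (rule iffD1[OF tendsto_cong[OF ev] lim])
  hence "c = 0" using F'(1) by (simp add: tendsto_const_iff)
  thus ?thesis using c[OF s] by simp
qed

end

text \<open>
  \<open>B\<close> is the local inverse of \<open>sig a\<close>. The relation between \<open>\<epsilon>\<close> and \<open>\<eta>\<close> makes times of modulus below \<open>\<epsilon>\<close>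
  correspond exactly to \<open>\<bar>\<sigma>\<bar> < \<eta>\<close>.
\<close>
locale blowup_star = pendulum_polydisc +
  fixes a :: complex and B :: "complex \<Rightarrow> complex" and \<eta> \<epsilon> :: real
  assumes a: "a \<in> A" and \<eta>: "\<eta> > 0" and \<epsilon>: "\<epsilon> = 2 / real (m-1) * \<eta>^(m-1)"
    and B_hol: "B holomorphic_on ball 0 \<eta>"
    and B_in: "u \<in> ball 0 \<eta> \<Longrightarrow> B u \<in> ball 0 \<rho>"
    and B_0: "B 0 = 0" and B_deriv: "deriv B 0 = 1"
    and sig_B: "u \<in> ball 0 \<eta> \<Longrightarrow> sig a (B u) = u"
    and B_sig: "\<lbrakk>\<theta> \<in> D; cmod (param_time a \<theta>) < \<epsilon>\<rbrakk> \<Longrightarrow> B (sig a \<theta>) = \<theta>"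
begin

text \<open>
  Time is real where \<open>\<sigma>\<^sup>m\<^sup>-\<^sup>1\<close> is real, that is, on the rays through the roots of unity \<open>dir k\<close>; on the
  \<open>k\<close>-th ray its sign is \<open>- (-1)\<^sup>k\<close>, so even \<open>k\<close> belong to blow-up. The radius at time \<open>s\<close> is \<open>rad s\<close>.
\<close>
definition dir :: "nat \<Rightarrow> complex" where "dir k = cis (pi * real k / real (m-1))"
definition ray :: "nat \<Rightarrow> real \<Rightarrow> complex" where "ray k r = B (dir k * of_real r)"
definition rad :: "real \<Rightarrow> real" where "rad s = root (m-1) (real (m-1) * \<bar>s\<bar> / 2)"
definition times :: "nat \<Rightarrow> real set" where "times k = (if even k then {-\<epsilon><..<0} else {0<..<\<epsilon>})"
definition side :: "nat \<Rightarrow> real filter" where "side k = (if even k then at_left 0 else at_right 0)"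
definition branch :: "nat \<Rightarrow> (complex \<times> complex) set" where
  "branch k = (\<lambda>r. param a (ray k r)) ` {0<..<\<eta>}"

lemma m1: "0 < m - 1" "real (m-1) > 0" using m by auto

lemma \<epsilon>_pos: "\<epsilon> > 0" using \<eta> m1 by (simp add: \<epsilon>)

lemma dir_power: "dir k^(m-1) = (-1)^k"
proof -
  have "dir k^(m-1) = cis (real (m-1) * (pi * real k / real (m-1)))"
    unfolding dir_def by (rule Complex.DeMoivre)
  also have "real (m-1) * (pi * real k / real (m-1)) = real k * pi" using m1 by simp
  also have "cis (real k * pi) = cis pi^k" by (rule Complex.DeMoivre[symmetric])
  finally show ?thesis by simp
qed

lemma norm_dir: "cmod (dir k) = 1" by (simp add: dir_def)

lemma dir_shift: "dir (k + (m-1)) = - dir k"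
proof -
  have "pi * real (k + (m-1)) / real (m-1) = pi * real k / real (m-1) + pi"
    using m1 by (simp add: field_simps)
  thus ?thesis by (simp add: dir_def flip: cis_mult)
qed

lemma dir_roots: "bij_betw dir {..<2*(m-1)} {z. z^(2*(m-1)) = 1}"
proof -
  have eq: "(\<lambda>k. cis (2 * pi * real k / real (2*(m-1)))) = dir"
    unfolding dir_def by (intro ext arg_cong[of _ _ cis]) simp
  have "0 < 2 * (m-1)" using m1 by simp
  from Complex.bij_betw_roots_unity[OF this] show ?thesis unfolding eq .
qed

lemma dir_inj: "\<lbrakk>k < 2*(m-1); k' < 2*(m-1); dir k = dir k'\<rbrakk> \<Longrightarrow> k = k'"
  by (rule inj_onD[OF bij_betw_imp_inj_on[OF dir_roots]]) simp_all

lemma arg_in_ball: "0 \<le> r \<Longrightarrow> r < \<eta> \<Longrightarrow> dir k * of_real r \<in> ball 0 \<eta>"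
  by (simp add: norm_mult norm_dir)

lemma ray_in: "0 \<le> r \<Longrightarrow> r < \<eta> \<Longrightarrow> ray k r \<in> ball 0 \<rho>"
  unfolding ray_def by (rule B_in[OF arg_in_ball])

lemma sig_ray: "0 \<le> r \<Longrightarrow> r < \<eta> \<Longrightarrow> sig a (ray k r) = dir k * of_real r"
  unfolding ray_def by (rule sig_B[OF arg_in_ball])

lemma ray_D: "0 < r \<Longrightarrow> r < \<eta> \<Longrightarrow> ray k r \<in> D"
proof -
  assume r: "0 < r" "r < \<eta>"
  have "ray k r \<noteq> 0"
  proof
    assume "ray k r = 0"
    hence "dir k * of_real r = 0" using sig_ray[of r k] r by (simp add: sig_0)
    thus False using r norm_dir[of k] by auto
  qed
  thus "ray k r \<in> D" using ray_in[of r k] r by (simp add: D_def)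
qed

lemma time_ray:
  assumes "0 \<le> r" "r < \<eta>"
  shows "param_time a (ray k r) = of_real ((-1)^(k+1) * (2 / real (m-1) * r^(m-1)))"
  unfolding param_time_sig[OF a ray_in[OF assms]] sig_ray[OF assms] power_mult_distrib dir_power by simp

lemma rad_power: "rad s^(m-1) = real (m-1) * \<bar>s\<bar> / 2"
  unfolding rad_def using m1 by simp

lemma time_rad: "2 / real (m-1) * rad s^(m-1) = \<bar>s\<bar>"
  unfolding rad_power using m1 by simp

lemma rad_bounds: "s \<noteq> 0 \<Longrightarrow> \<bar>s\<bar> < \<epsilon> \<Longrightarrow> 0 < rad s \<and> rad s < \<eta>"
proof -
  assume s: "s \<noteq> 0" "\<bar>s\<bar> < \<epsilon>"
  have "rad s > 0" unfolding rad_def using m1 s(1) by simp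
  moreover have "rad s^(m-1) < \<eta>^(m-1)"
    using s(2) m1 unfolding rad_power \<epsilon> by (simp add: field_simps)
  hence "rad s < \<eta>" by (rule power_less_imp_less_base) (use \<eta> in simp)
  ultimately show ?thesis by simp
qed

lemma rad_time: "0 < r \<Longrightarrow> rad ((-1)^k * (2 / real (m-1) * r^(m-1))) = r"
proof -
  assume r: "0 < r"
  have "real (m-1) * \<bar>(-1)^k * (2 / real (m-1) * r^(m-1))\<bar> / 2 = r^(m-1)"
    using r m1 by (simp add: abs_mult power_abs)
  thus ?thesis unfolding rad_def using r m1 by (simp add: real_root_power_cancel)
qed

lemma time_in_times: "0 < r \<Longrightarrow> r < \<eta> \<Longrightarrow> (-1)^(k+1) * (2 / real (m-1) * r^(m-1)) \<in> times k"
proof -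
  assume r: "0 < r" "r < \<eta>"
  have "r^(m-1) < \<eta>^(m-1)" using r m1 by (intro power_strict_mono) auto
  hence "2 / real (m-1) * r^(m-1) < \<epsilon>" unfolding \<epsilon> using m1 by (intro mult_strict_left_mono) auto
  moreover have "2 / real (m-1) * r^(m-1) > 0" using r m1 by simp
  ultimately show ?thesis by (cases "even k") (auto simp: times_def)
qed

lemma times_abs: "s \<in> times k \<Longrightarrow> s \<noteq> 0 \<and> \<bar>s\<bar> < \<epsilon> \<and> (-1)^(k+1) * \<bar>s\<bar> = s"
  by (cases "even k") (auto simp: times_def)

lemma times_rad: "s \<in> times k \<Longrightarrow> 0 < rad s \<and> rad s < \<eta>"
  using times_abs rad_bounds by blast

lemma time_ray_rad:
  assumes s: "s \<in> times k"
  shows "param_time a (ray k (rad s)) = of_real s"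
proof -
  have "param_time a (ray k (rad s)) = of_real ((-1)^(k+1) * (2 / real (m-1) * rad s^(m-1)))"
    by (rule time_ray) (use times_rad[OF s] in auto)
  also have "(-1)^(k+1) * (2 / real (m-1) * rad s^(m-1)) = s"
    unfolding time_rad using times_abs[OF s] by blast
  finally show ?thesis .
qed

lemma rad_image: "rad ` times k = {0<..<\<eta>}"
proof (intro subset_antisym subsetI)
  fix r assume "r \<in> {0<..<\<eta>}"
  hence r: "0 < r" "r < \<eta>" by auto
  show "r \<in> rad ` times k" using rad_time[OF r(1), of "k+1"] time_in_times[OF r, of k] by force
qed (use times_rad in auto)

lemma ray_time_bij:
  "bij_betw (\<lambda>r. param_time a (ray k r)) {0<..<\<eta>} (of_real ` times k)"
proof (rule bij_betw_byWitness[where f' = "\<lambda>z. rad (Re z)"])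
  show "\<forall>r\<in>{0<..<\<eta>}. rad (Re (param_time a (ray k r))) = r"
  proof
    fix r assume "r \<in> {0<..<\<eta>}"
    hence r: "0 < r" "r < \<eta>" by auto
    have "param_time a (ray k r) = of_real ((-1)^(k+1) * (2 / real (m-1) * r^(m-1)))"
      by (rule time_ray) (use r in auto)
    thus "rad (Re (param_time a (ray k r))) = r"
      using rad_time[OF r(1), of "k+1"] by (simp only: Re_complex_of_real)
  qed
  show "\<forall>z\<in>of_real ` times k. param_time a (ray k (rad (Re z))) = z" using time_ray_rad by auto
  show "(\<lambda>r. param_time a (ray k r)) ` {0<..<\<eta>} \<subseteq> of_real ` times k"
  proof
    fix z assume "z \<in> (\<lambda>r. param_time a (ray k r)) ` {0<..<\<eta>}"
    then obtain r where r: "0 < r" "r < \<eta>" "z = param_time a (ray k r)" by auto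
    have eq: "param_time a (ray k r) = of_real ((-1)^(k+1) * (2 / real (m-1) * r^(m-1)))"
      by (rule time_ray) (use r in auto)
    show "z \<in> of_real ` times k"
      unfolding r(3) eq by (rule imageI[OF time_in_times[OF r(1,2)]])
  qed
  show "(\<lambda>z. rad (Re z)) ` of_real ` times k \<subseteq> {0<..<\<eta>}" using times_rad by auto
qed

lemma real_time_point:
  assumes \<theta>: "\<theta> \<in> D" and t: "param_time a \<theta> = of_real s" "\<bar>s\<bar> < \<epsilon>"
  obtains k where "k < 2*(m-1)" "s \<in> times k" "\<theta> = ray k (rad s)"
proof -
  have \<theta>b: "\<theta> \<in> ball 0 \<rho>" "\<theta> \<noteq> 0" using \<theta> by (auto simp: D_def)
  define u where "u = sig a \<theta>"
  have Bu: "B u = \<theta>" unfolding u_def by (rule B_sig[OF \<theta>]) (simp add: t)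
  have u0: "u \<noteq> 0" using Bu B_0 \<theta>b(2) by auto
  have s: "of_real s = - (2 / of_nat (m-1)) * u^(m-1)"
    using param_time_sig[OF a \<theta>b(1)] t(1) by (simp add: u_def)
  have s0: "s \<noteq> 0" using s u0 m1 by auto
  have upow: "u^(m-1) = of_real (- s * real (m-1) / 2)"
    using s m1 by (simp add: field_simps)
  have "cmod u^(m-1) = \<bar>- s * real (m-1) / 2\<bar>"
    using arg_cong[OF upow, of cmod] by (simp only: norm_power norm_of_real)
  also have "\<dots> = rad s^(m-1)" unfolding rad_power by (simp add: abs_mult mult.commute)
  finally have ur: "cmod u = rad s"
    by (rule power_eq_imp_eq_base) (use m1 rad_bounds[OF s0 t(2)] in auto)
  have r0: "rad s > 0" using rad_bounds[OF s0 t(2)] by blast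
  define c where "c = u / of_real (rad s)"
  have uc: "u = c * of_real (rad s)" using r0 by (simp add: c_def)
  have cpow: "c^(m-1) = of_real (- sgn s)"
  proof -
    have "c^(m-1) = of_real (- s * real (m-1) / 2) / of_real (rad s^(m-1))"
      unfolding c_def power_divide upow by simp
    also have "\<dots> = of_real (- s * real (m-1) / 2 / (real (m-1) * \<bar>s\<bar> / 2))"
      unfolding rad_power of_real_divide ..
    also have "- s * real (m-1) / 2 / (real (m-1) * \<bar>s\<bar> / 2) = - sgn s"
      using m1 s0 by (simp add: sgn_if)
    finally show ?thesis .
  qed
  have "c^(2*(m-1)) = (c^(m-1))^2" by (subst mult.commute) (rule power_mult)
  also have "\<dots> = 1" unfolding cpow using s0 by (auto simp: sgn_if)
  finally have "c \<in> {z. z^(2*(m-1)) = 1}" by simp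
  then obtain k where k: "k < 2*(m-1)" "c = dir k"
    using bij_betw_imp_surj_on[OF dir_roots] by (metis imageE lessThan_iff)
  have "(-1)^k = (of_real (- sgn s) :: complex)" using cpow dir_power[of k] by (simp add: k(2))
  hence "s \<in> times k" using s0 t(2)
    by (cases "even k") (auto simp: times_def sgn_if split: if_splits)
  moreover have "\<theta> = ray k (rad s)" using Bu by (simp add: ray_def uc k(2))
  ultimately show ?thesis using that k(1) by blast
qed

lemma real_time_set:
  "{\<theta>\<in>D. param_time a \<theta> \<in> \<real> \<and> cmod (param_time a \<theta>) < \<epsilon>} = (\<Union>k<2*(m-1). ray k ` {0<..<\<eta>})"
proof (intro subset_antisym subsetI)
  fix \<theta> assume "\<theta> \<in> {\<theta>\<in>D. param_time a \<theta> \<in> \<real> \<and> cmod (param_time a \<theta>) < \<epsilon>}"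
  then obtain s where s: "\<theta> \<in> D" "param_time a \<theta> = of_real s" "\<bar>s\<bar> < \<epsilon>"
    by (auto elim!: Reals_cases)
  obtain k where k: "k < 2*(m-1)" "s \<in> times k" "\<theta> = ray k (rad s)" by (rule real_time_point[OF s])
  have "\<theta> \<in> ray k ` {0<..<\<eta>}" unfolding k(3) using times_rad[OF k(2)] by simp
  thus "\<theta> \<in> (\<Union>k<2*(m-1). ray k ` {0<..<\<eta>})" using k(1) by blast
next
  fix \<theta> assume "\<theta> \<in> (\<Union>k<2*(m-1). ray k ` {0<..<\<eta>})"
  then obtain k r where r: "0 < r" "r < \<eta>" "\<theta> = ray k r" by auto
  have "param_time a \<theta> \<in> of_real ` times k"
    using bij_betw_imp_surj_on[OF ray_time_bij[of k]] r by auto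
  thus "\<theta> \<in> {\<theta>\<in>D. param_time a \<theta> \<in> \<real> \<and> cmod (param_time a \<theta>) < \<epsilon>}"
    using ray_D[OF r(1,2)] r(3) times_abs by auto
qed

lemma ray_eq_imp:
  assumes "0 < r" "r < \<eta>" "0 < r'" "r' < \<eta>" and eq: "dir k * of_real r = dir k' * of_real r'"
  shows "r = r'" "dir k = dir k'"
proof -
  have "cmod (dir k * of_real r) = cmod (dir k' * of_real r')" by (simp only: eq)
  thus rr: "r = r'" using assms(1-4) by (simp add: norm_mult norm_dir)
  show "dir k = dir k'" using eq assms(1) by (simp add: rr[symmetric])
qed

lemma rays_disjoint: "disjoint_family_on (\<lambda>k. ray k ` {0<..<\<eta>}) {..<2*(m-1)}"
  unfolding disjoint_family_on_def
proof (intro ballI impI)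
  fix k k' assume k: "k \<in> {..<2*(m-1)}" "k' \<in> {..<2*(m-1)}" "k \<noteq> k'"
  have False if r: "0 < r" "r < \<eta>" "0 < r'" "r' < \<eta>" "ray k r = ray k' r'" for r r'
  proof -
    have "dir k * of_real r = dir k' * of_real r'"
      using sig_ray[of r k] sig_ray[of r' k'] r by simp
    hence "dir k = dir k'" by (rule ray_eq_imp(2)[OF r(1-4)])
    thus False using dir_inj k by auto
  qed
  thus "ray k ` {0<..<\<eta>} \<inter> ray k' ` {0<..<\<eta>} = {}" by (auto simp: disjoint_iff)
qed

text \<open>
  For odd \<open>m\<close> opposite rays have the same image, because \<open>t\<close>, \<open>v\<close> and \<open>w\<close> are even functions of \<open>\<theta>\<close>
  while \<open>sig\<close> is odd.
\<close>
lemma branch_shift: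
  assumes m_odd: "odd m" and s: "s \<in> times k"
  shows "param a (ray (k + (m-1)) (rad s)) = param a (ray k (rad s))"
proof -
  define \<theta> where "\<theta> = ray k (rad s)"
  note rs = times_rad[OF s]
  have \<theta>: "\<theta> \<in> D" unfolding \<theta>_def using rs ray_D by blast
  hence m\<theta>: "- \<theta> \<in> D" by (simp add: D_def)
  have ev: "even (m-1)" "even (m+1)" using m_odd by simp_all
  have "param_time a (- \<theta>) = param_time a \<theta>" using ev by (simp add: param_time_def)
  also have "\<dots> = of_real s" unfolding \<theta>_def by (rule time_ray_rad[OF s])
  finally have "cmod (param_time a (- \<theta>)) < \<epsilon>" using times_abs[OF s] by simp
  from B_sig[OF m\<theta> this] have "B (- sig a \<theta>) = - \<theta>" by (simp add: sig_minus)
  moreover have "sig a \<theta> = dir k * of_real (rad s)" unfolding \<theta>_def using rs by (intro sig_ray) auto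
  ultimately have "ray (k + (m-1)) (rad s) = - \<theta>" unfolding ray_def dir_shift by simp
  moreover have "param a (- \<theta>) = param a \<theta>" using ev by (simp add: param_def)
  ultimately show ?thesis by (simp add: \<theta>_def)
qed

text \<open>
  The half cycle for odd \<open>m\<close> contains no two opposite rays, so its rays have different images.
\<close>
lemma branch_unique:
  assumes k: "k < 2 * wind_t m" "k' < 2 * wind_t m"
    and r: "0 < r" "r < \<eta>" "0 < r'" "r' < \<eta>"
    and eq: "param a (ray k r) = param a (ray k' r')"
  shows "k = k'"
proof -
  have pe: "ray k r^cover_deg = ray k' r'^cover_deg"
    by (rule param_eq_imp_power_eq[OF a _ _ eq]) (use r ray_in in auto)
  have sg: "sig a (ray k r) = dir k * of_real r" "sig a (ray k' r') = dir k' * of_real r'"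
    using r by (auto intro!: sig_ray)
  show ?thesis
  proof (cases "even m")
    case True
    hence "ray k r = ray k' r'" using pe by (simp add: cover_deg_def)
    hence "dir k * of_real r = dir k' * of_real r'" using sg by simp
    hence "dir k = dir k'" by (rule ray_eq_imp(2)[OF r])
    thus ?thesis using k True by (intro dir_inj) (auto simp: wind_t_def)
  next
    case False
    have wm: "2 * wind_t m = m - 1" using cover_deg_wind(1) False by (simp add: cover_deg_def)
    have "ray k r^2 = ray k' r'^2" using pe False by (simp add: cover_deg_def)
    hence "ray k r = ray k' r' \<or> ray k r = - ray k' r'" by (simp add: power2_eq_iff)
    thus ?thesis
    proof
      assume "ray k r = ray k' r'"
      hence "dir k * of_real r = dir k' * of_real r'" using sg by simp
      hence "dir k = dir k'" by (rule ray_eq_imp(2)[OF r])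
      thus ?thesis using k wm by (intro dir_inj) auto
    next
      assume "ray k r = - ray k' r'"
      hence "dir k * of_real r = dir (k' + (m-1)) * of_real r'"
        using sg unfolding dir_shift by (simp add: sig_minus)
      hence "dir k = dir (k' + (m-1))" by (rule ray_eq_imp(2)[OF r])
      hence "k = k' + (m-1)" using k wm m1 by (intro dir_inj) auto
      thus ?thesis using k wm by simp
    qed
  qed
qed

lemma times_interval: "open (times k)" "convex (times k)" "connected (times k)" "times k \<noteq> {}"
  using \<epsilon>_pos by (auto simp: times_def convex_real_interval)

lemma side_props:
  "side k \<noteq> bot" "\<forall>\<^sub>F s in side k. s \<in> times k" "((\<lambda>s. s) \<longlongrightarrow> 0) (side k)"
proof -
  show "side k \<noteq> bot" by (simp add: side_def trivial_limit_at_left_real trivial_limit_at_right_real)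
  show "\<forall>\<^sub>F s in side k. s \<in> times k"
    using eventually_at_left_real[of "-\<epsilon>" 0] eventually_at_right_real[of 0 \<epsilon>] \<epsilon>_pos
    by (auto simp: side_def times_def)
  show "((\<lambda>s. s) \<longlongrightarrow> 0) (side k)" by (simp add: side_def)
qed

lemma rad_continuous: "continuous_on UNIV rad"
  unfolding rad_def by (intro continuous_intros) auto

lemma branch_eq: "branch k = (\<lambda>s. param a (ray k (rad s))) ` times k"
  unfolding branch_def rad_image[of k, symmetric] image_image ..

lemma ray_rad_isCont:
  assumes s: "s \<in> insert 0 (times k)"
  shows "isCont (\<lambda>s. ray k (rad s)) s"
proof -
  have "rad 0 = 0" by (simp add: rad_def)
  hence "0 \<le> rad s" "rad s < \<eta>" using s times_rad[of s k] \<eta> by auto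
  hence in_ball: "dir k * of_real (rad s) \<in> ball 0 \<eta>" by (rule arg_in_ball)
  have "isCont rad s" using rad_continuous by (simp add: continuous_on_eq_continuous_at)
  hence c: "isCont (\<lambda>s. dir k * of_real (rad s)) s" by (intro continuous_intros)
  have "isCont B (dir k * of_real (rad s))"
    using holomorphic_on_imp_continuous_on[OF B_hol] in_ball by (simp add: continuous_on_eq_continuous_at)
  from isCont_o2[OF c this] show ?thesis by (simp add: ray_def)
qed

text \<open>
  Near each time the ray is the local inverse of \<open>param_time a\<close>, so the curve is the restriction
  of a holomorphic solution to real times.
\<close>
lemma branch_is_solution:
  "real_time_solution G (leaf a) (times k) (\<lambda>s. param a (ray k (rad s)))"
  "((\<lambda>s. param a (ray k (rad s))) \<longlongrightarrow> (0, 0)) (side k)"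
proof -
  define \<theta> where "\<theta> = (\<lambda>s. ray k (rad s))"
  have \<theta>D: "\<theta> s \<in> D" if "s \<in> times k" for s unfolding \<theta>_def using times_rad[OF that] ray_D by blast
  have t\<theta>: "param_time a (\<theta> s) = of_real s" if "s \<in> times k" for s
    unfolding \<theta>_def by (rule time_ray_rad[OF that])
  have "real_time_solution G (leaf a) (times k) (\<lambda>s. param a (\<theta> s))"
    unfolding real_time_solution_def
  proof (intro ballI conjI)
    fix s assume s: "s \<in> times k"
    show "param a (\<theta> s) \<in> leaf a" using \<theta>D[OF s] by (simp add: leaf_def)
    show "fst (param a (\<theta> s)) \<noteq> 0" by (rule param_fst_nz[OF a \<theta>D[OF s]])
    obtain r W g where rgW: "r > 0" "open W" "\<theta> s \<in> W" "W \<subseteq> D"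
      "g holomorphic_on ball (param_time a (\<theta> s)) r" "g ` ball (param_time a (\<theta> s)) r = W"
      "\<And>\<phi>. \<phi> \<in> W \<Longrightarrow> g (param_time a \<phi>) = \<phi> \<and> param_time a \<phi> \<in> ball (param_time a (\<theta> s)) r"
      and sol: "pendulum_solution G (ball (param_time a (\<theta> s)) r)
       (\<lambda>t. snd (param a (g t)) / fst (param a (g t))) (\<lambda>t. 1 / fst (param a (g t)))"
      using leaf_local_solution[OF a \<theta>D[OF s]] by blast
    have "isCont \<theta> s" unfolding \<theta>_def by (rule ray_rad_isCont) (use s in simp)
    hence "\<forall>\<^sub>F s' in nhds s. \<theta> s' \<in> W"
      using rgW(2,3) by (metis isCont_def tendsto_at_iff_tendsto_nhds topological_tendstoD)
    moreover have "\<forall>\<^sub>F s' in nhds s. s' \<in> times k"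
      by (rule eventually_nhds_in_open[OF times_interval(1) s])
    ultimately have "\<forall>\<^sub>F s' in nhds s. \<theta> s' = g (of_real s')"
      by eventually_elim (use rgW(7) t\<theta> in metis)
    then obtain V where V: "open V" "s \<in> V" "\<And>s'. s' \<in> V \<Longrightarrow> g (of_real s') = \<theta> s'"
      unfolding eventually_nhds by metis
    have "of_real s \<in> ball (param_time a (\<theta> s)) r" using rgW(1) t\<theta>[OF s] by simp
    hence d: "((\<lambda>t. snd (param a (g t)) / fst (param a (g t))) has_field_derivative
          1 / fst (param a (g (of_real s)))) (at (of_real s))"
      "((\<lambda>t. 1 / fst (param a (g t))) has_field_derivative
          poly (pderiv G) (snd (param a (g (of_real s))) / fst (param a (g (of_real s))))) (at (of_real s))"
      using sol unfolding pendulum_solution_def by blast+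
    show "((\<lambda>s. snd (param a (\<theta> s)) / fst (param a (\<theta> s))) has_vector_derivative 1 / fst (param a (\<theta> s))) (at s)"
      using has_vector_derivative_transform_within_open[OF has_vector_derivative_real_field[OF d(1)] V(1,2),
        of "\<lambda>s. snd (param a (\<theta> s)) / fst (param a (\<theta> s))"] V(2,3) by simp
    show "((\<lambda>s. 1 / fst (param a (\<theta> s))) has_vector_derivative
            poly (pderiv G) (snd (param a (\<theta> s)) / fst (param a (\<theta> s)))) (at s)"
      using has_vector_derivative_transform_within_open[OF has_vector_derivative_real_field[OF d(2)] V(1,2),
        of "\<lambda>s. 1 / fst (param a (\<theta> s))"] V(2,3) by simp
  qed
  thus "real_time_solution G (leaf a) (times k) (\<lambda>s. param a (ray k (rad s)))" by (simp add: \<theta>_def)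
  have \<theta>0: "\<theta> 0 = 0" by (simp add: \<theta>_def ray_def rad_def B_0)
  have "isCont \<theta> 0" unfolding \<theta>_def by (rule ray_rad_isCont) simp
  hence "((\<lambda>s. \<theta> s) \<longlongrightarrow> \<theta> 0) (side k)" by (rule isCont_tendsto_compose[OF _ side_props(3)])
  moreover have "isCont (param a) (\<theta> 0)"
    using param_continuous[OF a] \<rho>_pos by (simp add: continuous_on_eq_continuous_at \<theta>0)
  ultimately have "((\<lambda>s. param a (\<theta> s)) \<longlongrightarrow> param a (\<theta> 0)) (side k)"
    using isCont_tendsto_compose by blast
  thus "((\<lambda>s. param a (ray k (rad s))) \<longlongrightarrow> (0, 0)) (side k)" by (simp add: \<theta>_def \<theta>0[unfolded \<theta>_def] param_0)
qed

text \<open>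
  At each time a solution that blows up at \<open>0\<close> sits on one of the rays; by connectedness it
  cannot change the ray.
\<close>
lemma solution_is_branch:
  assumes \<phi>: "real_time_solution G (leaf a) (times b) \<phi>" "(\<phi> \<longlongrightarrow> (0, 0)) (side b)" and b: "b < 2"
  obtains j where "j < wind_t m" "\<phi> ` times b = branch (2 * j + b)"
proof -
  have tm: "times (2 * j + b) = times b" for j by (simp add: times_def)
  define C where "C k = {s \<in> times b. \<phi> s = param a (ray (2 * k + b) (rad s))}" for k
  have ex: "\<exists>j<wind_t m. s \<in> C j" if s: "s \<in> times b" for s
  proof -
    have "\<phi> s \<in> leaf a" using \<phi>(1) s by (simp add: real_time_solution_def)
    then obtain \<theta> where \<theta>: "\<theta> \<in> D" "\<phi> s = param a \<theta>" by (auto simp: leaf_def)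
    have "blowup_time (\<phi> s) = of_real s"
      by (rule real_solution_time[OF a times_interval(2,1) \<phi>(1) side_props \<phi>(2) s])
    hence t: "param_time a \<theta> = of_real s" using param_time_eq[OF a \<theta>(1)] \<theta>(2) by simp
    have s\<epsilon>: "\<bar>s\<bar> < \<epsilon>" using times_abs[OF s] by blast
    obtain k where k: "k < 2*(m-1)" "s \<in> times k" "\<theta> = ray k (rad s)"
      by (rule real_time_point[OF \<theta>(1) t s\<epsilon>])
    have "even k = even b" using s k(2) by (auto simp: times_def split: if_splits)
    then obtain k' where k': "k' < 2 * wind_t m" "even k' = even b" "\<phi> s = param a (ray k' (rad s))"
    proof (cases "k < 2 * wind_t m")
      case True
      thus ?thesis using that[of k] \<open>even k = even b\<close> \<theta>(2) k(3) by simp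
    next
      case False
      hence m_odd: "odd m" using k(1) by (auto simp: wind_t_def)
      hence wm: "2 * wind_t m = m - 1" using cover_deg_wind(1) by (simp add: cover_deg_def)
      define k' where "k' = k - (m-1)"
      have kk: "k = k' + (m-1)" using False wm by (simp add: k'_def)
      have ev: "even k' = even b" using \<open>even k = even b\<close> m_odd by (simp add: kk)
      hence "times k' = times b" by (simp add: times_def)
      hence "param a (ray k (rad s)) = param a (ray k' (rad s))"
        unfolding kk using s by (intro branch_shift[OF m_odd]) simp
      thus ?thesis using that[of k'] ev k(1,3) wm \<theta>(2) by (simp add: kk)
    qed
    define j where "j = k' div 2"
    have "k' = 2 * j + b" using k'(2) b unfolding j_def
      by (cases "b = 0") (auto elim!: evenE oddE)
    thus ?thesis using k' s by (intro exI[of _ j]) (auto simp: C_def)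
  qed
  obtain s0 where s0: "s0 \<in> times b" using times_interval(4) by blast
  obtain j where j: "j < wind_t m" "s0 \<in> C j" using ex[OF s0] by blast
  have cont_\<phi>: "continuous_on (times b) \<phi>"
    unfolding continuous_on_eq_continuous_within
  proof
    fix s assume s: "s \<in> times b"
    let ?x = "\<lambda>s. snd (\<phi> s) / fst (\<phi> s)" and ?y = "\<lambda>s. 1 / fst (\<phi> s)"
    have d: "fst (\<phi> s) \<noteq> 0" "(?x has_vector_derivative 1 / fst (\<phi> s)) (at s)"
      "(?y has_vector_derivative poly (pderiv G) (snd (\<phi> s) / fst (\<phi> s))) (at s)"
      using \<phi>(1) s unfolding real_time_solution_def by blast+
    have "continuous (at s) (\<lambda>s. (1 / ?y s, ?x s / ?y s))"
      using d(1) by (intro continuous_intros has_vector_derivative_continuous[OF d(2)]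
          has_vector_derivative_continuous[OF d(3)]) auto
    hence "continuous (at s within times b) (\<lambda>s. (1 / ?y s, ?x s / ?y s))"
      by (rule continuous_at_imp_continuous_at_within)
    thus "continuous (at s within times b) \<phi>"
    proof (rule continuous_transform_within[OF _ zero_less_one s])
      fix s' assume "s' \<in> times b"
      hence "fst (\<phi> s') \<noteq> 0" using \<phi>(1) unfolding real_time_solution_def by blast
      thus "(1 / ?y s', ?x s' / ?y s') = \<phi> s'" by simp
    qed
  qed
  have "times b \<subseteq> C j"
  proof (rule connected_finite_closed_cover[OF times_interval(3), where K = "{..<wind_t m}" and C = C])
    show "closedin (top_of_set (times b)) (C k)" for k
    proof -
      have "continuous_on (times b) (\<lambda>s. param a (ray (2 * k + b) (rad s)))"
      proof (rule continuous_on_compose2[OF param_continuous[OF a]])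
        show "continuous_on (times b) (\<lambda>s. ray (2 * k + b) (rad s))"
          by (intro continuous_at_imp_continuous_on ballI ray_rad_isCont) (simp add: tm)
        show "(\<lambda>s. ray (2 * k + b) (rad s)) ` times b \<subseteq> ball 0 \<rho>"
          using times_rad ray_in by (force simp: less_imp_le)
      qed
      from continuous_closedin_preimage[OF continuous_on_diff[OF cont_\<phi> this] closed_singleton[of 0]]
      show ?thesis by (rule back_subst[of "closedin _"]) (auto simp: C_def)
    qed
    show "times b \<subseteq> (\<Union>k<wind_t m. C k)" using ex by blast
    show "C k \<inter> C k' = {}" if "k \<in> {..<wind_t m}" "k' \<in> {..<wind_t m}" "k \<noteq> k'" for k k'
    proof -
      have False if "s \<in> C k" "s \<in> C k'" for s
      proof -
        have s: "s \<in> times b" "param a (ray (2 * k + b) (rad s)) = param a (ray (2 * k' + b) (rad s))"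
          using that by (auto simp: C_def)
        have "2 * k + b = 2 * k' + b"
          by (rule branch_unique[OF _ _ _ _ _ _ s(2)])
             (use times_rad[OF s(1)] \<open>k \<in> {..<wind_t m}\<close> \<open>k' \<in> {..<wind_t m}\<close> b in auto)
        thus False using \<open>k \<noteq> k'\<close> by simp
      qed
      thus ?thesis by blast
    qed
  qed (use j s0 in auto)
  hence "\<phi> ` times b = branch (2 * j + b)"
    unfolding branch_eq tm C_def by (intro image_cong) auto
  thus ?thesis using that j(1) by blast
qed

lemma branches_bij:
  assumes b: "b < 2"
  shows "bij_betw (\<lambda>j. branch (2 * j + b)) {..<wind_t m}
    {\<phi> ` times b | \<phi>. real_time_solution G (leaf a) (times b) \<phi> \<and> (\<phi> \<longlongrightarrow> (0, 0)) (side b)}"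
proof (rule bij_betwI')
  fix j j' assume j: "j \<in> {..<wind_t m}" "j' \<in> {..<wind_t m}"
  have "j = j'" if eq: "branch (2 * j + b) = branch (2 * j' + b)"
  proof -
    have \<eta>2: "\<eta> / 2 \<in> {0<..<\<eta>}" using \<eta> by simp
    hence "param a (ray (2 * j + b) (\<eta> / 2)) \<in> branch (2 * j + b)"
      unfolding branch_def by (rule imageI)
    hence "param a (ray (2 * j + b) (\<eta> / 2)) \<in> branch (2 * j' + b)"
      unfolding eq .
    then obtain r where r: "0 < r" "r < \<eta>" "param a (ray (2 * j + b) (\<eta> / 2)) = param a (ray (2 * j' + b) r)"
      by (auto simp: branch_def)
    have "2 * j + b = 2 * j' + b"
      by (rule branch_unique[OF _ _ _ _ _ _ r(3)]) (use r \<eta>2 j b in auto)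
    thus ?thesis by simp
  qed
  thus "(branch (2 * j + b) = branch (2 * j' + b)) = (j = j')" by blast
next
  fix j assume "j \<in> {..<wind_t m}"
  have "times (2 * j + b) = times b" "side (2 * j + b) = side b" by (simp_all add: times_def side_def)
  thus "branch (2 * j + b) \<in> {\<phi> ` times b | \<phi>. real_time_solution G (leaf a) (times b) \<phi> \<and> (\<phi> \<longlongrightarrow> (0, 0)) (side b)}"
    unfolding branch_eq using branch_is_solution[of "2 * j + b"] by auto
next
  fix X assume "X \<in> {\<phi> ` times b | \<phi>. real_time_solution G (leaf a) (times b) \<phi> \<and> (\<phi> \<longlongrightarrow> (0, 0)) (side b)}"
  then obtain \<phi> where \<phi>: "X = \<phi> ` times b" "real_time_solution G (leaf a) (times b) \<phi>" "(\<phi> \<longlongrightarrow> (0, 0)) (side b)"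
    by blast
  obtain j where "j < wind_t m" "\<phi> ` times b = branch (2 * j + b)"
    by (rule solution_is_branch[OF \<phi>(2,3) b])
  thus "\<exists>j\<in>{..<wind_t m}. X = branch (2 * j + b)" using \<phi>(1) by auto
qed

lemma ray_holomorphic:
  "(\<lambda>u. B (dir k * u)) holomorphic_on ball 0 \<eta>" "(\<lambda>u. B (dir k * u)) ` ball 0 \<eta> \<subseteq> ball 0 \<rho>"
proof -
  have im: "(\<lambda>u. dir k * u) ` ball 0 \<eta> \<subseteq> ball 0 \<eta>" by (auto simp: norm_mult norm_dir)
  have "(\<lambda>u. dir k * u) holomorphic_on ball 0 \<eta>" by (intro holomorphic_intros)
  from holomorphic_on_compose_gen[OF this B_hol im]
  show "(\<lambda>u. B (dir k * u)) holomorphic_on ball 0 \<eta>" by (simp add: o_def)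
  show "(\<lambda>u. B (dir k * u)) ` ball 0 \<eta> \<subseteq> ball 0 \<rho>" using im B_in by blast
qed

lemma ray_deriv: "deriv (\<lambda>u. B (dir k * u)) 0 = cis (pi * real k / real (m-1))"
proof (rule DERIV_imp_deriv)
  have "(B has_field_derivative 1) (at (dir k * 0))"
    using holomorphic_derivI[OF B_hol open_ball, of 0] \<eta> by (simp add: B_deriv)
  moreover have "((\<lambda>u. dir k * u) has_field_derivative dir k) (at 0)"
    by (auto intro!: derivative_eq_intros)
  ultimately have "((\<lambda>u. B (dir k * u)) has_field_derivative 1 * dir k) (at 0)"
    by (rule DERIV_chain2)
  thus "((\<lambda>u. B (dir k * u)) has_field_derivative cis (pi * real k / real (m-1))) (at 0)"
    by (simp add: dir_def)
qed

lemma blowup_branches_bij: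
  "bij_betw (\<lambda>j. (\<lambda>r. param a (ray (2*j) r)) ` {0<..<\<eta>}) {..<wind_t m} (blowup_branches G (leaf a) \<epsilon>)"
  using branches_bij[of 0] by (simp add: blowup_branches_def times_def side_def branch_def)

lemma blowdown_branches_bij:
  "bij_betw (\<lambda>j. (\<lambda>r. param a (ray (2*j+1) r)) ` {0<..<\<eta>}) {..<wind_t m} (blowdown_branches G (leaf a) \<epsilon>)"
  using branches_bij[of 1] by (simp add: blowdown_branches_def times_def side_def branch_def)

end

context pendulum_polydisc
begin

text \<open>
  Small times force small \<open>\<theta>\<close>, since \<open>\<bar>N\<bar> \<ge> 1/2\<close> bounds \<open>\<bar>t\<bar>\<close> from below by a multiple of
  \<open>\<bar>\<theta>\<bar>\<^sup>m\<^sup>-\<^sup>1\<close> on the whole disc; so the local inverse of \<open>sig a\<close> near \<open>0\<close> catches all of them.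
\<close>
lemma blowup_star_exists:
  assumes a: "a \<in> A"
  obtains \<epsilon>0 where "\<epsilon>0 > 0"
    "\<And>\<epsilon>. \<epsilon> \<in> {0<..<\<epsilon>0} \<Longrightarrow> \<exists>B \<eta>. blowup_star m G r0 r1 F S N R \<delta> a B \<eta> \<epsilon>"
proof -
  have m1: "real (m-1) > 0" "0 < m - 1" using m by auto
  have z0: "0 \<in> ball (0::complex) \<rho>" using \<rho>_pos by simp
  have d0: "deriv (sig a) 0 \<noteq> 0" by (simp add: sig_deriv_0[OF a])
  obtain r W g where g: "r > 0" "open W" "0 \<in> W" "W \<subseteq> ball 0 \<rho>" "sig a ` W = ball (sig a 0) r"
    "g holomorphic_on ball (sig a 0) r" "g ` ball (sig a 0) r = W"
    "\<And>y. y \<in> ball (sig a 0) r \<Longrightarrow> sig a (g y) = y" "\<And>z. z \<in> W \<Longrightarrow> g (sig a z) = z"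
    "\<And>y. y \<in> ball (sig a 0) r \<Longrightarrow> deriv (sig a) (g y) \<noteq> 0"
    "\<And>y. y \<in> ball (sig a 0) r \<Longrightarrow> (g has_field_derivative 1 / deriv (sig a) (g y)) (at y)"
    using holomorphic_local_inverse[OF sig_holomorphic[OF a] open_ball z0 d0] by blast
  obtain q where q: "q > 0" "ball 0 q \<subseteq> W" using g(2,3) by (meson open_contains_ball)
  define \<epsilon>0 where "\<epsilon>0 = min (2 / real (m-1) * r^(m-1)) (q^(m-1) / real (m-1))"
  show ?thesis
  proof (rule that[of \<epsilon>0])
    show "\<epsilon>0 > 0" using m1 g(1) q(1) by (simp add: \<epsilon>0_def)
    fix \<epsilon> assume "\<epsilon> \<in> {0<..<\<epsilon>0}"
    hence \<epsilon>: "0 < \<epsilon>" "\<epsilon> < 2 / real (m-1) * r^(m-1)" "\<epsilon> < q^(m-1) / real (m-1)"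
      by (auto simp: \<epsilon>0_def)
    define \<eta> where "\<eta> = root (m-1) (real (m-1) * \<epsilon> / 2)"
    have \<eta>: "\<eta> > 0" unfolding \<eta>_def using m1 \<epsilon>(1) by simp
    have \<eta>p: "\<eta>^(m-1) = real (m-1) * \<epsilon> / 2" unfolding \<eta>_def using m1 \<epsilon>(1) by simp
    have "\<eta>^(m-1) < r^(m-1)" unfolding \<eta>p using \<epsilon>(2) m1 by (simp add: field_simps)
    hence \<eta>r: "\<eta> < r" by (rule power_less_imp_less_base) (use g(1) in simp)
    hence sub: "ball 0 \<eta> \<subseteq> ball (sig a 0) r" by (simp add: sig_0 subset_ball)
    have g0: "g 0 = 0" using g(9)[OF g(3)] by (simp add: sig_0)
    have "blowup_star m G r0 r1 F S N R \<delta> a g \<eta> \<epsilon>"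
    proof
      show "a \<in> A" "0 < \<eta>" by (fact a \<eta>)+
      show "\<epsilon> = 2 / real (m-1) * \<eta>^(m-1)" unfolding \<eta>p using m1 by simp
      show "g holomorphic_on ball 0 \<eta>" using g(6) sub by (rule holomorphic_on_subset)
      show "g 0 = 0" by (rule g0)
      have "0 \<in> ball (sig a 0) r" using g(1) by (simp add: sig_0)
      from DERIV_imp_deriv[OF g(11)[OF this]] show "deriv g 0 = 1"
        by (simp add: g0 sig_deriv_0[OF a])
      show "g u \<in> ball 0 \<rho>" "sig a (g u) = u" if "u \<in> ball 0 \<eta>" for u
        using that sub g(4,7,8) by blast+
      show "g (sig a \<theta>) = \<theta>" if \<theta>: "\<theta> \<in> D" "cmod (param_time a \<theta>) < \<epsilon>" for \<theta>
      proof -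
        have \<theta>b: "\<theta> \<in> ball 0 \<rho>" using \<theta>(1) by (simp add: D_def)
        define n where "n = cmod (N (S (a * \<theta>^2)))"
        have "cmod (N (S (a * \<theta>^2)) - 1) < 1 / 2" using N_near S_in arg_in[OF a \<theta>b] by blast
        moreover have "cmod 1 \<le> cmod (N (S (a * \<theta>^2)) - 1) + n"
          unfolding n_def by (metis norm_minus_commute diff_add_cancel norm_triangle_ineq)
        ultimately have n: "n \<ge> 1 / 2" by simp
        have "cmod (param_time a \<theta>) = 2 / real (m-1) * cmod \<theta>^(m-1) * n"
          by (simp add: param_time_def norm_mult norm_divide norm_power n_def del: of_nat_diff)
        moreover have "2 / real (m-1) * cmod \<theta>^(m-1) * (1 / 2) \<le> 2 / real (m-1) * cmod \<theta>^(m-1) * n"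
          by (rule mult_left_mono[OF n]) simp
        ultimately have "1 / real (m-1) * cmod \<theta>^(m-1) < q^(m-1) / real (m-1)"
          using \<theta>(2) \<epsilon>(3) by simp
        hence "cmod \<theta>^(m-1) < q^(m-1)" using m1 by (simp add: divide_less_cancel)
        hence "cmod \<theta> < q" by (rule power_less_imp_less_base) (use q(1) in simp)
        thus ?thesis using q(2) g(9) by auto
      qed
    qed
    thus "\<exists>B \<eta>. blowup_star m G r0 r1 F S N R \<delta> a B \<eta> \<epsilon>" by blast
  qed
qed

end


section \<open>The theorem\<close>

theorem theorem10p3:
  fixes m :: nat and G :: "complex poly"
  assumes m: "m \<ge> 2" and deg: "degree G = m + 1"
  shows
    \<comment> \<open>(i) the projective Hamiltonians and the homogenized force\<close>
    "(\<forall>u z. u \<noteq> 0 \<longrightarrow> Huz m G u z = u^(m+1) * Hxy G (1/u) (z/u) \<and>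
                      homogenize m (pderiv G) u 1 = u^m * poly (pderiv G) (1/u)) \<and>
     (\<forall>v w. v \<noteq> 0 \<longrightarrow> Hvw m G v w = v^(m+1) * Hxy G (w/v) (1/v) \<and>
                      homogenize m (pderiv G) v w = v^m * poly (pderiv G) (w/v)) \<and>
     \<comment> \<open>(i) the two forms of the vector fields on the zero energy level\<close>
     (\<forall>u z. Huz m G u z = 0 \<longrightarrow>
        uz_field m G (u, z) = (- u * deriv (\<lambda>z. Huz m G u z) z, u * deriv (\<lambda>u. Huz m G u z) u)) \<and>
     (\<forall>v w. Hvw m G v w = 0 \<longrightarrow>
        vw_field m G (v, w) = (v * deriv (\<lambda>w. Hvw m G v w) w, - v * deriv (\<lambda>v. Hvw m G v w) v)) \<and>
     \<comment> \<open>(i) transformation of the ODE, with original time as a function of \<open>t\<^sub>1\<close>\<close>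
     (\<forall>S t x y. open S \<and> inj_on t S \<and>
        (\<forall>s\<in>S. x (t s) \<noteq> 0 \<and> Hxy G (x (t s)) (y (t s)) = 0 \<and>
               (t has_field_derivative (1 / x (t s))^(m-1)) (at s)) \<longrightarrow>
        (pendulum_solution G (t ` S) x y \<longleftrightarrow>
         (\<forall>s\<in>S.
           ((\<lambda>s. 1 / x (t s)) has_field_derivative
              fst (uz_field m G (1 / x (t s), y (t s) / x (t s)))) (at s) \<and>
           ((\<lambda>s. y (t s) / x (t s)) has_field_derivative
              snd (uz_field m G (1 / x (t s), y (t s) / x (t s)))) (at s)))) \<and>
     \<comment> \<open>(i) transformation of the ODE, with original time as a function of \<open>t\<^sub>2\<close>\<close>
     (\<forall>S t x y. open S \<and> inj_on t S \<and>
        (\<forall>s\<in>S. y (t s) \<noteq> 0 \<and> Hxy G (x (t s)) (y (t s)) = 0 \<and>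
               (t has_field_derivative (1 / y (t s))^(m-1)) (at s)) \<longrightarrow>
        (pendulum_solution G (t ` S) x y \<longleftrightarrow>
         (\<forall>s\<in>S.
           ((\<lambda>s. 1 / y (t s)) has_field_derivative
              fst (vw_field m G (1 / y (t s), x (t s) / y (t s)))) (at s) \<and>
           ((\<lambda>s. x (t s) / y (t s)) has_field_derivative
              snd (vw_field m G (1 / y (t s), x (t s) / y (t s)))) (at s)))) \<and>
     \<comment> \<open>(ii) equilibria at the points \<open>[\<xi>:\<eta>:0]\<close> at infinity\<close>
     (\<forall>\<xi> \<eta>. (\<xi>, \<eta>) \<noteq> (0, 0) \<longrightarrow>
        (\<xi> \<noteq> 0 \<longrightarrow> uz_field m G (0, \<eta>/\<xi>) \<noteq> 0) \<and>
        (\<eta> \<noteq> 0 \<longrightarrow> (vw_field m G (0, \<xi>/\<eta>) = 0 \<longleftrightarrow> \<xi> = 0))) \<and>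
     (m \<ge> 3 \<longrightarrow> (vw_field m G has_derivative (\<lambda>_. 0)) (at (0, 0))) \<and>
     \<comment> \<open>(ii)--(vii) local leafs in all sufficiently small polydiscs around \<open>v = w = 0\<close>\<close>
     (\<exists>R0>0. \<forall>R\<in>{0<..<R0}. \<exists>\<delta>0>0. \<forall>\<delta>\<in>{0<..<\<delta>0}.
       let U = ball 0 R \<times> ball 0 \<delta>;
           \<rho> = root (m-1) \<delta>;
           D = ball 0 \<rho> - {0};
           A = {a. a^(m-1) = 2 * lead_coeff G};
           cyc = (if even m then 1 else 1/2)
       in
       \<exists>\<Lambda>. 
         \<comment> \<open>\<open>\<Lambda> a\<close> is the leaf with expansion coefficient \<open>a\<close>\<close>
         {L. local_leaf m G U L} = \<Lambda> ` A \<and>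
         (\<forall>a\<in>A. - a \<in> A \<longleftrightarrow> odd m) \<and>
         \<comment> \<open>(v) a single leaf, or two leafs\<close>
         (even m \<longrightarrow> (\<exists>!L. local_leaf m G U L)) \<and>
         (odd m \<longrightarrow> card {L. local_leaf m G U L} = 2 \<and>
            (\<forall>a\<in>A. a^((m-1) div 2) = csqrt (2 * lead_coeff G) \<or>
                    a^((m-1) div 2) = - csqrt (2 * lead_coeff G)) \<and>
            (\<forall>a\<in>A. \<forall>a'\<in>A. \<Lambda> a = \<Lambda> a' \<longleftrightarrow> a^((m-1) div 2) = a'^((m-1) div 2))) \<and>
         (m mod 4 = 3 \<longrightarrow> (\<forall>a\<in>A. {L. local_leaf m G U L} = {\<Lambda> a, \<Lambda> (- a)} \<and> \<Lambda> a \<noteq> \<Lambda> (- a))) \<and>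
         (\<forall>a\<in>A. \<exists>e t.
            let L = \<Lambda> a;
                P = (\<lambda>\<theta>. (a * \<theta>^(m+1) * (1 + e \<theta>), \<theta>^(m-1)))
            in
            \<comment> \<open>(ii) the equilibrium is in the closure of the leaf\<close>
            (0, 0) \<in> closure L \<and> closure L \<inter> U = insert (0, 0) L \<and>
            \<comment> \<open>(iii) analytic expansion\<close>
            e holomorphic_on ball 0 \<rho> \<and> e 0 = 0 \<and> L = P ` D \<and>
            t holomorphic_on ball 0 \<rho> \<and> t 0 = 0 \<and> original_time_along G D t P \<and>
            (\<exists>h. h holomorphic_on ball 0 \<rho> \<and> h 0 = 0 \<and>
               (\<forall>\<theta>\<in>ball 0 \<rho>. deriv t \<theta> =
                  - (2 / of_nat (m-1)) * (1 + h \<theta>) * deriv (\<lambda>\<theta>. snd (P \<theta>)) \<theta>)) \<and>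
            \<comment> \<open>(iv) expansion of time, and minimal blow-up loops\<close>
            (\<exists>k. k holomorphic_on ball 0 \<rho> \<and> k 0 = 0 \<and>
               (\<forall>\<theta>\<in>ball 0 \<rho>. t \<theta> = - (2 / of_nat (m-1)) * \<theta>^(m-1) * (1 + k \<theta>))) \<and>
            (\<forall>\<gamma>. path \<gamma> \<and> path_image \<gamma> \<subseteq> D \<and> winding_number \<gamma> 0 = cyc \<longrightarrow>
               minimal_blowup_loop G L (t \<circ> \<gamma>) (P \<circ> \<gamma>) \<and>
               \<comment> \<open>(v) winding numbers\<close>
               winding_number (t \<circ> \<gamma>) 0 = of_nat (wind_t m) \<and>
               winding_number (snd \<circ> P \<circ> \<gamma>) 0 = of_nat (wind_t m) \<and>
               winding_number (fst \<circ> P \<circ> \<gamma>) 0 = of_nat (wind_v m)) \<and>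
            \<comment> \<open>(v) the loop does not close up earlier\<close>
            (\<forall>\<theta>\<in>D. \<forall>s\<in>{0<..<1}. P (\<theta> * exp (2 * pi * \<i> * cyc * of_real s)) \<noteq> P \<theta>) \<and>
            \<comment> \<open>(vi) the Riemann surface\<close>
            (\<exists>\<A>. riemann_surface (insert (0, 0) L) \<A> \<and>
               holomorphic_in_charts \<A> fst \<and> holomorphic_in_charts \<A> snd \<and>
               branch_point \<A> fst (0, 0) \<and>
               has_ramification_index \<A> fst (0, 0) (wind_v m) \<and>
               has_ramification_index \<A> snd (0, 0) (wind_t m)) \<and>
            \<comment> \<open>(vii) the blow-up star; \<open>\<beta> k\<close> leaves \<open>0\<close> in direction \<open>\<pi> k/(m-1)\<close>, it is a blow-up
                branch for even \<open>k\<close> and a blow-down branch for odd \<open>k\<close>\<close>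
            (\<exists>\<epsilon>0>0. \<forall>\<epsilon>\<in>{0<..<\<epsilon>0}. \<exists>\<eta>>0. \<exists>\<beta>.
               (\<forall>k<2*(m-1).
                  \<beta> k holomorphic_on ball 0 \<eta> \<and> \<beta> k ` ball 0 \<eta> \<subseteq> ball 0 \<rho> \<and>
                  \<beta> k 0 = 0 \<and> deriv (\<beta> k) 0 = cis (pi * real k / real (m-1)) \<and>
                  bij_betw (\<lambda>r. t (\<beta> k (of_real r))) {0<..<\<eta>}
                    (of_real ` (if even k then {-\<epsilon><..<0} else {0<..<\<epsilon>}))) \<and>
               disjoint_family_on (\<lambda>k. (\<lambda>r. \<beta> k (of_real r)) ` {0<..<\<eta>}) {..<2*(m-1)} \<and>
               {\<theta>\<in>D. t \<theta> \<in> \<real> \<and> norm (t \<theta>) < \<epsilon>} =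
                 (\<Union>k<2*(m-1). (\<lambda>r. \<beta> k (of_real r)) ` {0<..<\<eta>}) \<and>
               \<comment> \<open>indices \<open>k < 2 * wind_t m\<close>: the full cycle for even \<open>m\<close>, the half cycle for odd \<open>m\<close>\<close>
               bij_betw (\<lambda>j. (\<lambda>r. P (\<beta> (2*j) (of_real r))) ` {0<..<\<eta>})
                 {..<wind_t m} (blowup_branches G L \<epsilon>) \<and>
               bij_betw (\<lambda>j. (\<lambda>r. P (\<beta> (2*j+1) (of_real r))) ` {0<..<\<eta>})
                 {..<wind_t m} (blowdown_branches G L \<epsilon>))))"
proof -
  obtain r0 r1 F S N where data: "puiseux_data m G r0 r1 F S N"
    using puiseux_data_exists[OF m deg] by blast
  obtain R0 where R0: "R0 > 0"
    "\<And>R. R \<in> {0<..<R0} \<Longrightarrow> \<exists>\<delta>0>0. \<forall>\<delta>\<in>{0<..<\<delta>0}. pendulum_polydisc m G r0 r1 F S N R \<delta>"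
    using pendulum_polydisc_exists[OF data] by blast
  have small: "\<exists>R0>0. \<forall>R\<in>{0<..<R0}. \<exists>\<delta>0>0. \<forall>\<delta>\<in>{0<..<\<delta>0}. P R \<delta>"
    if "\<And>R \<delta>. pendulum_polydisc m G r0 r1 F S N R \<delta> \<Longrightarrow> P R \<delta>" for P
  proof (rule exI[of _ R0], intro conjI R0(1) ballI)
    fix R assume "R \<in> {0<..<R0}"
    from R0(2)[OF this] that show "\<exists>\<delta>0>0. \<forall>\<delta>\<in>{0<..<\<delta>0}. P R \<delta>" by blast
  qed
  show ?thesis
  proof (intro conjI, goal_cases)
    case 1
    show ?case
      using Huz_eq[OF m deg] homogenize_eq[of _ "pderiv G" m 1] deg by (simp add: degree_pderiv)
  next
    case 2
    show ?case
      using Hvw_eq[OF m deg] homogenize_eq[of _ "pderiv G" m] deg by (simp add: degree_pderiv)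
  next
    case 3
    show ?case using uz_field_hamiltonian[OF m] by blast
  next
    case 4
    show ?case using vw_field_hamiltonian[OF m] by blast
  next
    case 5
    show ?case by (intro allI impI, elim conjE, rule pendulum_uz_iff[OF m deg]) auto
  next
    case 6
    show ?case by (intro allI impI, elim conjE, rule pendulum_vw_iff[OF m deg]) auto
  next
    case 7
    show ?case
      using uz_field_infinity_nonzero[OF m deg] vw_field_infinity_eq_0_iff[OF m deg] by simp
  next
    case 8
    show ?case using vw_field_linearization by blast
  next
    case 9
    show ?case
    proof (rule small, goal_cases)
      case (1 R \<delta>)
      then interpret pendulum_polydisc m G r0 r1 F S N R \<delta> .
      have A_minus: "\<forall>a\<in>A. - a \<in> A \<longleftrightarrow> odd m" using minus_in_A_iff by blast
      have even: "even m \<longrightarrow> (\<exists>!L. local_leaf m G U L)" using leaf_unique_even by blast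
      have odd: "odd m \<longrightarrow> card {L. local_leaf m G U L} = 2 \<and>
              (\<forall>a\<in>A. a^((m-1) div 2) = csqrt (2 * lead_coeff G) \<or>
                      a^((m-1) div 2) = - csqrt (2 * lead_coeff G)) \<and>
              (\<forall>a\<in>A. \<forall>a'\<in>A. leaf a = leaf a' \<longleftrightarrow> a^((m-1) div 2) = a'^((m-1) div 2))"
        using leafs_card_odd A_odd leaf_eq_odd by blast
      have opposite: "m mod 4 = 3 \<longrightarrow>
          (\<forall>a\<in>A. {L. local_leaf m G U L} = {leaf a, leaf (- a)} \<and> leaf a \<noteq> leaf (- a))"
        using leafs_opposite by blast
      show ?case
      proof ((subst Let_def)+, fold \<rho>_def, fold D_def A_def, rule exI[of _ leaf],
          intro conjI leafs_eq A_minus even odd opposite ballI, goal_cases)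
        case (1 a)
        hence a: "a \<in> A" .
        define e where "e = (\<lambda>\<theta>. F (S (a * \<theta>^2)) - 1)"
        have P_eq: "(a * \<theta>^(m+1) * (1 + e \<theta>), \<theta>^(m-1)) = param a \<theta>" for \<theta>
          by (simp add: param_def e_def)
        have e: "e holomorphic_on ball 0 \<rho>" "e 0 = 0"
          unfolding e_def by (intro holomorphic_intros param_holomorphic[OF a]) (simp add: S_0 F_0)
        have t0: "param_time a 0 = 0" using m by (simp add: param_time_def power_0_left)
        obtain \<epsilon>0 where \<epsilon>0: "\<epsilon>0 > 0"
          "\<And>\<epsilon>. \<epsilon> \<in> {0<..<\<epsilon>0} \<Longrightarrow> \<exists>B \<eta>. blowup_star m G r0 r1 F S N R \<delta> a B \<eta> \<epsilon>"
          using blowup_star_exists[OF a] by blast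
        have star: "\<exists>\<epsilon>0>0. \<forall>\<epsilon>\<in>{0<..<\<epsilon>0}. P \<epsilon>"
          if "\<And>\<epsilon> B \<eta>. blowup_star m G r0 r1 F S N R \<delta> a B \<eta> \<epsilon> \<Longrightarrow> P \<epsilon>" for P
          using \<epsilon>0 that by blast
        have loops: "\<forall>\<gamma>. path \<gamma> \<and> path_image \<gamma> \<subseteq> D \<and> winding_number \<gamma> 0 = (if even m then 1 else 1/2) \<longrightarrow>
                 minimal_blowup_loop G (leaf a) (param_time a \<circ> \<gamma>) (param a \<circ> \<gamma>) \<and>
                 winding_number (param_time a \<circ> \<gamma>) 0 = of_nat (wind_t m) \<and>
                 winding_number (snd \<circ> param a \<circ> \<gamma>) 0 = of_nat (wind_t m) \<and>
                 winding_number (fst \<circ> param a \<circ> \<gamma>) 0 = of_nat (wind_v m)"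
          using param_loop[OF a _ _ refl] by blast
        have early: "\<forall>\<theta>\<in>D. \<forall>s\<in>{0<..<1}.
            param a (\<theta> * exp (2 * pi * \<i> * (if even m then 1 else 1/2) * of_real s)) \<noteq> param a \<theta>"
          using loop_not_closed_early[OF a] by blast
        show ?case
        proof (rule exI[of _ e], rule exI[of _ "param_time a"], unfold P_eq,
            intro conjI closure_leaf[OF a] e leaf_def param_time_holomorphic[OF a] t0 original_time[OF a]
              param_time_deriv_expansion[OF a] param_time_expansion[OF a] loops early
              closure_leaf_riemann_surface[OF a], rule star, goal_cases)
          case (1 \<epsilon> B \<eta>)
          then interpret blowup_star m G r0 r1 F S N R \<delta> a B \<eta> \<epsilon> .
          have rays: "\<forall>k<2*(m-1). (\<lambda>u. B (dir k * u)) holomorphic_on ball 0 \<eta> \<and>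
               (\<lambda>u. B (dir k * u)) ` ball 0 \<eta> \<subseteq> ball 0 \<rho> \<and> B (dir k * 0) = 0 \<and>
               deriv (\<lambda>u. B (dir k * u)) 0 = cis (pi * real k / real (m-1)) \<and>
               bij_betw (\<lambda>r. param_time a (ray k r)) {0<..<\<eta>}
                  (of_real ` (if even k then {-\<epsilon><..<0} else {0<..<\<epsilon>}))"
            using ray_holomorphic ray_deriv ray_time_bij[unfolded times_def] B_0 by simp
          show ?case
            by (rule exI[of _ \<eta>], rule conjI[OF \<eta>], rule exI[of _ "\<lambda>k u. B (dir k * u)"],
                fold ray_def, intro conjI rays rays_disjoint real_time_set blowup_branches_bij blowdown_branches_bij)
        qed
      qed
    qed
  qed
qed

end
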